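(* Let $m$ and $n$ be positive integers, let $\mathcal{A}=\{(a_1,a_2)\in\mathbb{Z}^2: 0\le a_1\le m,\ 0\le a_2\le n\}$, let $c_{ia}$ ($i=1,2,3,4$, $a\in\mathcal{A}$) be indeterminates, and let $F_i=\sum_{a\in\mathcal{A}}c_{ia}x_1^{a_1}x_2^{a_2}$ for $i=1,2,3,4$. Let $F_{m,n}$ be the $4mn\times 4mn$ matrix, in the monomial bases, of the linear map $S_{m-1,n-1}^4\to S_{2m-1,2n-1}$, $(A_1,A_2,A_3,A_4)\mapsto\sum_{i=1}^4A_iF_i$, and let $Q_{m,n}$ be the $9mn\times 9mn$ matrix, in the monomial bases, of the linear map $S_{m-1,n-1}^9\to S_{3m-1,3n-1}$ sending $(A_1,\dots,A_9)$ to $$A_1F_1^2+A_2F_2^2+A_3F_3^2+A_4F_1F_2+A_5F_1F_3+A_6F_1F_4+A_7F_2F_3+A_8F_2F_4+A_9F_3F_4.$$ Then, in $\mathbb{Z}[c_{ia}]$, $$\det(Q_{m,n})=\pm\det(F_{m,n})^3\,\mathrm{Res}_{m,n}(F_1,F_2,F_3).$$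
   Context: Let $\mathbb{K}=\mathbb{Q}(c_{ia})_{i=1,\dots,4,\,a\in\mathcal{A}}$ be the field of rational functions in the indeterminates $c_{ia}$, and let $x_1,x_2$ be further indeterminates. For nonnegative integers $i,j$, $S_{i,j}$ denotes the $\mathbb{K}$-vector space spanned by the monomials $x_1^{a_1}x_2^{a_2}$ with $0\le a_1\le i$ and $0\le a_2\le j$; its monomial basis consists of these monomials. The monomial basis of a power $S_{i,j}^r$ consists of the $r$-tuples having one entry a monomial of $S_{i,j}$ and the other entries zero. The entries of $F_{m,n}$ and $Q_{m,n}$ lie in $\mathbb{Z}[c_{ia}]$, and their determinants are well defined up to sign (depending on the ordering of the bases). $\mathrm{Res}_{m,n}(F_1,F_2,F_3)$ denotes the sparse resultant associated with the support $\mathcal{A}$: it is the irreducible polynomial in $\mathbb{Z}[c_{ia}: i=1,2,3,\ a\in\mathcal{A}]$, unique up to sign, such that for every specialization of the coefficients $c_{ia}$ in $\mathbb{C}$ it vanishes if and only if the bihomogenizations of bidegree $(m,n)$ of the specialized $F_1,F_2,F_3$ have a common zero in $\mathbb{P}^1(\mathbb{C})\times\mathbb{P}^1(\mathbb{C})$. *)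

theory Defs
  imports
    "HOL-Library.Poly_Mapping"
    "HOL-Library.Product_Plus"
    "HOL-Computational_Algebra.Factorial_Ring"
    "Jordan_Normal_Form.Determinant"
    Complex_Main
begin

text \<open>
  Multivariate polynomials are represented by \<^typ>\<open>('e \<Rightarrow>\<^sub>0 'r)\<close>, a finitely supported map from
  exponents to coefficients, with convolution as multiplication.  The indeterminate $c_{ia}$ is
  the pair \<open>(i, a)\<close> of an index \<open>i\<close> and an exponent pair \<open>a\<close>; \<open>cpoly\<close> is the
  integer polynomial ring in all such symbols, whatever \<open>m\<close> and \<open>n\<close> are, and the polynomials
  considered below use only those with \<open>a\<close> in the support.
\<close>

type_synonym expo = "nat \<times> nat"
type_synonym cvar = "nat \<times> expo"
type_synonym cpoly = "(cvar \<Rightarrow>\<^sub>0 nat) \<Rightarrow>\<^sub>0 int"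
type_synonym 'r bipoly = "expo \<Rightarrow>\<^sub>0 'r"

definition indet :: "cvar \<Rightarrow> cpoly" where
  "indet v = Poly_Mapping.single (Poly_Mapping.single v 1) 1"

definition indets :: "cpoly \<Rightarrow> cvar set" where
  "indets p = (\<Union>t\<in>Poly_Mapping.keys p. Poly_Mapping.keys t)"

definition specialize :: "(cvar \<Rightarrow> complex) \<Rightarrow> cpoly \<Rightarrow> complex" where
  "specialize c p =
     (\<Sum>t\<in>Poly_Mapping.keys p. of_int (Poly_Mapping.lookup p t) *
        (\<Prod>v\<in>Poly_Mapping.keys t. c v ^ Poly_Mapping.lookup t v))"

text \<open>\<open>exp_box i j\<close> is the set of exponents of the monomial basis of $S_{i,j}$; the support
  $\mathcal{A}$ is \<open>exp_box m n\<close>.\<close>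

definition exp_box :: "nat \<Rightarrow> nat \<Rightarrow> expo set" where
  "exp_box i j = {0..i} \<times> {0..j}"

definition xmonom :: "expo \<Rightarrow> 'r::comm_ring_1 bipoly" where
  "xmonom a = Poly_Mapping.single a 1"

definition form :: "nat \<Rightarrow> nat \<Rightarrow> (expo \<Rightarrow> 'r) \<Rightarrow> 'r::comm_ring_1 bipoly" where
  "form m n u = (\<Sum>a\<in>exp_box m n. Poly_Mapping.single a (u a))"

definition genF :: "nat \<Rightarrow> nat \<Rightarrow> nat \<Rightarrow> cpoly bipoly" where
  "genF m n i = form m n (\<lambda>a. indet (i, a))"

text \<open>Tuples in $S_{i,j}^r$ are lists of length \<open>r\<close>.  Basis vectors and forms have coefficients in
  $\mathbb{Z}[c_{ia}]$, so the matrices of the linear maps over the fraction field are computed in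
  this ring.\<close>

definition power_basis :: "nat \<Rightarrow> nat \<Rightarrow> nat \<Rightarrow> 'r::comm_ring_1 bipoly list set" where
  "power_basis r i j = {(replicate r 0)[k := xmonom a] | k a. k < r \<and> a \<in> exp_box i j}"

definition comb_map :: "'r::comm_ring_1 bipoly list \<Rightarrow> 'r bipoly list \<Rightarrow> 'r bipoly" where
  "comb_map Gs As = (\<Sum>k<length Gs. As ! k * Gs ! k)"

text \<open>The matrix of a linear map in ordered bases: column \<open>q\<close> contains the coordinates of the
  image of the \<open>q\<close>-th source basis element \<open>bs ! q\<close>.  The target basis is the list of monomials
  with exponents \<open>es\<close>.\<close>

definition matrix_of ::
  "'r::comm_ring_1 bipoly list list \<Rightarrow> expo list \<Rightarrow> ('r bipoly list \<Rightarrow> 'r bipoly) \<Rightarrow> 'r mat" where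
  "matrix_of bs es \<phi> =
     mat (length es) (length bs) (\<lambda>(p, q). Poly_Mapping.lookup (\<phi> (bs ! q)) (es ! p))"

definition is_ordering :: "'a list \<Rightarrow> 'a set \<Rightarrow> bool" where
  "is_ordering xs B \<longleftrightarrow> distinct xs \<and> set xs = B"

definition F_map :: "nat \<Rightarrow> nat \<Rightarrow> cpoly bipoly list \<Rightarrow> cpoly bipoly" where
  "F_map m n = comb_map [genF m n 1, genF m n 2, genF m n 3, genF m n 4]"

definition Q_map :: "nat \<Rightarrow> nat \<Rightarrow> cpoly bipoly list \<Rightarrow> cpoly bipoly" where
  "Q_map m n =
     (let F1 = genF m n 1; F2 = genF m n 2; F3 = genF m n 3; F4 = genF m n 4
      in comb_map [F1 ^ 2, F2 ^ 2, F3 ^ 2, F1 * F2, F1 * F3, F1 * F4, F2 * F3, F2 * F4, F3 * F4])"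

text \<open>Points of the complex projective line are given by homogeneous coordinates, i.e. nonzero
  pairs; vanishing does not depend on the choice of representatives.\<close>

definition bihom ::
  "nat \<Rightarrow> nat \<Rightarrow> complex bipoly \<Rightarrow> complex \<times> complex \<Rightarrow> complex \<times> complex \<Rightarrow> complex" where
  "bihom m n f = (\<lambda>(x1, y1) (x2, y2).
     \<Sum>(a1, a2)\<in>Poly_Mapping.keys f.
       Poly_Mapping.lookup f (a1, a2) * x1 ^ a1 * y1 ^ (m - a1) * x2 ^ a2 * y2 ^ (n - a2))"

definition common_zero :: "nat \<Rightarrow> nat \<Rightarrow> complex bipoly list \<Rightarrow> bool" where
  "common_zero m n fs \<longleftrightarrow>
     (\<exists>P Q. P \<noteq> (0, 0) \<and> Q \<noteq> (0, 0) \<and> (\<forall>f\<in>set fs. bihom m n f P Q = 0))"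

text \<open>The resultant is determined only up to sign, hence a predicate.\<close>

definition is_resultant :: "nat \<Rightarrow> nat \<Rightarrow> cpoly \<Rightarrow> bool" where
  "is_resultant m n R \<longleftrightarrow>
     indets R \<subseteq> {1, 2, 3} \<times> exp_box m n \<and>
     irreducible R \<and>
     (\<forall>c. specialize c R = 0 \<longleftrightarrow>
        common_zero m n (map (\<lambda>i. form m n (\<lambda>a. c (i, a))) [1, 2, 3]))"

end

theory Submission
  imports
    Defs
    "HOL-Library.Product_Lexorder"
    "HOL-Computational_Algebra.Computational_Algebra"
    "HOL-Computational_Algebra.Field_as_Ring"
    "Jordan_Normal_Form.Char_Poly"
begin

text \<open>
Put $M = mn$.  The comparison of $\det(Q_{m,n})$ with $\det(F_{m,n})^3$ goes through the Koszul complex of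
$F_1,F_2,F_3$ in bidegree $(3m-1,3n-1)$,
$$S_{m-1,n-1}^3 \to S_{2m-1,2n-1}^3 \to S_{3m-1,3n-1}.$$
The matrix $F_{m,n}$ identifies $S_{2m-1,2n-1}$ with $S_{m-1,n-1}^4$.  In these coordinates the second map has
the twelve column blocks $F_iF_j$ with $i \le 3$ and $j \le 4$: nine of them make up $Q_{m,n}$, the other three are
repetitions, and cancelling these by column operations leaves exactly the Koszul syzygies.  Adding $3M$ rows of
fresh indeterminates makes the second map square and yields
$a \det(F_{m,n})^3 = \pm \det(Q_{m,n})\, b$, where $a$ and $b$ do not involve $F_4$ (\<open>stacked_identity\<close>).

Comparing this with the same identity for another fourth form $F_5$ eliminates $a$ and $b$ and shows that
$\det(F_{m,n})^3$ divides $\det(Q_{m,n})$, with a quotient \<open>res\<close> that depends on $F_1,F_2,F_3$ only.  To cancel the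
common factor in this step no unique factorization is used: along a line in an integral direction at which
$\det(F_{m,n}) = \pm 1$ the divisor becomes monic, one divides with remainder, and the remainder
vanishes since at one special line the factor to be cancelled has no zero (\<open>cancel_coprime_factor\<close>).

The quotient has the right zeros.  Now the identity says $a = \pm b \cdot$\<open>res\<close>.  If $F_1,F_2,F_3$ have no common zero
then the second Koszul map is surjective (\<open>bidegree_surjective\<close>), the fresh rows can be chosen with
$a \ne 0$, and so \<open>res\<close> does not vanish (\<open>res_nonzero\<close>).  The surjectivity is proved fibrewise over
$\mathbb{P}^1$, lifting Koszul syzygies of univariate polynomials.  Conversely \<open>res\<close> vanishes if there is an affine
common zero, because evaluation there annihilates the image of $Q_{m,n}$ (\<open>res_zero\<close>).

Finally \<open>res\<close> is reduced: on one explicit pencil it has as many distinct roots as its degree in $F_1$.  Hence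
it divides every polynomial that vanishes on its zeros (\<open>res_dvd\<close>), in particular the resultant, which is
irreducible; and the units of $\mathbb{Z}[c_{ia}]$ are $\pm 1$ (\<open>resultant_eq\<close>).
\<close>

abbreviation lookup :: "('a \<Rightarrow>\<^sub>0 'b::zero) \<Rightarrow> 'a \<Rightarrow> 'b" where "lookup \<equiv> Poly_Mapping.lookup"
abbreviation keys :: "('a \<Rightarrow>\<^sub>0 'b::zero) \<Rightarrow> 'a set" where "keys \<equiv> Poly_Mapping.keys"
abbreviation single :: "'a \<Rightarrow> 'b \<Rightarrow> 'a \<Rightarrow>\<^sub>0 'b::zero" where "single \<equiv> Poly_Mapping.single"

section \<open>Substitution in polynomials\<close>

text \<open>The one evaluation principle behind all substitutions below: coefficients are mapped by \<open>h\<close> and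
the exponent \<open>t\<close> by \<open>\<phi> t\<close>.  If \<open>h\<close> is a ring homomorphism and \<open>\<phi>\<close> turns sums of exponents into
products, this is a ring homomorphism.  It is used to specialize the indeterminates, to change the
coefficient ring of forms in $x_1,x_2$, to evaluate such forms at points, and to pass to iterated
univariate polynomials.\<close>

definition pm_eval :: "('c::comm_ring_1 \<Rightarrow> 'r::comm_ring_1) \<Rightarrow> ('e::comm_monoid_add \<Rightarrow> 'r) \<Rightarrow> ('e \<Rightarrow>\<^sub>0 'c) \<Rightarrow> 'r" where
  "pm_eval h \<phi> p = (\<Sum>t\<in>keys p. h (lookup p t) * \<phi> t)"

lemma poly_mapping_as_sum:
  "p = (\<Sum>t\<in>keys p. single t (lookup p t))"
  by (rule poly_mapping_eqI) (simp add: lookup_sum lookup_single when_def in_keys_iff)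

lemma pm_eval_hom:
  assumes "comm_ring_hom h" and "\<phi> 0 = 1" and mult: "\<And>s t. \<phi> (s + t) = \<phi> s * \<phi> t"
  shows "comm_ring_hom (pm_eval h \<phi>)"
proof -
  interpret h: comm_ring_hom h by fact
  have super: "pm_eval h \<phi> p = (\<Sum>t\<in>S. h (lookup p t) * \<phi> t)"
    if "finite S" "keys p \<subseteq> S" for S p
    unfolding pm_eval_def
    by (rule sum.mono_neutral_left) (use that in \<open>auto simp: in_keys_iff\<close>)
  have add: "pm_eval h \<phi> (p + q) = pm_eval h \<phi> p + pm_eval h \<phi> q" for p q
  proof -
    let ?S = "keys p \<union> keys q"
    have "keys (p + q) \<subseteq> ?S" by (rule keys_add)
    then show ?thesis by (simp add: super[of ?S] lookup_add h.hom_add distrib_right sum.distrib)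
  qed
  have zero: "pm_eval h \<phi> 0 = 0" by (simp add: pm_eval_def)
  have sum: "pm_eval h \<phi> (sum f A) = (\<Sum>a\<in>A. pm_eval h \<phi> (f a))" for A and f :: "'d \<Rightarrow> _"
    by (induct A rule: infinite_finite_induct) (auto simp: add zero)
  have single: "pm_eval h \<phi> (single t a) = h a * \<phi> t" for t a
    by (simp add: pm_eval_def)
  have "pm_eval h \<phi> (p * q) = pm_eval h \<phi> p * pm_eval h \<phi> q" for p q
  proof -
    have "p * q = (\<Sum>s\<in>keys p. \<Sum>t\<in>keys q.
        single (s + t) (lookup p s * lookup q t))"
      apply (subst poly_mapping_as_sum[of p], subst poly_mapping_as_sum[of q])
      apply (simp add: sum_product mult_single)
      done
    then have "pm_eval h \<phi> (p * q) = (\<Sum>s\<in>keys p. \<Sum>t\<in>keys q.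
        (h (lookup p s) * \<phi> s) * (h (lookup q t) * \<phi> t))"
      by (simp add: sum single mult h.hom_mult mult_ac)
    then show ?thesis by (simp add: pm_eval_def sum_product)
  qed
  moreover have "pm_eval h \<phi> 1 = 1" using single[of 0 1] assms(2) by simp
  ultimately show ?thesis by unfold_locales (simp_all add: zero add)
qed

definition mon :: "(cvar \<Rightarrow> 'a::comm_ring_1) \<Rightarrow> (cvar \<Rightarrow>\<^sub>0 nat) \<Rightarrow> 'a" where
  "mon c t = (\<Prod>v\<in>keys t. c v ^ lookup t v)"

lemma mon_superset:
  assumes "finite S" "keys t \<subseteq> S"
  shows "mon c t = (\<Prod>v\<in>S. c v ^ lookup t v)"
  unfolding mon_def
  by (rule prod.mono_neutral_left) (use assms in \<open>auto simp: in_keys_iff\<close>)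

lemma mon_add: "mon c (s + t) = mon c s * mon c t"
proof -
  let ?S = "keys s \<union> keys t"
  have "keys (s + t) \<subseteq> ?S" by (rule keys_add)
  then show ?thesis
    by (simp add: mon_superset[of ?S] lookup_add power_add prod.distrib)
qed

lemma mon_0 [simp]: "mon c 0 = 1"
  by (simp add: mon_def)

text \<open>Unlike \<^const>\<open>specialize\<close>, the target is an arbitrary commutative ring.  With polynomials as values
this describes substitutions, shifts $c \mapsto c + tw$, and scalings of the indeterminates.\<close>

definition ev :: "(cvar \<Rightarrow> 'a::comm_ring_1) \<Rightarrow> cpoly \<Rightarrow> 'a" where
  "ev c = pm_eval of_int (mon c)"

lemma ev_alt: "ev c p = (\<Sum>t\<in>keys p. of_int (lookup p t) * mon c t)"
  by (simp add: ev_def pm_eval_def)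

lemma specialize_ev: "specialize c p = ev c p"
  by (simp add: specialize_def ev_alt mon_def)

lemma of_int_hom: "comm_ring_hom (of_int :: int \<Rightarrow> 'a :: comm_ring_1)"
  by unfold_locales simp_all

lemma ev_hom: "comm_ring_hom (ev c)"
  unfolding ev_def by (rule pm_eval_hom[OF of_int_hom mon_0 mon_add])

interpretation ev: comm_ring_hom "ev c" for c
  by (rule ev_hom)

lemma ev_0 [simp]: "ev c 0 = 0" by (rule ev.hom_zero)
lemma ev_1 [simp]: "ev c 1 = 1" by (rule ev.hom_one)
lemma ev_mult: "ev c (p * q) = ev c p * ev c q" by (rule ev.hom_mult)

lemma ev_single: "ev c (single t a) = of_int a * mon c t"
  by (simp add: ev_alt)

lemma ev_indet [simp]: "ev c (indet v) = c v"
  by (simp add: indet_def ev_single mon_def)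

lemma hom_ev:
  assumes "comm_ring_hom h"
  shows "h (ev c p) = ev (\<lambda>v. h (c v)) p"
proof -
  interpret h: comm_ring_hom h by fact
  show ?thesis by (simp add: ev_alt mon_def h.hom_sum h.hom_mult h.hom_prod h.hom_power h.hom_of_int)
qed

lemma ev_indet_id: "ev indet p = p"
proof -
  have m: "mon indet t = single t 1" for t
  proof -
    have pw: "indet v ^ k = single (single v k) 1" for v k
      by (induct k) (auto simp: indet_def mult_single simp flip: single_add)
    have "(\<Prod>v\<in>S. indet v ^ f v) = single (\<Sum>v\<in>S. single v (f v)) 1"
      if "finite S" for S :: "cvar set" and f
      using that by induct (auto simp: pw mult_single)
    then show ?thesis using poly_mapping_as_sum[of t] by (simp add: mon_def)
  qed
  have "of_int a * single t 1 = single t a" for a and t :: "cvar \<Rightarrow>\<^sub>0 nat"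
    by (simp add: mult_single flip: single_of_int)
  then show ?thesis using poly_mapping_as_sum[of p] by (simp add: ev_alt m)
qed

lemma ev_compose: "ev c (ev d p) = ev (\<lambda>v. ev c (d v)) p"
  by (rule hom_ev[OF ev_hom])

text \<open>Distinct monomials are distinct characters of the multiplicative monoid of assignments, so they are
linearly independent as functions.  The induction is Dedekind's: doubling the value of a variable in
which two monomials differ and subtracting a multiple removes one monomial and keeps another.\<close>

lemma cpoly_nonvanishing:
  assumes "p \<noteq> 0"
  shows "\<exists>c :: cvar \<Rightarrow> complex. ev c p \<noteq> 0"
  using assms
proof (induction "card (keys p)" arbitrary: p rule: less_induct)
  case less
  from less.prems obtain t1 where t1: "t1 \<in> keys p"
    by (metis equals0I keys_eq_empty)
  show ?case
  proof (cases "keys p = {t1}")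
    case True
    have "ev (\<lambda>_. 1 :: complex) p = of_int (lookup p t1)"
      by (simp add: ev_alt True mon_def)
    with t1 show ?thesis by (metis in_keys_iff of_int_eq_0_iff)
  next
    case False
    with t1 obtain t2 where t2: "t2 \<in> keys p" "t2 \<noteq> t1" by blast
    then obtain v where v: "lookup t2 v \<noteq> lookup t1 v"
      by (metis poly_mapping_eqI)
    define w where "w t = (2::int) ^ lookup t v - 2 ^ lookup t1 v" for t
    define p' where "p' = (\<Sum>t\<in>keys p. single t (lookup p t * w t))"
    have lk: "lookup p' t = lookup p t * w t" for t
      by (simp add: p'_def lookup_sum lookup_single when_def in_keys_iff)
    have "keys p' \<subset> keys p"
    proof
      show "keys p' \<subseteq> keys p" by (auto simp: in_keys_iff lk)
      show "keys p' \<noteq> keys p"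
        using t1 by (auto simp: set_eq_iff in_keys_iff lk w_def)
    qed
    then have card: "card (keys p') < card (keys p)"
      by (simp add: psubset_card_mono)
    have "w t2 \<noteq> 0" using v by (simp add: w_def)
    then have "lookup p' t2 \<noteq> 0"
      using t2 by (simp add: lk in_keys_iff)
    then have "p' \<noteq> 0" by auto
    from less.hyps[OF card this] obtain c :: "cvar \<Rightarrow> complex" where c: "ev c p' \<noteq> 0" by blast
    have sc: "mon (c(v := 2 * c v)) t = 2 ^ lookup t v * mon c t" for t
    proof -
      let ?S = "insert v (keys t)"
      have "mon (c(v := 2 * c v)) t = (\<Prod>x\<in>?S. (if x = v then 2 ^ lookup t v else 1) * c x ^ lookup t x)"
        by (subst mon_superset[of ?S]) (auto intro!: prod.cong simp: power_mult_distrib)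
      also have "\<dots> = 2 ^ lookup t v * mon c t"
        by (subst mon_superset[of ?S t c]) (auto simp: prod.distrib)
      finally show ?thesis .
    qed
    have "ev c p' = (\<Sum>t\<in>keys p. of_int (lookup p' t) * mon c t)"
      unfolding ev_alt by (rule sum.mono_neutral_left) (auto simp: in_keys_iff lk)
    also have "\<dots> = ev (c(v := 2 * c v)) p - 2 ^ lookup t1 v * ev c p"
      unfolding ev_alt sc lk w_def by (simp add: algebra_simps sum_subtractf sum_distrib_left)
    finally show ?thesis using c by (metis diff_zero mult_zero_right)
  qed
qed

lemma cpoly_eqI:
  assumes "\<And>c :: cvar \<Rightarrow> complex. ev c p = ev c q"
  shows "p = q"
  using cpoly_nonvanishing[of "p - q"] assms by (auto simp: ev.hom_minus)

text \<open>On each line through the origin a unit restricts to a unit of $\mathbb{C}[t]$, hence to a constant; so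
it is constant on all assignments.\<close>

lemma cpoly_unit:
  fixes h h' :: cpoly
  assumes "h * h' = 1"
  shows "h = 1 \<or> h = -1"
proof -
  define k where "k = ev (\<lambda>_. 0::int) h"
  have kk: "k * ev (\<lambda>_. 0::int) h' = 1"
    unfolding k_def using assms by (metis ev_mult ev_1)
  have "h = of_int k"
  proof (rule cpoly_eqI)
    fix c :: "cvar \<Rightarrow> complex"
    define l where "l = ev (\<lambda>v. [:0, c v:]) h"
    have "l * ev (\<lambda>v. [:0, c v:]) h' = 1"
      unfolding l_def using assms by (metis ev_mult ev_1)
    then have "degree l = 0"
      by (metis degree_1 dvd_def dvd_triv_left is_unit_iff_degree one_dvd zero_neq_one mult_zero_left)
    then obtain a where a: "l = [:a:]" by (metis degree_eq_zeroE)
    have e: "poly l x = ev (\<lambda>v. x * c v) h" for x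
    proof -
      have "comm_ring_hom (\<lambda>p :: complex poly. poly p x)" by unfold_locales auto
      from hom_ev[OF this, of _ h] show ?thesis by (simp add: l_def)
    qed
    have "ev c h = ev (\<lambda>v. 0) h" using e[of 1] e[of 0] a by simp
    also have "\<dots> = of_int k"
    proof -
      have "comm_ring_hom (of_int :: int \<Rightarrow> complex)" by unfold_locales auto
      from hom_ev[OF this, of _ h] show ?thesis by (simp add: k_def)
    qed
    finally show "ev c h = ev c (of_int k)" by (simp add: ev.hom_of_int)
  qed
  moreover have "k = 1 \<or> k = -1" using kk using zmult_eq_1_iff by auto
  ultimately show ?thesis by auto
qed

section \<open>Divisibility tested along lines\<close>

abbreviation spec_poly :: "(cvar \<Rightarrow> complex) \<Rightarrow> cpoly poly \<Rightarrow> complex poly" where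
  "spec_poly c \<equiv> map_poly (ev c)"

text \<open>Homogeneity of degree \<open>d\<close> in the variables of \<open>V\<close> alone.\<close>

definition homog :: "cvar set \<Rightarrow> nat \<Rightarrow> cpoly \<Rightarrow> bool" where
  "homog V d U \<longleftrightarrow>
     (\<forall>t\<in>keys U. (\<Sum>v\<in>keys t. if v \<in> V then lookup t v else 0) = d)"

text \<open>The polynomial $U(c + tw)$ in $t$.  If \<open>U\<close> is homogeneous of degree \<open>d\<close> in \<open>V\<close> and \<open>w\<close> lives on \<open>V\<close>, its
coefficient at $t^d$ is \<open>along V w U\<close>: the variables of \<open>V\<close> are replaced by the direction \<open>w\<close> and the
others are kept.\<close>

definition shift :: "(cvar \<Rightarrow> cpoly) \<Rightarrow> cpoly \<Rightarrow> cpoly poly" where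
  "shift w U = ev (\<lambda>v. [:indet v, w v:]) U"

definition along :: "cvar set \<Rightarrow> (cvar \<Rightarrow> cpoly) \<Rightarrow> cpoly \<Rightarrow> cpoly" where
  "along V w U = ev (\<lambda>v. if v \<in> V then w v else indet v) U"

lemma mon_indet: "mon indet t = (single t 1 :: cpoly)"
  using ev_indet_id[of "single t 1"] by (simp add: ev_single)

interpretation map_ev: map_poly_comm_ring_hom "ev c" for c
  by unfold_locales

lemma map_ev_pCons: "map_poly (ev c) (pCons a p) = pCons (ev c a) (map_poly (ev c) p)"
  by (rule poly_eqI) (simp add: coeff_map_poly coeff_pCons split: nat.split)

lemma comm_ring_hom_compose:
  assumes "comm_ring_hom f" "comm_ring_hom g"
  shows "comm_ring_hom (\<lambda>x. f (g x))"
proof -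
  interpret f: comm_ring_hom f by fact
  interpret g: comm_ring_hom g by fact
  show ?thesis by unfold_locales (simp_all add: f.hom_add g.hom_add f.hom_mult g.hom_mult)
qed

lemma poly_hom_ring: "comm_ring_hom (\<lambda>p. poly p (a :: 'a :: comm_ring_1))"
  by unfold_locales auto

lemma spec_shift: "poly (spec_poly c (shift w U)) t = ev (\<lambda>v. c v + t * ev c (w v)) U"
proof -
  have 1: "comm_ring_hom (\<lambda>p. poly (spec_poly c p) t)"
    by (rule comm_ring_hom_compose[OF poly_hom_ring, of "spec_poly c"]) (rule map_ev.comm_ring_hom_axioms)
  show ?thesis unfolding shift_def
    by (subst hom_ev[OF 1]) (simp add: map_ev_pCons)
qed

lemma shift_0: "poly (shift w U) 0 = U"
  unfolding shift_def by (subst hom_ev[OF poly_hom_ring]) (simp add: ev_indet_id)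

lemma shift_mult: "shift w (p * q) = shift w p * shift w q"
  by (simp add: shift_def ev_mult)

lemma coeff_mult_le:
  fixes p q :: "'a :: comm_ring_1 poly"
  assumes "degree p \<le> a" "degree q \<le> b"
  shows "degree (p * q) \<le> a + b \<and> coeff (p * q) (a + b) = coeff p a * coeff q b"
proof
  show "degree (p * q) \<le> a + b" using degree_mult_le[of p q] assms by linarith
  have "coeff (p * q) (a + b) = (\<Sum>i\<le>a+b. coeff p i * coeff q (a + b - i))"
    by (simp add: coeff_mult)
  also have "\<dots> = (\<Sum>i\<in>{a}. coeff p i * coeff q (a + b - i))"
  proof (rule sum.mono_neutral_right)
    show "\<forall>i\<in>{..a+b} - {a}. coeff p i * coeff q (a + b - i) = 0"
    proof
      fix i assume i: "i \<in> {..a+b} - {a}"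
      show "coeff p i * coeff q (a + b - i) = 0"
      proof (cases "i < a")
        case True then have "a + b - i > degree q" using assms by auto
        then show ?thesis by (simp add: coeff_eq_0)
      next
        case False then have "i > degree p" using assms i by auto
        then show ?thesis by (simp add: coeff_eq_0)
      qed
    qed
  qed auto
  finally show "coeff (p * q) (a + b) = coeff p a * coeff q b" by simp
qed

lemma coeff_power_le:
  fixes p :: "'a :: comm_ring_1 poly"
  assumes "degree p \<le> a"
  shows "degree (p ^ n) \<le> n * a \<and> coeff (p ^ n) (n * a) = coeff p a ^ n"
proof (induction n)
  case (Suc n)
  then show ?case using coeff_mult_le[OF assms, of "p ^ n" "n * a"] by simp
qed auto

lemma coeff_prod_le:
  fixes p :: "'b \<Rightarrow> 'a :: comm_ring_1 poly"
  assumes "finite S" "\<And>x. x \<in> S \<Longrightarrow> degree (p x) \<le> a x"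
  shows "degree (prod p S) \<le> sum a S \<and> coeff (prod p S) (sum a S) = (\<Prod>x\<in>S. coeff (p x) (a x))"
  using assms
proof (induction S rule: finite_induct)
  case (insert x S)
  then show ?case using coeff_mult_le[of "p x" "a x" "prod p S" "sum a S"] by simp
qed auto

lemma shift_homog:
  assumes "homog V d U" "\<And>v. v \<notin> V \<Longrightarrow> w v = 0"
  shows "degree (shift w U) \<le> d" "coeff (shift w U) d = along V w U"
proof -
  have m: "degree (mon (\<lambda>v. [:indet v, w v:]) t) \<le> d \<and>
      coeff (mon (\<lambda>v. [:indet v, w v:]) t) d = mon (\<lambda>v. if v \<in> V then w v else indet v) t"
    if t: "t \<in> keys U" for t
  proof -
    have fac: "degree ([:indet v, w v:] ^ k) \<le> (if v \<in> V then k else 0) \<and>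
       coeff ([:indet v, w v:] ^ k) (if v \<in> V then k else 0) = (if v \<in> V then w v else indet v) ^ k" for v k
    proof (cases "v \<in> V")
      case True
      then show ?thesis using coeff_power_le[of "[:indet v, w v:]" 1 k] by simp
    next
      case False
      then show ?thesis using coeff_power_le[of "[:indet v, w v:]" 0 k] assms(2)[of v] by simp
    qed
    have d: "(\<Sum>v\<in>keys t. if v \<in> V then lookup t v else 0) = d"
      using assms(1) t by (simp add: homog_def)
    show ?thesis unfolding mon_def
      using coeff_prod_le[of "keys t" "\<lambda>v. [:indet v, w v:] ^ lookup t v"
          "\<lambda>v. if v \<in> V then lookup t v else 0"] fac
      by (simp add: d)
  qed
  have o: "of_int a * (p :: cpoly poly) = smult (of_int a) p" for a p
    by (simp add: of_int_poly)
  show "degree (shift w U) \<le> d"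
    unfolding shift_def ev_alt o
    by (intro degree_sum_le order.trans[OF degree_smult_le]) (auto simp: m)
  show "coeff (shift w U) d = along V w U"
    unfolding shift_def along_def ev_alt o by (simp add: coeff_sum m)
qed

text \<open>Multiplying the variables of \<open>V\<close> by $t$ separates the monomials of \<open>U\<close> by their degree in \<open>V\<close>.\<close>

lemma homogI:
  assumes "ev (\<lambda>v. if v \<in> V then [:0, indet v:] else [:indet v:]) U = monom U d"
  shows "homog V d U"
proof -
  define \<delta> where "\<delta> t = (\<Sum>v\<in>keys t. if v \<in> V then lookup t v else 0)" for t :: "cvar \<Rightarrow>\<^sub>0 nat"
  have sc: "mon (\<lambda>v. if v \<in> V then [:0, indet v:] else [:indet v:]) t = monom (mon indet t) (\<delta> t)" for t
  proof -
    have a: "[:0, indet v:] ^ k = monom (indet v ^ k) k" for v k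
      by (metis monom_0 monom_Suc monom_power mult_1 One_nat_def pCons_0_0)
    have b: "[:indet v:] ^ k = monom (indet v ^ k) 0" for v k
      by (simp add: monom_0 poly_const_pow)
    have "(\<Prod>v\<in>S. (if v \<in> V then [:0, indet v:] else [:indet v:]) ^ k v)
       = monom (\<Prod>v\<in>S. indet v ^ k v) (\<Sum>v\<in>S. if v \<in> V then k v else 0)"
      if "finite S" for S and k :: "cvar \<Rightarrow> nat"
      using that
    proof (induction S rule: finite_induct)
      case (insert x S)
      then show ?case using a[of x] b[of x] by (simp add: mult_monom)
    qed (simp add: monom_0 pCons_one)
    then show ?thesis by (simp add: mon_def \<delta>_def)
  qed
  show ?thesis unfolding homog_def \<delta>_def[symmetric]
  proof
    fix t assume t: "t \<in> keys U"
    show "\<delta> t = d"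
    proof (rule ccontr)
      assume nd: "\<delta> t \<noteq> d"
      have o: "of_int a * (p :: cpoly poly) = smult (of_int a) p" for a p
        by (simp add: of_int_poly)
      have "of_int a * single t 1 = single t a" for a and t :: "cvar \<Rightarrow>\<^sub>0 nat"
        by (simp add: mult_single flip: single_of_int)
      then have "coeff (monom U d) (\<delta> t) =
         (\<Sum>s\<in>keys U. if \<delta> s = \<delta> t then single s (lookup U s) else 0)"
        unfolding assms[symmetric] ev_alt o
        by (simp add: coeff_sum sc mon_indet if_distrib cong: if_cong)
      then have "(\<Sum>s\<in>keys U. if \<delta> s = \<delta> t then single s (lookup U s) else 0) = 0"
        using nd by simp
      then have "(\<Sum>s\<in>keys U. lookup (if \<delta> s = \<delta> t then single s (lookup U s) else 0) t) = 0"
        by (simp only: lookup_zero flip: lookup_sum)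
      moreover have "(\<Sum>s\<in>keys U. lookup (if \<delta> s = \<delta> t then single s (lookup U s) else 0) t)
        = (\<Sum>s\<in>keys U. if s = t then lookup U t else 0)"
        by (intro sum.cong) (auto simp: lookup_single when_def)
      ultimately show False using t by (simp add: in_keys_iff)
    qed
  qed
qed

lemma extract_lowest_order:
  fixes x :: "complex poly poly"
  assumes "x \<noteq> 0"
  shows "\<exists>k y. x = smult ([:0,1:] ^ k) y \<and> map_poly (\<lambda>a. poly a 0) y \<noteq> 0"
  using assms
proof (induction "degree (lead_coeff x)" arbitrary: x rule: less_induct)
  case less
  show ?case
  proof (cases "map_poly (\<lambda>a. poly a 0) x = 0")
    case False
    then have "x = smult ([:0,1:] ^ 0) x \<and> map_poly (\<lambda>a. poly a 0) x \<noteq> 0" by simp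
    then show ?thesis by blast
  next
    case True
    define y where "y = map_poly (\<lambda>a. a div [:0,1:]) x"
    have dv: "[:0,1:] dvd coeff x i" for i
    proof -
      have "poly (coeff x i) 0 = 0" using True by (metis coeff_0 coeff_map_poly poly_0)
      then show ?thesis using poly_eq_0_iff_dvd[of "coeff x i" 0] by simp
    qed
    have xy: "x = smult [:0,1:] y"
      by (rule poly_eqI) (simp only: coeff_smult y_def coeff_map_poly div_0 dvd_mult_div_cancel[OF dv])
    then have "y \<noteq> 0" using less.prems by auto
    have "lead_coeff x = [:0,1:] * lead_coeff y" using lead_coeff_smult[of "[:0,1:]" y] by (simp only: flip: xy)
    then have "degree (lead_coeff y) < degree (lead_coeff x)"
      using \<open>y \<noteq> 0\<close> by (simp add: degree_mult_eq)
    from less.hyps[OF this \<open>y \<noteq> 0\<close>] obtain k z where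
      z: "y = smult ([:0,1:] ^ k) z" "map_poly (\<lambda>a. poly a 0) z \<noteq> 0" by blast
    have "x = smult ([:0,1:] ^ Suc k) z" by (subst xy, subst z(1)) (simp only: smult_smult power_Suc)
    with z(2) show ?thesis by blast
  qed
qed

text \<open>Coprimality or squarefreeness at one specialization \<open>c\<close> forces a remainder to vanish identically.  If
$r \ne 0$, restrict to a line through \<open>c\<close> on which $r$ does not vanish, with parameter $\sigma$.  Then
$r = \sigma^k x$ with $x \ne 0$ at $\sigma = 0$, and comparing the lowest powers of $\sigma$ in
$r^N g = p h$ gives a divisibility in $\mathbb{C}[t]$ between the values at $\sigma = 0$, that is at
\<open>c\<close>.  There the degree of $x$ is too small.\<close>

lemma remainder_vanishes:
  fixes p r g h :: "cpoly poly"
  assumes eq: "r ^ N * g = p * h" and r: "degree r < d"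
    and p: "spec_poly c p \<noteq> 0" and g: "spec_poly c g \<noteq> 0"
    and sq: "\<And>y. degree y < d \<Longrightarrow> spec_poly c p dvd y ^ N * spec_poly c g \<Longrightarrow> y = 0"
  shows "r = 0"
proof (rule ccontr)
  assume "r \<noteq> 0"
  then obtain j where "coeff r j \<noteq> 0" by (meson leading_coeff_0_iff)
  then obtain e :: "cvar \<Rightarrow> complex" where e: "ev e (coeff r j) \<noteq> 0"
    using cpoly_nonvanishing by blast
  \<comment> \<open>the line from \<open>c\<close> at parameter 0 to \<open>e\<close> at parameter 1\<close>
  define l where "l v = [:c v, e v - c v:]" for v
  define \<Lambda> where "\<Lambda> = map_poly (ev l)"
  define E where "E = (map_poly (\<lambda>a. poly a 0) :: complex poly poly \<Rightarrow> complex poly)"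
  interpret \<Lambda>: comm_ring_hom \<Lambda> unfolding \<Lambda>_def by (rule map_ev.comm_ring_hom_axioms)
  interpret e0: comm_ring_hom "\<lambda>a :: complex poly. poly a 0" by (rule poly_hom_ring)
  interpret E0: map_poly_comm_ring_hom "\<lambda>a :: complex poly. poly a 0" by unfold_locales
  interpret E: comm_ring_hom E unfolding E_def by (rule E0.comm_ring_hom_axioms)
  have lev: "poly (ev l a) 0 = ev c a" "poly (ev l a) 1 = ev e a" for a
    by (subst hom_ev[OF poly_hom_ring], simp add: l_def)+
  have E\<Lambda>: "E (\<Lambda> a) = spec_poly c a" for a
    by (simp add: E_def \<Lambda>_def poly_eq_iff coeff_map_poly lev)
  have Es: "E (smult ([:0,1:] ^ k) x) = (if k = 0 then E x else 0)" for k x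
    by (cases k) (simp_all add: E_def poly_eq_iff coeff_map_poly)
  have "\<Lambda> r \<noteq> 0"
  proof
    assume "\<Lambda> r = 0"
    then have "ev l (coeff r j) = 0" by (metis \<Lambda>_def coeff_0 coeff_map_poly ev_0)
    then show False using lev(2)[of "coeff r j"] e by simp
  qed
  then obtain k x where x: "\<Lambda> r = smult ([:0,1:] ^ k) x" "E x \<noteq> 0"
    unfolding E_def using extract_lowest_order by blast
  have dx: "degree (E x) < d"
  proof -
    have "degree x = degree (\<Lambda> r)" unfolding x(1) by simp
    also have "\<dots> \<le> degree r" unfolding \<Lambda>_def by (rule degree_map_poly_le)
    finally show ?thesis using degree_map_poly_le[of "\<lambda>a. poly a 0" x] r unfolding E_def by linarith
  qed
  have eq': "\<Lambda> r ^ N * \<Lambda> g = \<Lambda> p * \<Lambda> h" using eq by (metis \<Lambda>.hom_mult \<Lambda>.hom_power)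
  have Ep: "E (\<Lambda> p) \<noteq> 0" "E (\<Lambda> g) \<noteq> 0" using p g by (simp_all add: E\<Lambda>)
  then have "\<Lambda> p \<noteq> 0" "\<Lambda> g \<noteq> 0" by (auto simp: E.hom_zero)
  then have "\<Lambda> h \<noteq> 0" using eq' \<open>\<Lambda> r \<noteq> 0\<close> by auto
  then obtain m z where z: "\<Lambda> h = smult ([:0,1:] ^ m) z" "E z \<noteq> 0"
    unfolding E_def using extract_lowest_order by blast
  have main: "smult ([:0,1:] ^ (k * N)) (x ^ N * \<Lambda> g) = smult ([:0,1:] ^ m) (\<Lambda> p * z)"
    using eq' unfolding x(1) z(1) by (simp only: smult_power power_mult mult_smult_left mult_smult_right)
  have nz: "E (x ^ N * \<Lambda> g) \<noteq> 0" "E (\<Lambda> p * z) \<noteq> 0"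
    using x(2) z(2) Ep by (simp_all add: E.hom_mult E.hom_power)
  have canc: "smult ([:0,1:] ^ a) A = smult ([:0,1:] ^ b) B \<Longrightarrow> a \<le> b \<Longrightarrow> A = smult ([:0,1:] ^ (b - a)) B"
    for a b and A B :: "complex poly poly"
  proof -
    assume 1: "smult ([:0,1:] ^ a) A = smult ([:0,1:] ^ b) B" "a \<le> b"
    then have "smult ([:0,1:] ^ a) A = smult ([:0,1:] ^ a) (smult ([:0,1:] ^ (b - a)) B)"
      by (simp only: smult_smult flip: power_add) simp
    then have "smult ([:0,1:] ^ a) (A - smult ([:0,1:] ^ (b - a)) B) = 0"
      by (simp add: smult_diff_right)
    then show ?thesis by simp
  qed
  have "k * N = m"
  proof (rule linorder_cases[of "k * N" m])
    assume "k * N < m"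
    with canc[OF main] nz show ?thesis by (metis Es less_imp_le zero_less_diff less_numeral_extra(3))
  next
    assume "m < k * N"
    with canc[OF main[symmetric]] nz show ?thesis by (metis Es less_imp_le zero_less_diff less_numeral_extra(3))
  qed
  with canc[OF main] have "x ^ N * \<Lambda> g = \<Lambda> p * z" by simp
  then have "E x ^ N * E (\<Lambda> g) = E (\<Lambda> p) * E z" by (metis E.hom_mult E.hom_power)
  then have "spec_poly c p dvd E x ^ N * spec_poly c g" by (simp add: E\<Lambda>)
  from sq[OF dx this] x(2) show False by simp
qed

text \<open>A substitute for unique factorization.  Along a direction in which \<open>U\<close> takes the value $\pm 1$, \<open>U\<close>
becomes monic in $t$ up to sign, so one can divide \<open>Q\<close> by it.  The remainder is killed by
\<open>remainder_vanishes\<close>, because on the special line $c + tw$ the polynomial \<open>G\<close> has no root and is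
therefore a nonzero constant.  Putting $t = 0$ gives the divisibility for \<open>U\<close> and \<open>Q\<close> themselves.\<close>

lemma cancel_coprime_factor:
  assumes eq: "U * H = G * Q" and hom: "homog V d U" and d: "d > 0"
    and w: "\<And>v. v \<notin> V \<Longrightarrow> w v = 0"
    and lead: "along V w U = 1 \<or> along V w U = -1"
    and G: "\<And>t :: complex. ev (\<lambda>v. c v + t * ev c (w v)) G \<noteq> 0"
  shows "U dvd Q"
proof -
  let ?p = "shift w U"
  have dp: "degree ?p \<le> d" "coeff ?p d = along V w U" using shift_homog[OF hom w] by auto
  have dp': "degree ?p = d" using dp lead by (metis le_antisym le_degree neg_equal_0_iff_equal one_neq_zero)
  have p0: "?p \<noteq> 0" using dp' d by auto
  obtain q r where qr: "pseudo_divmod (shift w Q) ?p = (q, r)" by fastforce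
  define k where "k = Suc (degree (shift w Q)) - d"
  define s where "s = (along V w U) ^ k"
  have s: "s = 1 \<or> s = -1" unfolding s_def using lead by (cases "even k") auto
  have div: "smult s (shift w Q) = ?p * q + r" "r = 0 \<or> degree r < d"
    using pseudo_divmod[OF p0 qr] dp dp' unfolding s_def k_def by auto
  have spc: "spec_poly c ?p \<noteq> 0" and dsp: "degree (spec_poly c ?p) = d"
  proof -
    have "ev c (along V w U) \<noteq> 0" using lead by (auto simp: ev.hom_uminus)
    then have nz: "coeff (spec_poly c ?p) d \<noteq> 0" using dp(2) by (simp add: coeff_map_poly)
    then show "spec_poly c ?p \<noteq> 0" by (metis coeff_0)
    have "degree (spec_poly c ?p) \<le> d" using degree_map_poly_le dp' by metis
    then show "degree (spec_poly c ?p) = d" using nz by (simp add: le_antisym le_degree)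
  qed
  have "r = 0"
  proof (rule ccontr)
    assume "r \<noteq> 0"
    then have dr: "degree r < d" using div by auto
    have noroot: "poly (spec_poly c (shift w G)) t \<noteq> 0" for t using G by (simp add: spec_shift)
    have "degree (spec_poly c (shift w G)) = 0"
    proof (rule ccontr)
      assume "degree (spec_poly c (shift w G)) \<noteq> 0"
      then have "\<not> constant (poly (spec_poly c (shift w G)))" by (simp add: constant_degree)
      from fundamental_theorem_of_algebra[OF this] noroot show False by blast
    qed
    then obtain a where a: "spec_poly c (shift w G) = [:a:]" by (metis degree_eq_zeroE)
    have a0: "a \<noteq> 0" using noroot[of 0] a by auto
    have "r ^ 1 * shift w G = ?p * (smult s (shift w H) - q * shift w G)"
    proof -
      have "?p * shift w H = shift w G * shift w Q" using eq by (simp flip: shift_mult)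
      then have "?p * smult s (shift w H) = shift w G * (?p * q + r)"
        by (simp flip: div(1))
      then show ?thesis by (simp add: algebra_simps)
    qed
    from remainder_vanishes[OF this dr spc, unfolded a] have "r = 0"
      using a0 dsp by (simp add: dvd_smult_iff) (metis dvd_imp_degree_le leD)
    with \<open>r \<noteq> 0\<close> show False by simp
  qed
  then have "poly (smult s (shift w Q)) 0 = poly (?p * q) 0" using div by simp
  then have "s * Q = U * poly q 0" by (simp add: shift_0)
  then have "s * (s * Q) = U * (s * poly q 0)" by (simp add: mult_ac)
  moreover have "s * (s * Q) = Q" using s by auto
  ultimately have "Q = U * (s * poly q 0)" by simp
  then show ?thesis by simp
qed

text \<open>If \<open>R\<close> vanishes on the zeros of \<open>U\<close>, then a power of \<open>R\<close> is divisible by \<open>U\<close> on every line in direction \<open>w\<close>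
on which \<open>U\<close> keeps its degree.  That \<open>R\<close> itself is divisible needs \<open>U\<close> to be reduced; this is guaranteed by one
line on which \<open>U\<close> has as many distinct roots as its degree in \<open>V\<close>.  The direction \<open>w\<close> need not make \<open>U\<close> monic, so the division is a
pseudodivision and a power of the leading coefficient appears.\<close>

lemma radical_divides:
  assumes hom: "homog V d U" and d: "d > 0"
    and w: "\<And>v. v \<notin> V \<Longrightarrow> w v = 0"
    and S: "card S = d" "\<And>s :: complex. s \<in> S \<Longrightarrow> ev (\<lambda>v. c v + s * ev c (w v)) U = 0"
    and s0: "ev (\<lambda>v. c v + s0 * ev c (w v)) U \<noteq> 0"
    and R: "\<And>c :: cvar \<Rightarrow> complex. ev c U = 0 \<Longrightarrow> ev c R = 0"
  shows "\<exists>k H. along V w U ^ k * R = U * H"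
proof -
  let ?p = "shift w U" and ?l = "along V w U"
  have dp: "degree ?p \<le> d" "coeff ?p d = ?l" using shift_homog[OF hom w] by auto
  have spd: "degree (spec_poly a ?p) \<le> d" for a using degree_map_poly_le dp by (metis order_trans)
  have pS: "poly (spec_poly c ?p) s = 0" if "s \<in> S" for s using S that by (simp add: spec_shift)
  have p0: "spec_poly c ?p \<noteq> 0" using s0 by (metis poly_0 spec_shift)
  have few: "y = 0" if "degree y < d" "\<And>s. s \<in> S \<Longrightarrow> poly y s = 0" for y :: "complex poly"
  proof (rule ccontr)
    assume "y \<noteq> 0"
    have "card S \<le> card {x. poly y x = 0}"
      using that(2) by (intro card_mono poly_roots_finite \<open>y \<noteq> 0\<close>) auto
    also have "\<dots> \<le> degree y" by (rule card_poly_roots_bound[OF \<open>y \<noteq> 0\<close>])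
    finally show False using that(1) S(1) by simp
  qed
  have dsp: "degree (spec_poly c ?p) = d" using few[of "spec_poly c ?p"] p0 pS spd[of c] by (meson le_neq_implies_less)
  then have lc: "ev c ?l \<noteq> 0" using p0 dp(2) by (metis coeff_map_poly ev_0 leading_coeff_0_iff)
  then have l0: "?l \<noteq> 0" by auto
  then have dp': "degree ?p = d" using dp by (metis le_antisym le_degree)
  have pne: "?p \<noteq> 0" using dp' d by auto
  obtain q r where "pseudo_divmod (shift w R) ?p = (q, r)" by fastforce
  from pseudo_divmod[OF pne this] dp dp' obtain k where
    div: "smult (?l ^ k) (shift w R) = ?p * q + r" and r: "r = 0 \<or> degree r < d" by auto
  obtain q2 r2 where "pseudo_divmod (r ^ d) ?p = (q2, r2)" by fastforce
  from pseudo_divmod[OF pne this] dp dp' obtain k2 where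
    div2: "smult (?l ^ k2) (r ^ d) = ?p * q2 + r2" and r2: "r2 = 0 \<or> degree r2 < d" by auto
  have "r2 = 0"
  proof (rule ccontr)
    assume ne: "r2 \<noteq> 0"
    with r2 have dr2: "degree r2 < d" by simp
    have "?l * coeff r2 i = 0" for i
    proof (rule cpoly_eqI)
      fix a :: "cvar \<Rightarrow> complex"
      have "ev a (coeff r2 i) = 0" if la: "ev a ?l \<noteq> 0"
      proof -
        have da: "degree (spec_poly a ?p) = d"
          using la dp(2) spd[of a] by (metis coeff_map_poly ev_0 le_antisym le_degree)
        have D: "smult (ev a ?l ^ k) (spec_poly a (shift w R)) = spec_poly a ?p * spec_poly a q + spec_poly a r"
          using arg_cong[OF div, of "spec_poly a"]
          by (simp add: map_poly_smult ev_mult map_ev.hom_mult map_ev.hom_add ev.hom_power)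
        have "poly (spec_poly a r) t = 0" if "poly (spec_poly a ?p) t = 0" for t
        proof -
          have "poly (spec_poly a (shift w R)) t = 0" using that R by (simp add: spec_shift)
          then show ?thesis using arg_cong[OF D, of "\<lambda>p. poly p t"] that by simp
        qed
        then have dvd: "spec_poly a ?p dvd spec_poly a r ^ d"
          using nullstellensatz_univariate[of "spec_poly a ?p" "spec_poly a r"] da d by auto
        have D2: "smult (ev a ?l ^ k2) (spec_poly a r ^ d) = spec_poly a ?p * spec_poly a q2 + spec_poly a r2"
          using arg_cong[OF div2, of "spec_poly a"]
          by (simp add: map_poly_smult ev_mult map_ev.hom_mult map_ev.hom_add ev.hom_power map_ev.hom_power)
        have "spec_poly a ?p dvd spec_poly a r2"
          using D2 dvd by (metis dvd_add_right_iff dvd_smult dvd_triv_left)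
        then have "spec_poly a r2 = 0"
          using dr2 da degree_map_poly_le[of "ev a" r2] by (metis dvd_imp_degree_le leD le_less_trans)
        then show ?thesis by (metis coeff_0 coeff_map_poly ev_0)
      qed
      then show "ev a (?l * coeff r2 i) = ev a 0" by (auto simp: ev_mult)
    qed
    then have "r2 = 0" using l0 by (simp add: poly_eq_iff)
    with ne show False by simp
  qed
  have "r = 0"
  proof (rule ccontr)
    assume "r \<noteq> 0"
    with r have dr: "degree r < d" by simp
    have eq: "r ^ d * [:?l ^ k2:] = ?p * q2" using div2 \<open>r2 = 0\<close> by simp
    have g: "spec_poly c [:?l ^ k2:] = [:ev c ?l ^ k2:]" by (simp add: map_ev_pCons ev.hom_power)
    have "r = 0"
    proof (rule remainder_vanishes[OF eq dr p0])
      show "spec_poly c [:?l ^ k2:] \<noteq> 0" unfolding g using lc by simp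
      fix y :: "complex poly"
      assume y: "degree y < d" "spec_poly c ?p dvd y ^ d * spec_poly c [:?l ^ k2:]"
      have "poly y s = 0" if "s \<in> S" for s
      proof -
        obtain z where "y ^ d * [:ev c ?l ^ k2:] = spec_poly c ?p * z" using y(2) g by (metis dvdE)
        from arg_cong[OF this, of "\<lambda>p. poly p s"] pS[OF that] lc show ?thesis by simp
      qed
      then show "y = 0" using few y(1) by blast
    qed
    with \<open>r \<noteq> 0\<close> show False by simp
  qed
  then have "poly (smult (?l ^ k) (shift w R)) 0 = poly (?p * q) 0" using div by simp
  then have "?l ^ k * R = U * poly q 0" by (simp add: shift_0)
  then show ?thesis by blast
qed

section \<open>Exactness of the Koszul complex in one variable\<close>

text \<open>Degree bound in a form that includes the zero polynomial and is closed under sums.\<close>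

definition deg_lt :: "nat \<Rightarrow> 'a :: zero poly \<Rightarrow> bool" where
  "deg_lt k a \<longleftrightarrow> (\<forall>j\<ge>k. coeff a j = 0)"

lemma deg_lt_iff: "deg_lt k a \<longleftrightarrow> a = 0 \<or> degree a < k"
proof
  assume "deg_lt k a"
  then show "a = 0 \<or> degree a < k" unfolding deg_lt_def
    by (metis leading_coeff_0_iff not_le)
qed (auto simp: deg_lt_def coeff_eq_0)

lemma deg_lt_0 [simp]: "deg_lt k 0" by (simp add: deg_lt_def)

lemma deg_lt_add: "deg_lt k a \<Longrightarrow> deg_lt k b \<Longrightarrow> deg_lt k (a + b :: 'a :: comm_ring_1 poly)"
  by (simp add: deg_lt_def)

lemma deg_lt_diff: "deg_lt k a \<Longrightarrow> deg_lt k b \<Longrightarrow> deg_lt k (a - b :: 'a :: comm_ring_1 poly)"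
  by (simp add: deg_lt_def)

lemma deg_lt_smult: "deg_lt k a \<Longrightarrow> deg_lt k (smult s a :: 'a :: comm_ring_1 poly)"
  by (simp add: deg_lt_def)

lemma deg_lt_sum:
  "(\<And>x. x \<in> S \<Longrightarrow> deg_lt k (f x)) \<Longrightarrow> deg_lt k (sum f S :: 'a :: comm_ring_1 poly)"
  by (simp add: deg_lt_def coeff_sum)

lemma deg_lt_mono: "deg_lt k a \<Longrightarrow> k \<le> l \<Longrightarrow> deg_lt l a"
  by (simp add: deg_lt_def)

lemma deg_lt_mult:
  fixes a b :: "complex poly"
  assumes "deg_lt k a" "deg_lt (Suc l) b"
  shows "deg_lt (k + l) (a * b)"
  using assms by (cases "a = 0 \<or> b = 0") (auto simp: deg_lt_iff degree_mult_eq)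

lemma deg_lt_cancel:
  fixes a b :: "complex poly"
  assumes "deg_lt (k + l) (a * b)" "coeff a l \<noteq> 0" "deg_lt (Suc l) a"
  shows "deg_lt k b"
proof (cases "b = 0")
  case False
  have "degree a = l" using assms(2,3) by (metis deg_lt_iff le_antisym le_degree less_Suc_eq_le coeff_0)
  moreover have "a \<noteq> 0" using assms(2) by auto
  ultimately show ?thesis using assms(1) False by (auto simp: deg_lt_iff degree_mult_eq)
qed simp

text \<open>Three binary forms of degree \<open>n\<close>, dehomogenized, without a common zero on the projective line; the last
condition excludes a common zero at infinity.\<close>

definition no_zero :: "nat \<Rightarrow> complex poly \<Rightarrow> complex poly \<Rightarrow> complex poly \<Rightarrow> bool" where
  "no_zero n g1 g2 g3 \<longleftrightarrow>
     deg_lt (Suc n) g1 \<and> deg_lt (Suc n) g2 \<and> deg_lt (Suc n) g3 \<and>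
     (\<forall>z. \<not> (poly g1 z = 0 \<and> poly g2 z = 0 \<and> poly g3 z = 0)) \<and>
     \<not> (coeff g1 n = 0 \<and> coeff g2 n = 0 \<and> coeff g3 n = 0)"

lemma no_zero_rotate: "no_zero n g1 g2 g3 \<Longrightarrow> no_zero n g2 g3 g1"
  by (auto simp: no_zero_def)

lemma no_zero_bezout:
  assumes "no_zero n g1 g2 g3"
  shows "\<exists>s1 s2 s3. s1 * g1 + s2 * g2 + s3 * g3 = 1"
proof -
  define d where "d = gcd g1 (gcd g2 g3)"
  have dv: "d dvd g1" "d dvd g2" "d dvd g3"
    unfolding d_def by (auto intro: dvd_trans)
  have "d \<noteq> 0" using assms by (auto simp: d_def no_zero_def)
  have "degree d = 0"
  proof (rule ccontr)
    assume "degree d \<noteq> 0"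
    then have "\<not> constant (poly d)" by (simp add: constant_degree)
    then obtain z where "poly d z = 0" using fundamental_theorem_of_algebra by blast
    then have "poly g1 z = 0 \<and> poly g2 z = 0 \<and> poly g3 z = 0"
      using dv by (metis dvdE mult_zero_left poly_mult)
    with assms show False by (auto simp: no_zero_def)
  qed
  with \<open>d \<noteq> 0\<close> have "is_unit d" by (simp add: is_unit_iff_degree)
  then obtain e where e: "d * e = 1" by (metis dvdE)
  obtain a b where ab: "a * g1 + b * gcd g2 g3 = d" unfolding d_def by (metis bezout_coefficients_fst_snd)
  obtain a' b' where ab': "a' * g2 + b' * g3 = gcd g2 g3" by (metis bezout_coefficients_fst_snd)
  have "(e * a) * g1 + (e * b * a') * g2 + (e * b * b') * g3 = e * (a * g1 + b * (a' * g2 + b' * g3))"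
    by (simp add: algebra_simps)
  also have "\<dots> = 1" unfolding ab' ab using e by (simp add: mult.commute)
  finally show ?thesis by blast
qed

text \<open>With $s \cdot g = 1$ and $A \cdot g = 0$ one has $A = g \times (A \times s)$, so every syzygy is Koszul.
The vector $A \times s$ may be changed by a multiple of $g$; reducing its third component modulo
$g_3$ makes that component small, and then the other two are bounded because $g_3$ has degree exactly $n$.\<close>

lemma koszul_univariate_aux:
  fixes g1 g2 g3 :: "complex poly"
  assumes "no_zero n g1 g2 g3" "n > 0" "coeff g3 n \<noteq> 0"
    and "deg_lt (2 * n) A1" "deg_lt (2 * n) A2" "deg_lt (2 * n) A3"
    and syz: "A1 * g1 + A2 * g2 + A3 * g3 = 0"
  shows "\<exists>C1 C2 C3. deg_lt n C1 \<and> deg_lt n C2 \<and> deg_lt n C3 \<and>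
    A1 = g2 * C3 - g3 * C2 \<and> A2 = g3 * C1 - g1 * C3 \<and> A3 = g1 * C2 - g2 * C1"
proof -
  obtain s1 s2 s3 where s: "s1 * g1 + s2 * g2 + s3 * g3 = 1" using no_zero_bezout[OF assms(1)] by blast
  \<comment> \<open>\<open>C\<close> is the cross product of \<open>A\<close> and \<open>s\<close>, minus \<open>h\<close> times \<open>g\<close>\<close>
  define h where "h = (A1 * s2 - A2 * s1) div g3"
  define C1 where "C1 = A2 * s3 - A3 * s2 - h * g1"
  define C2 where "C2 = A3 * s1 - A1 * s3 - h * g2"
  define C3 where "C3 = A1 * s2 - A2 * s1 - h * g3"
  have g: "deg_lt (Suc n) g1" "deg_lt (Suc n) g2" "deg_lt (Suc n) g3" using assms(1) by (auto simp: no_zero_def)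
  have dg: "degree g3 = n" using g(3) assms(3) by (metis deg_lt_iff le_antisym le_degree less_Suc_eq_le coeff_0)
  have "g2 * C3 - g3 * C2 = A1 * (s1 * g1 + s2 * g2 + s3 * g3) - s1 * (A1 * g1 + A2 * g2 + A3 * g3)"
    by (simp add: C2_def C3_def algebra_simps)
  then have e1: "A1 = g2 * C3 - g3 * C2" by (simp add: s syz)
  have "g3 * C1 - g1 * C3 = A2 * (s1 * g1 + s2 * g2 + s3 * g3) - s2 * (A1 * g1 + A2 * g2 + A3 * g3)"
    by (simp add: C1_def C3_def algebra_simps)
  then have e2: "A2 = g3 * C1 - g1 * C3" by (simp add: s syz)
  have "g1 * C2 - g2 * C1 = A3 * (s1 * g1 + s2 * g2 + s3 * g3) - s3 * (A1 * g1 + A2 * g2 + A3 * g3)"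
    by (simp add: C1_def C2_def algebra_simps)
  then have e3: "A3 = g1 * C2 - g2 * C1" by (simp add: s syz)
  have "C3 = (A1 * s2 - A2 * s1) mod g3" by (simp add: C3_def h_def minus_div_mult_eq_mod)
  then have c3: "deg_lt n C3" using degree_mod_less[of g3 "A1 * s2 - A2 * s1"] dg assms(2)
    by (cases "g3 = 0") (auto simp: deg_lt_iff)
  have "g3 * C2 = C3 * g2 - A1" by (simp add: e1 algebra_simps)
  moreover have "deg_lt (n + n) (C3 * g2 - A1)"
    using deg_lt_mult[OF c3 g(2)] assms(4) by (simp add: deg_lt_diff mult_2)
  ultimately have c2: "deg_lt n C2" using deg_lt_cancel[of n n g3 C2] assms(3) g(3) by simp
  have "g3 * C1 = A2 + C3 * g1" by (simp add: e2 algebra_simps)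
  moreover have "deg_lt (n + n) (A2 + C3 * g1)"
    using deg_lt_mult[OF c3 g(1)] assms(5) by (simp add: deg_lt_add mult_2)
  ultimately have c1: "deg_lt n C1" using deg_lt_cancel[of n n g3 C1] assms(3) g(3) by simp
  from c1 c2 c3 e1 e2 e3 show ?thesis by blast
qed

lemma koszul_univariate:
  fixes g1 g2 g3 :: "complex poly"
  assumes g: "no_zero n g1 g2 g3" and n: "n > 0"
    and A: "deg_lt (2 * n) A1" "deg_lt (2 * n) A2" "deg_lt (2 * n) A3"
    and syz: "A1 * g1 + A2 * g2 + A3 * g3 = 0"
  shows "\<exists>C1 C2 C3. deg_lt n C1 \<and> deg_lt n C2 \<and> deg_lt n C3 \<and>
    A1 = g2 * C3 - g3 * C2 \<and> A2 = g3 * C1 - g1 * C3 \<and> A3 = g1 * C2 - g2 * C1"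
proof -
  consider "coeff g3 n \<noteq> 0" | "coeff g1 n \<noteq> 0" | "coeff g2 n \<noteq> 0"
    using g by (auto simp: no_zero_def)
  then show ?thesis
  proof cases
    case 1
    from koszul_univariate_aux[OF g n 1 A syz] show ?thesis .
  next
    case 2
    have "A2 * g2 + A3 * g3 + A1 * g1 = 0" using syz by (simp add: algebra_simps)
    from koszul_univariate_aux[OF no_zero_rotate[OF g] n 2 A(2,3,1) this] show ?thesis by blast
  next
    case 3
    have "A3 * g3 + A1 * g1 + A2 * g2 = 0" using syz by (simp add: algebra_simps)
    from koszul_univariate_aux[OF no_zero_rotate[OF no_zero_rotate[OF g]] n 3 A(3,1,2) this]
    show ?thesis by blast
  qed
qed

text \<open>Write $h = \sum h s_i g_i$ and reduce the first two coefficients modulo $g_3$; the degree of the third one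
is then forced by the degree of $h$.\<close>

lemma surj_univariate_aux:
  fixes g1 g2 g3 :: "complex poly"
  assumes "no_zero n g1 g2 g3" "n > 0" "coeff g3 n \<noteq> 0" and h: "deg_lt (3 * n) h"
  shows "\<exists>A1 A2 A3. deg_lt (2 * n) A1 \<and> deg_lt (2 * n) A2 \<and> deg_lt (2 * n) A3 \<and>
    h = A1 * g1 + A2 * g2 + A3 * g3"
proof -
  obtain s1 s2 s3 where s: "s1 * g1 + s2 * g2 + s3 * g3 = 1" using no_zero_bezout[OF assms(1)] by blast
  have g: "deg_lt (Suc n) g1" "deg_lt (Suc n) g2" "deg_lt (Suc n) g3" using assms(1) by (auto simp: no_zero_def)
  have dg: "degree g3 = n" using g(3) assms(3) by (metis deg_lt_iff le_antisym le_degree less_Suc_eq_le coeff_0)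
  define A1 where "A1 = (h * s1) mod g3"
  define A2 where "A2 = (h * s2) mod g3"
  define A3 where "A3 = h * s3 + g1 * ((h * s1) div g3) + g2 * ((h * s2) div g3)"
  have a: "deg_lt n A1" "deg_lt n A2"
    using degree_mod_less[of g3 "h * s1"] degree_mod_less[of g3 "h * s2"] dg assms(2)
    by (cases "g3 = 0", simp, force simp: deg_lt_iff A1_def, cases "g3 = 0", simp, force simp: deg_lt_iff A2_def)
  have "A1 * g1 + A2 * g2 + A3 * g3
    = g1 * (h * s1 mod g3 + (h * s1 div g3) * g3) + g2 * (h * s2 mod g3 + (h * s2 div g3) * g3) + h * s3 * g3"
    by (simp only: A1_def A2_def A3_def algebra_simps)
  also have "\<dots> = h * (s1 * g1 + s2 * g2 + s3 * g3)" by (simp add: algebra_simps)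
  finally have e: "h = A1 * g1 + A2 * g2 + A3 * g3" by (simp add: s)
  have "g3 * A3 = h - A1 * g1 - A2 * g2" by (simp add: e algebra_simps)
  moreover have "deg_lt (2 * n + n) (h - A1 * g1 - A2 * g2)"
    using h deg_lt_mult[OF a(1) g(1)] deg_lt_mult[OF a(2) g(2)]
    by (auto intro!: deg_lt_diff elim: deg_lt_mono)
  ultimately have "deg_lt (2 * n) A3" using deg_lt_cancel[of "2 * n" n g3 A3] assms(3) g(3) by simp
  then show ?thesis using a e deg_lt_mono[of n _ "2 * n"] by (metis le_add1 mult_2)
qed

lemma surj_univariate:
  fixes g1 g2 g3 :: "complex poly"
  assumes g: "no_zero n g1 g2 g3" and n: "n > 0" and h: "deg_lt (3 * n) h"
  shows "\<exists>A1 A2 A3. deg_lt (2 * n) A1 \<and> deg_lt (2 * n) A2 \<and> deg_lt (2 * n) A3 \<and>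
    h = A1 * g1 + A2 * g2 + A3 * g3"
proof -
  consider "coeff g3 n \<noteq> 0" | "coeff g1 n \<noteq> 0" | "coeff g2 n \<noteq> 0"
    using g by (auto simp: no_zero_def)
  then show ?thesis
  proof cases
    case 1
    from surj_univariate_aux[OF g n 1 h] show ?thesis .
  next
    case 2
    from surj_univariate_aux[OF no_zero_rotate[OF g] n 2 h]
    show ?thesis by (metis add.commute add.assoc)
  next
    case 3
    from surj_univariate_aux[OF no_zero_rotate[OF no_zero_rotate[OF g]] n 3 h]
    show ?thesis by (metis add.commute add.assoc)
  qed
qed

text \<open>Padding by zero rows gives a singular square matrix.\<close>

lemma nontrivial_kernel:
  fixes f :: "nat \<Rightarrow> nat \<Rightarrow> 'a :: field"
  assumes "k < N"
  shows "\<exists>a. (\<exists>j<N. a j \<noteq> 0) \<and> (\<forall>r<k. (\<Sum>j<N. f r j * a j) = 0)"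
proof -
  define M where "M = mat N N (\<lambda>(r, j). if r < k then f r j else 0)"
  have M: "M \<in> carrier_mat N N" by (simp add: M_def)
  have "det (transpose_mat M) = 0"
  proof (subst det_0_iff_vec_prod_zero_field[of _ N])
    show "\<exists>v. v \<in> carrier_vec N \<and> v \<noteq> 0\<^sub>v N \<and> transpose_mat M *\<^sub>v v = 0\<^sub>v N"
    proof (intro exI conjI)
      show "unit_vec N k \<noteq> 0\<^sub>v N" using assms by (metis index_unit_vec(1) index_zero_vec(1) one_neq_zero)
      show "transpose_mat M *\<^sub>v unit_vec N k = 0\<^sub>v N"
        using assms by (intro eq_vecI) (auto simp: M_def)
    qed simp
  qed (simp add: M_def)
  then have "det M = 0" using det_transpose[OF M] by simp
  then obtain v where v: "v \<in> carrier_vec N" "v \<noteq> 0\<^sub>v N" "M *\<^sub>v v = 0\<^sub>v N"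
    using det_0_iff_vec_prod_zero_field[OF M] by auto
  have "\<exists>j<N. v $ j \<noteq> 0" using v(1,2) by (auto simp: vec_eq_iff)
  moreover have "(\<Sum>j<N. f r j * v $ j) = 0" if "r < k" for r
  proof -
    have "(M *\<^sub>v v) $ r = 0" using v(3) that assms by simp
    moreover have "(M *\<^sub>v v) $ r = (\<Sum>j<N. f r j * v $ j)"
      using that assms v(1) by (auto simp: M_def scalar_prod_def lessThan_atLeast0 intro!: sum.cong)
    ultimately show ?thesis by simp
  qed
  ultimately show ?thesis by blast
qed

section \<open>Exactness of the Koszul complex in two variables\<close>

text \<open>A polynomial in $x_1, x_2$ is a polynomial in $x_1$ whose coefficients are polynomials in $x_2$; this
bounds the degree in $x_2$.\<close>

definition zdeg_lt :: "nat \<Rightarrow> complex poly poly \<Rightarrow> bool" where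
  "zdeg_lt k A \<longleftrightarrow> (\<forall>i. deg_lt k (coeff A i))"

lemma zdeg_lt_0 [simp]: "zdeg_lt k 0" by (simp add: zdeg_lt_def)
lemma zdeg_lt_add: "zdeg_lt k a \<Longrightarrow> zdeg_lt k b \<Longrightarrow> zdeg_lt k (a + b)"
  by (simp add: zdeg_lt_def deg_lt_add)
lemma zdeg_lt_diff: "zdeg_lt k a \<Longrightarrow> zdeg_lt k b \<Longrightarrow> zdeg_lt k (a - b)"
  by (simp add: zdeg_lt_def deg_lt_diff)
lemma zdeg_lt_mult: "zdeg_lt k A \<Longrightarrow> zdeg_lt (Suc l) B \<Longrightarrow> zdeg_lt (k + l) (A * B)"
  by (simp add: zdeg_lt_def coeff_mult deg_lt_sum deg_lt_mult)
lemma zdeg_lt_monom: "deg_lt k a \<Longrightarrow> zdeg_lt k (monom a i)"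
  by (simp add: zdeg_lt_def)
lemma zdeg_lt_shift: "zdeg_lt k A \<Longrightarrow> zdeg_lt k (monom 1 i * A)"
  by (simp add: zdeg_lt_def coeff_monom_mult)
lemma zdeg_lt_const: "deg_lt k a \<Longrightarrow> zdeg_lt k [:a:]"
  by (simp add: zdeg_lt_def coeff_pCons split: nat.split)
lemma zdeg_lt_scale: "zdeg_lt k A \<Longrightarrow> zdeg_lt k (smult [:s:] A)"
  by (simp add: zdeg_lt_def deg_lt_smult)

lemma zdeg_lt_eval:
  assumes "zdeg_lt k A"
  shows "deg_lt k (poly A [:t:])"
proof -
  have "coeff A i * [:t:] ^ i = smult (t ^ i) (coeff A i)" for i
    by (simp add: poly_const_pow)
  then show ?thesis using assms unfolding poly_altdef
    by (intro deg_lt_sum) (simp add: zdeg_lt_def deg_lt_smult)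
qed

text \<open>The coefficients of the quotient are recovered from the top one downwards.\<close>

lemma zdeg_lt_divide_linear:
  assumes "zdeg_lt k ([:-[:t:], 1:] * A)"
  shows "zdeg_lt k A"
  unfolding zdeg_lt_def
proof
  fix i
  show "deg_lt k (coeff A i)"
  proof (induction "Suc (degree A) - i" arbitrary: i)
    case 0
    then show ?case by (simp add: coeff_eq_0)
  next
    case (Suc x)
    then have "deg_lt k (coeff A (Suc i))" by simp
    moreover have "coeff ([:-[:t:], 1:] * A) (Suc i) = coeff A i - smult t (coeff A (Suc i))"
      by simp
    ultimately show ?case using assms unfolding zdeg_lt_def
      by (metis deg_lt_add deg_lt_smult diff_add_cancel)
  qed
qed

text \<open>Three dehomogenized forms of bidegree $(m,n)$ without a common zero on $\mathbb{P}^1 \times \mathbb{P}^1$,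
expressed fibrewise over the first factor: \<open>fin\<close> for the finite points, \<open>inf\<close> for the fibre at infinity.\<close>

locale no_common_zero =
  fixes m n :: nat and F1 F2 F3 :: "complex poly poly"
  assumes m: "m > 0" and n: "n > 0"
    and dx: "degree F1 \<le> m" "degree F2 \<le> m" "degree F3 \<le> m"
    and dz: "zdeg_lt (Suc n) F1" "zdeg_lt (Suc n) F2" "zdeg_lt (Suc n) F3"
    and fin: "\<And>t. no_zero n (poly F1 [:t:]) (poly F2 [:t:]) (poly F3 [:t:])"
    and inf: "no_zero n (coeff F1 m) (coeff F2 m) (coeff F3 m)"
begin

text \<open>The degree in $x_1$ is left free here; only the degree in $x_2$ is controlled.\<close>

definition in_ideal :: "complex poly poly \<Rightarrow> bool" where
  "in_ideal H \<longleftrightarrow> (\<exists>A1 A2 A3. zdeg_lt (2 * n) A1 \<and> zdeg_lt (2 * n) A2 \<and> zdeg_lt (2 * n) A3 \<and>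
     H = A1 * F1 + A2 * F2 + A3 * F3)"

lemma in_ideal_0: "in_ideal 0"
  unfolding in_ideal_def by (rule exI[of _ 0])+ simp

lemma in_ideal_add:
  assumes "in_ideal H" "in_ideal G"
  shows "in_ideal (H + G)"
proof -
  from assms obtain A1 A2 A3 B1 B2 B3 where
    *: "zdeg_lt (2 * n) A1" "zdeg_lt (2 * n) A2" "zdeg_lt (2 * n) A3" "H = A1 * F1 + A2 * F2 + A3 * F3"
    "zdeg_lt (2 * n) B1" "zdeg_lt (2 * n) B2" "zdeg_lt (2 * n) B3" "G = B1 * F1 + B2 * F2 + B3 * F3"
    unfolding in_ideal_def by blast
  have "H + G = (A1 + B1) * F1 + (A2 + B2) * F2 + (A3 + B3) * F3" using * by (simp add: algebra_simps)
  with * show ?thesis unfolding in_ideal_def by (meson zdeg_lt_add)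
qed

lemma in_ideal_scale:
  assumes "in_ideal H"
  shows "in_ideal (smult [:s:] H)"
proof -
  from assms obtain A1 A2 A3 where
    *: "zdeg_lt (2 * n) A1" "zdeg_lt (2 * n) A2" "zdeg_lt (2 * n) A3" "H = A1 * F1 + A2 * F2 + A3 * F3"
    unfolding in_ideal_def by blast
  have "smult [:s:] H = smult [:s:] A1 * F1 + smult [:s:] A2 * F2 + smult [:s:] A3 * F3"
    using * by (simp add: smult_add_right)
  with * show ?thesis unfolding in_ideal_def by (meson zdeg_lt_scale)
qed

lemma in_ideal_sum: "(\<And>x. x \<in> S \<Longrightarrow> in_ideal (f x)) \<Longrightarrow> in_ideal (sum f S)"
  by (induction S rule: infinite_finite_induct) (auto simp: in_ideal_0 in_ideal_add)

text \<open>Restricting $(x_1 - t) H = \sum A_i F_i$ to the fibre $x_1 = t$ gives a syzygy of three forms in one variable.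
It is a Koszul syzygy; subtracting its lift makes all $A_i$ divisible by $x_1 - t$.\<close>

lemma divide_linear:
  assumes "in_ideal ([:-[:t:], 1:] * H)"
  shows "in_ideal H"
proof -
  let ?l = "[:-[:t:], 1:]"
  obtain A1 A2 A3 where A: "zdeg_lt (2 * n) A1" "zdeg_lt (2 * n) A2" "zdeg_lt (2 * n) A3"
    "?l * H = A1 * F1 + A2 * F2 + A3 * F3" using assms unfolding in_ideal_def by blast
  let ?e = "\<lambda>F. poly F [:t:]"
  have "?e A1 * ?e F1 + ?e A2 * ?e F2 + ?e A3 * ?e F3 = 0"
    using arg_cong[OF A(4), of ?e] by simp
  from koszul_univariate[OF fin n _ _ _ this] A zdeg_lt_eval obtain C1 C2 C3 where
    C: "deg_lt n C1" "deg_lt n C2" "deg_lt n C3" "?e A1 = ?e F2 * C3 - ?e F3 * C2"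
    "?e A2 = ?e F3 * C1 - ?e F1 * C3" "?e A3 = ?e F1 * C2 - ?e F2 * C1" by metis
  have c: "zdeg_lt (2 * n) ([:D:] * F)" if "deg_lt n D" "zdeg_lt (Suc n) F" for D F
    using zdeg_lt_mult[OF zdeg_lt_const[OF that(1)] that(2)] by (simp add: mult_2)
  have "?e (A1 - ([:C3:] * F2 - [:C2:] * F3)) = 0" using C by (simp add: mult.commute)
  then obtain B1 where B1: "A1 - ([:C3:] * F2 - [:C2:] * F3) = ?l * B1" by (metis poly_eq_0_iff_dvd dvdE)
  have "?e (A2 - ([:C1:] * F3 - [:C3:] * F1)) = 0" using C by (simp add: mult.commute)
  then obtain B2 where B2: "A2 - ([:C1:] * F3 - [:C3:] * F1) = ?l * B2" by (metis poly_eq_0_iff_dvd dvdE)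
  have "?e (A3 - ([:C2:] * F1 - [:C1:] * F2)) = 0" using C by (simp add: mult.commute)
  then obtain B3 where B3: "A3 - ([:C2:] * F1 - [:C1:] * F2) = ?l * B3" by (metis poly_eq_0_iff_dvd dvdE)
  have "zdeg_lt (2 * n) B1" "zdeg_lt (2 * n) B2" "zdeg_lt (2 * n) B3"
    by (rule zdeg_lt_divide_linear[of _ t], simp only: B1[symmetric] B2[symmetric] B3[symmetric],
        intro zdeg_lt_diff A c C dz)+
  moreover have "?l * H = ?l * (B1 * F1 + B2 * F2 + B3 * F3)"
  proof -
    have "?l * (B1 * F1 + B2 * F2 + B3 * F3) = (?l * B1) * F1 + (?l * B2) * F2 + (?l * B3) * F3"
      by (simp only: distrib_left mult.assoc)
    also have "\<dots> = A1 * F1 + A2 * F2 + A3 * F3"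
      unfolding B1[symmetric] B2[symmetric] B3[symmetric] by (simp only: algebra_simps)
    finally show ?thesis using A(4) by simp
  qed
  then have "H = B1 * F1 + B2 * F2 + B3 * F3" by (metis mult_cancel_left pCons_eq_0_iff one_neq_zero)
  ultimately show ?thesis unfolding in_ideal_def by blast
qed

text \<open>Over $\mathbb{C}$ the factor splits into linear ones.\<close>

lemma divide_polynomial:
  assumes "\<alpha> \<noteq> 0" "in_ideal (map_poly (\<lambda>a. [:a:]) \<alpha> * H)"
  shows "in_ideal H"
  using assms
proof (induction "degree \<alpha>" arbitrary: \<alpha> rule: less_induct)
  case less
  interpret cp: map_poly_comm_ring_hom "\<lambda>a :: complex. [:a:]"
    by unfold_locales (simp_all add: pCons_one)
  show ?case
  proof (cases "degree \<alpha> = 0")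
    case True
    then obtain a where a: "\<alpha> = [:a:]" by (metis degree_eq_zeroE)
    with less.prems have "in_ideal (smult [:a:] H)" and "a \<noteq> 0"
      by (auto simp: map_poly_pCons)
    from in_ideal_scale[OF this(1)] have "in_ideal (smult [:1/a:] (smult [:a:] H))" .
    moreover have "smult [:1/a:] (smult [:a:] H) = smult ([:1/a:] * [:a:]) H" by (simp only: smult_smult)
    moreover have "[:1/a:] * [:a:] = 1" using \<open>a \<noteq> 0\<close> by (simp add: pCons_one)
    ultimately show ?thesis by simp
  next
    case False
    then obtain t where "poly \<alpha> t = 0"
      using fundamental_theorem_of_algebra[of \<alpha>] by (auto simp: constant_degree)
    then obtain \<beta> where \<beta>: "\<alpha> = [:-t, 1:] * \<beta>" by (metis poly_eq_0_iff_dvd dvdE)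
    with less.prems have nz: "\<beta> \<noteq> 0" by auto
    then have "degree \<beta> < degree \<alpha>" by (simp add: \<beta> degree_mult_eq del: mult_pCons_left)
    moreover have "map_poly (\<lambda>a. [:a:]) \<alpha> = [:-[:t:], 1:] * map_poly (\<lambda>a. [:a:]) \<beta>"
      unfolding \<beta> cp.hom_mult by (simp add: map_poly_pCons pCons_one)
    then have "in_ideal ([:-[:t:], 1:] * (map_poly (\<lambda>a. [:a:]) \<beta> * H))"
      using less.prems by (simp only: mult.assoc)
    then have "in_ideal (map_poly (\<lambda>a. [:a:]) \<beta> * H)" by (rule divide_linear)
    ultimately show ?thesis using less.hyps nz by blast
  qed
qed

text \<open>Surjectivity in the fibre at infinity lets one remove the leading coefficient in $x_1$.\<close>

lemma reduce_degree:
  assumes "zdeg_lt (3 * n) H"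
  shows "\<exists>G. zdeg_lt (3 * n) G \<and> degree G \<le> m \<and> in_ideal (H - G)"
  using assms
proof (induction "degree H" arbitrary: H rule: less_induct)
  case less
  show ?case
  proof (cases "degree H \<le> m")
    case True
    then show ?thesis using less.prems in_ideal_0 by (intro exI[of _ H]) simp
  next
    case False
    let ?d = "degree H"
    have "deg_lt (3 * n) (lead_coeff H)" using less.prems by (simp add: zdeg_lt_def)
    from surj_univariate[OF inf n this] obtain a1 a2 a3 where
      a: "deg_lt (2 * n) a1" "deg_lt (2 * n) a2" "deg_lt (2 * n) a3"
      "lead_coeff H = a1 * coeff F1 m + a2 * coeff F2 m + a3 * coeff F3 m" by blast
    let ?M = "\<lambda>a. monom a (?d - m)"
    define K where "K = ?M a1 * F1 + ?M a2 * F2 + ?M a3 * F3"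
    have K: "in_ideal K" unfolding in_ideal_def K_def using a zdeg_lt_monom by blast
    have Kz: "zdeg_lt (3 * n) K"
    proof -
      have "zdeg_lt (2 * n + n) K" unfolding K_def
        by (intro zdeg_lt_add zdeg_lt_mult zdeg_lt_monom a dz)
      then show ?thesis by simp
    qed
    have t: "degree (?M a * F) \<le> ?d \<and> coeff (?M a * F) ?d = a * coeff F m" if "degree F \<le> m"
      for a :: "complex poly" and F :: "complex poly poly"
      using coeff_mult_le[OF degree_monom_le[of a "?d - m"] that] False by simp
    have dK: "degree K \<le> ?d" unfolding K_def by (intro degree_add_le t[THEN conjunct1] dx)
    have cK: "coeff K ?d = lead_coeff H" unfolding K_def a(4) by (simp add: t dx)
    have "degree (H - K) < ?d"
    proof (cases "H - K = 0")
      case True with False show ?thesis by simp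
    next
      case ne: False
      have "degree (H - K) \<le> ?d" by (intro degree_diff_le dK) simp
      moreover have "coeff (H - K) ?d = 0" using cK by simp
      ultimately show ?thesis using ne by (metis leading_coeff_0_iff le_neq_implies_less)
    qed
    from less.hyps[OF this zdeg_lt_diff[OF less.prems Kz]] obtain G where
      G: "zdeg_lt (3 * n) G" "degree G \<le> m" "in_ideal (H - K - G)" by blast
    from in_ideal_add[OF G(3) K] have "in_ideal (H - G)" by (simp add: algebra_simps)
    with G show ?thesis by blast
  qed
qed

text \<open>Modulo the ideal all $x_1^k H$ have representatives in one finite-dimensional space, so a nonzero
polynomial in $x_1$ multiplies $H$ into the ideal, and such a factor can be divided out.\<close>

lemma everything_in_ideal:
  assumes H: "zdeg_lt (3 * n) H"
  shows "in_ideal H"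
proof -
  have "\<exists>G. zdeg_lt (3 * n) G \<and> degree G \<le> m \<and> in_ideal (monom 1 k * H - G)" for k
    by (rule reduce_degree) (rule zdeg_lt_shift[OF H])
  then obtain G where G: "\<And>k. zdeg_lt (3 * n) (G k)" "\<And>k. degree (G k) \<le> m"
    "\<And>k. in_ideal (monom 1 k * H - G k)" by metis
  \<comment> \<open>the dimension of the space containing all \<open>G k\<close>, so \<open>G 0, \<dots>, G D\<close> are linearly dependent\<close>
  define D where "D = Suc m * (3 * n)"
  have "D < Suc D" by simp
  from nontrivial_kernel[OF this, of "\<lambda>r k. coeff (coeff (G k) (r div (3 * n))) (r mod (3 * n))"]
  obtain a where a: "\<exists>j<Suc D. a j \<noteq> 0"
    "\<And>r. r < D \<Longrightarrow> (\<Sum>j<Suc D. coeff (coeff (G j) (r div (3 * n))) (r mod (3 * n)) * a j) = 0" by blast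
  have dep: "(\<Sum>k<Suc D. smult [:a k:] (G k)) = 0"
  proof (intro poly_eqI)
    fix i j
    show "coeff (coeff (\<Sum>k<Suc D. smult [:a k:] (G k)) i) j = coeff (coeff 0 i) j"
    proof (cases "i \<le> m \<and> j < 3 * n")
      case True
      have "i * (3 * n) + j < Suc i * (3 * n)" using True by simp
      also have "\<dots> \<le> D" unfolding D_def using True by (intro mult_le_mono1) simp
      finally have "i * (3 * n) + j < D" .
      from a(2)[OF this] True n show ?thesis by (simp add: coeff_sum mult.commute)
    next
      case False
      have "coeff (coeff (G k) i) j = 0" for k
      proof (cases "i \<le> m")
        case True
        then show ?thesis using False G(1)[of k] by (simp add: zdeg_lt_def deg_lt_def)
      next
        case False
        then show ?thesis using G(2)[of k] by (simp add: coeff_eq_0)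
      qed
      then show ?thesis by (simp add: coeff_sum)
    qed
  qed
  define \<alpha> where "\<alpha> = (\<Sum>k<Suc D. monom (a k) k)"
  have ca: "coeff \<alpha> j = a j" if "j < Suc D" for j
    using that by (simp add: \<alpha>_def coeff_sum del: sum.lessThan_Suc)
  have "\<alpha> \<noteq> 0" using a(1) ca by (metis coeff_0)
  interpret cp: map_poly_comm_ring_hom "\<lambda>a :: complex. [:a:]"
    by unfold_locales (simp_all add: pCons_one)
  have "map_poly (\<lambda>a. [:a:]) \<alpha> = (\<Sum>k<Suc D. monom [:a k:] k)"
    unfolding \<alpha>_def cp.hom_sum by (simp add: map_poly_monom)
  then have "map_poly (\<lambda>a. [:a:]) \<alpha> * H = (\<Sum>k<Suc D. smult [:a k:] (monom 1 k * H))"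
    by (simp add: sum_distrib_right smult_monom flip: mult_smult_left del: sum.lessThan_Suc)
  also have "\<dots> = (\<Sum>k<Suc D. smult [:a k:] (monom 1 k * H - G k)) + (\<Sum>k<Suc D. smult [:a k:] (G k))"
    by (simp add: smult_diff_right sum_subtractf del: sum.lessThan_Suc)
  finally have "map_poly (\<lambda>a. [:a:]) \<alpha> * H = (\<Sum>k<Suc D. smult [:a k:] (monom 1 k * H - G k))"
    unfolding dep by simp
  then have "in_ideal (map_poly (\<lambda>a. [:a:]) \<alpha> * H)"
    by (simp only:) (intro in_ideal_sum in_ideal_scale G)
  from divide_polynomial[OF \<open>\<alpha> \<noteq> 0\<close> this] show ?thesis .
qed

text \<open>The Koszul complex of three forms without common zero is exact at its last place in bidegree
$(3m-1,3n-1)$.  It remains to bound the degree of the multipliers in $x_1$: a top coefficient beyond the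
bound is a syzygy in the fibre at infinity, and subtracting the lift of the corresponding Koszul
syzygy lowers the degree.\<close>

theorem bidegree_surjective:
  assumes H: "zdeg_lt (3 * n) H" "degree H < 3 * m"
  shows "\<exists>A1 A2 A3. zdeg_lt (2 * n) A1 \<and> zdeg_lt (2 * n) A2 \<and> zdeg_lt (2 * n) A3 \<and>
     degree A1 < 2 * m \<and> degree A2 < 2 * m \<and> degree A3 < 2 * m \<and>
     H = A1 * F1 + A2 * F2 + A3 * F3"
proof -
  have lower: "\<exists>A1 A2 A3. zdeg_lt (2 * n) A1 \<and> zdeg_lt (2 * n) A2 \<and> zdeg_lt (2 * n) A3 \<and>
     degree A1 < 2 * m \<and> degree A2 < 2 * m \<and> degree A3 < 2 * m \<and>
     H = A1 * F1 + A2 * F2 + A3 * F3"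
    if "zdeg_lt (2 * n) A1" "zdeg_lt (2 * n) A2" "zdeg_lt (2 * n) A3"
      "degree A1 \<le> d" "degree A2 \<le> d" "degree A3 \<le> d" "H = A1 * F1 + A2 * F2 + A3 * F3"
    for d A1 A2 A3
    using that
  proof (induction d arbitrary: A1 A2 A3)
    case 0
    with m show ?case by (intro exI conjI) auto
  next
    case (Suc d)
    show ?case
    proof (cases "Suc d < 2 * m")
      case True
      with Suc.prems show ?thesis by (intro exI[of _ A1] exI[of _ A2] exI[of _ A3]) auto
    next
      case False
      let ?s = "Suc d"
      have t: "coeff (A * F) (Suc (d + m)) = coeff A ?s * coeff F m" if "degree A \<le> ?s" "degree F \<le> m" for A F :: "complex poly poly"
        using coeff_mult_le[OF that] by simp
      have "coeff H (?s + m) = 0" using H(2) False by (intro coeff_eq_0) linarith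
      then have "coeff A1 ?s * coeff F1 m + coeff A2 ?s * coeff F2 m + coeff A3 ?s * coeff F3 m = 0"
        using Suc.prems by (simp add: t dx)
      from koszul_univariate[OF inf n _ _ _ this] Suc.prems obtain C1 C2 C3 where
        C: "deg_lt n C1" "deg_lt n C2" "deg_lt n C3"
        "coeff A1 ?s = coeff F2 m * C3 - coeff F3 m * C2"
        "coeff A2 ?s = coeff F3 m * C1 - coeff F1 m * C3"
        "coeff A3 ?s = coeff F1 m * C2 - coeff F2 m * C1" unfolding zdeg_lt_def by metis
      let ?M = "\<lambda>a. monom a (?s - m)"
      have sm: "?s - m + m = ?s" using False m by simp
      have z: "zdeg_lt (2 * n) (?M D * F)" if "deg_lt n D" "zdeg_lt (Suc n) F" for D F
        using zdeg_lt_mult[OF zdeg_lt_monom[OF that(1)] that(2)] by (simp add: mult_2)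
      have d: "degree (?M D * F) \<le> ?s" "coeff (?M D * F) ?s = D * coeff F m" if "degree F \<le> m"
        for D :: "complex poly" and F :: "complex poly poly"
        using coeff_mult_le[OF degree_monom_le[of D "?s - m"] that] sm by simp_all
      define B1 where "B1 = A1 - (?M C3 * F2 - ?M C2 * F3)"
      define B2 where "B2 = A2 - (?M C1 * F3 - ?M C3 * F1)"
      define B3 where "B3 = A3 - (?M C2 * F1 - ?M C1 * F2)"
      have C': "coeff A1 ?s = C3 * coeff F2 m - C2 * coeff F3 m"
        "coeff A2 ?s = C1 * coeff F3 m - C3 * coeff F1 m"
        "coeff A3 ?s = C2 * coeff F1 m - C1 * coeff F2 m" unfolding C by (simp_all add: mult.commute)
      have low: "degree B \<le> d" if "degree B \<le> ?s" "coeff B ?s = 0" for B :: "complex poly poly"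
        using that by (metis coeff_0_degree_minus_1 diff_Suc_1 le_SucE le_zero_eq eq_imp_le)
      have "zdeg_lt (2 * n) B1" "zdeg_lt (2 * n) B2" "zdeg_lt (2 * n) B3"
        unfolding B1_def B2_def B3_def by (intro zdeg_lt_diff Suc.prems z C dz)+
      moreover have "degree B1 \<le> d"
        by (rule low) (use Suc.prems in \<open>auto simp: B1_def d dx C' intro!: degree_diff_le\<close>)
      moreover have "degree B2 \<le> d"
        by (rule low) (use Suc.prems in \<open>auto simp: B2_def d dx C' intro!: degree_diff_le\<close>)
      moreover have "degree B3 \<le> d"
        by (rule low) (use Suc.prems in \<open>auto simp: B3_def d dx C' intro!: degree_diff_le\<close>)
      moreover have "H = B1 * F1 + B2 * F2 + B3 * F3"
        unfolding B1_def B2_def B3_def Suc.prems(7) by (simp add: algebra_simps)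
      ultimately show ?thesis by (rule Suc.IH)
    qed
  qed
  obtain A1 A2 A3 where "zdeg_lt (2 * n) A1" "zdeg_lt (2 * n) A2" "zdeg_lt (2 * n) A3"
     "H = A1 * F1 + A2 * F2 + A3 * F3"
    using everything_in_ideal[OF H(1)] unfolding in_ideal_def by blast
  then show ?thesis
    by (intro lower[of A1 A2 A3 "max (degree A1) (max (degree A2) (degree A3))"]) auto
qed

end

section \<open>Forms and block matrices\<close>

definition coeff_map :: "('a::comm_ring_1 \<Rightarrow> 'b::comm_ring_1) \<Rightarrow> 'a bipoly \<Rightarrow> 'b bipoly" where
  "coeff_map h = pm_eval (\<lambda>a. single 0 (h a)) xmonom"

lemma xmonom_add: "xmonom (s + t) = xmonom s * (xmonom t :: 'a :: comm_ring_1 bipoly)"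
  by (simp add: xmonom_def mult_single)

lemma xmonom_0: "xmonom 0 = 1"
  by (simp add: xmonom_def)

lemma const_hom:
  assumes "comm_ring_hom h"
  shows "comm_ring_hom (\<lambda>a. single (0 :: 'e :: comm_monoid_add) (h a))"
proof -
  interpret comm_ring_hom h by fact
  show ?thesis by unfold_locales (simp_all add: single_add mult_single hom_add hom_mult)
qed

lemma coeff_map_hom: "comm_ring_hom h \<Longrightarrow> comm_ring_hom (coeff_map h)"
  unfolding coeff_map_def
  by (intro pm_eval_hom const_hom) (auto simp: xmonom_0 xmonom_add)

lemma lookup_coeff_map:
  assumes "comm_ring_hom h"
  shows "lookup (coeff_map h p) t = h (lookup p t)"
proof -
  interpret comm_ring_hom h by fact
  show ?thesis
    by (simp add: coeff_map_def pm_eval_def xmonom_def mult_single lookup_sum lookup_single when_def in_keys_iff)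
qed

lemma lookup_xmonom: "lookup (xmonom a) t = (if t = a then 1 else 0)"
  by (auto simp: xmonom_def lookup_single when_def)

lemma coeff_map_xmonom: "comm_ring_hom h \<Longrightarrow> coeff_map h (xmonom a) = xmonom a"
proof (rule poly_mapping_eqI)
  fix t assume h: "comm_ring_hom h"
  then interpret comm_ring_hom h .
  show "lookup (coeff_map h (xmonom a)) t = lookup (xmonom a) t"
    by (simp add: lookup_coeff_map[OF h] lookup_xmonom)
qed

lemma lookup_form: "lookup (form m n u) t = (if t \<in> exp_box m n then u t else 0)"
  by (auto simp: form_def lookup_sum lookup_single when_def exp_box_def)

lemma coeff_map_form: "comm_ring_hom h \<Longrightarrow> coeff_map h (form m n u) = form m n (\<lambda>a. h (u a))"
proof (rule poly_mapping_eqI)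
  fix t assume h: "comm_ring_hom h"
  then interpret comm_ring_hom h .
  show "lookup (coeff_map h (form m n u)) t = lookup (form m n (\<lambda>a. h (u a))) t"
    by (simp add: lookup_coeff_map[OF h] lookup_form)
qed

text \<open>Columns of block matrices are numbered by $kM + a$ with block number $k$ and position $a < M$.\<close>

lemma sum_blocks: "(\<Sum>q<K * M. f q) = (\<Sum>k<K. \<Sum>a<M. f (k * M + a))" for f :: "nat \<Rightarrow> 'a :: comm_monoid_add"
proof (induction K)
  case (Suc K)
  have "{..<Suc K * M} = {..<K * M} \<union> {K * M..<K * M + M}" by auto
  then have "(\<Sum>q<Suc K * M. f q) = (\<Sum>q<K * M. f q) + (\<Sum>q\<in>{K*M..<K*M+M}. f q)"
    by (simp add: sum.union_disjoint disjoint_iff)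
  also have "(\<Sum>q\<in>{K*M..<K*M+M}. f q) = (\<Sum>a<M. f (K * M + a))"
    by (rule sum.reindex_bij_witness[of _ "\<lambda>a. K * M + a" "\<lambda>q. q - K * M"]) auto
  finally show ?case using Suc by simp
qed simp

lemma prod_blocks: "(\<Prod>q<K * M. w (q div M)) = (\<Prod>k<K. w k ^ M)" for w :: "nat \<Rightarrow> 'a :: comm_monoid_mult"
proof (induction K)
  case (Suc K)
  have "{..<Suc K * M} = {..<K * M} \<union> {K * M..<K * M + M}" by auto
  then have "(\<Prod>q<Suc K * M. w (q div M)) = (\<Prod>q<K * M. w (q div M)) * (\<Prod>q\<in>{K*M..<K*M+M}. w (q div M))"
    by (simp add: prod.union_disjoint disjoint_iff)
  also have "(\<Prod>q\<in>{K*M..<K*M+M}. w (q div M)) = (\<Prod>q\<in>{K*M..<K*M+M}. w K)"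
  proof (rule prod.cong)
    fix q assume "q \<in> {K*M..<K*M+M}"
    then have "q div M = K" by (metis atLeastLessThan_iff div_nat_eqI mult.commute mult_Suc_right add.commute)
    then show "w (q div M) = w K" by simp
  qed simp
  finally show ?case using Suc by simp
qed simp

lemma index_split:
  fixes k M :: nat assumes "a < M" shows "(k * M + a) div M = k" "(k * M + a) mod M = a"
  using assms by auto

lemma index_less: "k < K \<Longrightarrow> a < M \<Longrightarrow> k * M + a < K * (M :: nat)"
  by (metis add.commute add_less_cancel_left less_le_trans mult_Suc mult_le_mono1 Suc_leI nat_add_left_cancel_less)

lemma det_scale_cols:
  fixes A :: "'a :: comm_ring_1 mat"
  assumes A: "A \<in> carrier_mat N N"
  shows "det (mat N N (\<lambda>(p, q). w q * A $$ (p, q))) = (\<Prod>q<N. w q) * det A"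
proof -
  let ?B = "mat N N (\<lambda>(p, q). w q * A $$ (p, q))"
  have "det ?B = (\<Sum>p\<in>{p. p permutes {0..<N}}. signof p * (\<Prod>i=0..<N. ?B $$ (i, p i)))"
    by (simp add: det_def)
  also have "\<dots> = (\<Sum>p\<in>{p. p permutes {0..<N}}. (\<Prod>q<N. w q) * (signof p * (\<Prod>i=0..<N. A $$ (i, p i))))"
  proof (rule sum.cong)
    fix p assume p: "p \<in> {p. p permutes {0..<N}}"
    then have p': "p permutes {0..<N}" by simp
    have 1: "(\<Prod>i=0..<N. ?B $$ (i, p i)) = (\<Prod>i=0..<N. w (p i) * A $$ (i, p i))"
      by (rule prod.cong) (use permutes_in_image[OF p'] in auto)
    have 2: "(\<Prod>i=0..<N. w (p i)) = (\<Prod>i=0..<N. w i)"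
      using prod.permute[OF p', of w] by (simp add: o_def)
    show "signof p * (\<Prod>i=0..<N. ?B $$ (i, p i)) = (\<Prod>q<N. w q) * (signof p * (\<Prod>i=0..<N. A $$ (i, p i)))"
      unfolding 1 prod.distrib 2 by (simp add: mult_ac atLeast0LessThan)
  qed simp
  also have "\<dots> = (\<Prod>q<N. w q) * det A" using A by (simp add: det_def sum_distrib_left)
  finally show ?thesis .
qed

lemma det_block_diagonal:
  fixes A :: "'a :: idom mat"
  assumes A: "A \<in> carrier_mat b b"
  shows "det (mat (K * b) (K * b) (\<lambda>(s, q). if s div b = q div b then A $$ (s mod b, q mod b) else 0)) = det A ^ K"
proof (induction K)
  case 0
  then show ?case by simp
next
  case (Suc K)
  let ?D = "\<lambda>K. mat (K * b) (K * b) (\<lambda>(s, q). if s div b = q div b then A $$ (s mod b, q mod b) else 0)"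
  have low: "s div b < K" if "s < K * b" for s using that by (simp add: less_mult_imp_div_less)
  have high: "s div b = K \<and> s mod b = s - K * b" if "\<not> s < K * b" "s < b + K * b" for s
  proof -
    have "s = (K * b + (s - K * b))" "s - K * b < b" using that by auto
    then show ?thesis using index_split[of "s - K * b" b K] by metis
  qed
  have 1: "?D (Suc K) = four_block_mat (?D K) (0\<^sub>m (K * b) b) (0\<^sub>m b (K * b)) A"
  proof (rule eq_matI)
    fix i j assume "i < dim_row (four_block_mat (?D K) (0\<^sub>m (K * b) b) (0\<^sub>m b (K * b)) A)"
      "j < dim_col (four_block_mat (?D K) (0\<^sub>m (K * b) b) (0\<^sub>m b (K * b)) A)"
    then have ij: "i < b + K * b" "j < b + K * b" using A by auto
    show "?D (Suc K) $$ (i, j) = four_block_mat (?D K) (0\<^sub>m (K * b) b) (0\<^sub>m b (K * b)) A $$ (i, j)"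
      using ij low[of i] low[of j] high[of i] high[of j] A
      by (cases "i < K * b"; cases "j < K * b") (auto simp: index_mat_four_block)
  qed (use A in auto)
  have "det (?D (Suc K)) = det (?D K) * det A"
    unfolding 1 by (rule det_four_block_mat_upper_right_zero) (use A in auto)
  then show ?case unfolding Suc.IH by (simp only: power_Suc2)
qed

lemma det_integer_unit:
  fixes A B :: "int mat"
  assumes "A \<in> carrier_mat N N" "B \<in> carrier_mat N N" "A * B = 1\<^sub>m N"
  shows "det (map_mat (of_int :: int \<Rightarrow> 'a :: comm_ring_1) A) = 1 \<or> det (map_mat (of_int :: int \<Rightarrow> 'a) A) = -1"
proof -
  have "det A * det B = 1" using assms by (metis det_mult det_one)
  then have "det A = 1 \<or> det A = -1" using zmult_eq_1_iff by auto
  moreover have "comm_ring_hom (of_int :: int \<Rightarrow> 'a)" by unfold_locales auto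
  ultimately show ?thesis by (auto simp: comm_ring_hom.hom_det)
qed

lemma lookup_const_mult:
  "lookup (single 0 a * p) t = a * lookup p t"
  for a :: "'r :: comm_ring_1" and p :: "'r bipoly"
  by (simp add: map.rep_eq when_def flip: mult_map_scale_conv_mult)

section \<open>The determinantal identity\<close>

text \<open>The twelve products $F_i F_j$ with $i \in \{1,2,3\}$ and $j \in \{1,2,3,4\}$ are numbered by $4(i-1)+(j-1)$.
\<open>col_plus\<close> lists them so that the first nine are the products in the order of the columns of $Q_{m,n}$.
The last three are $F_2F_1$, $F_3F_1$, $F_3F_2$; from them the column operations subtract the equal
products $F_1F_2$, $F_1F_3$, $F_2F_3$, whose numbers are listed by \<open>col_minus\<close>.\<close>

definition col_plus :: "nat \<Rightarrow> nat" where "col_plus k = [0,5,10,1,2,3,6,7,11,4,8,9] ! k"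
definition col_minus :: "nat \<Rightarrow> nat" where "col_minus k = [1,2,6] ! (k - 9)"

definition col_op :: "nat \<Rightarrow> nat \<Rightarrow> int" where
  "col_op k l = (if k = col_plus l then 1 else 0) - (if l \<ge> 9 \<and> k = col_minus l then 1 else 0)"

definition col_op_inv :: "nat \<Rightarrow> nat \<Rightarrow> int" where
  "col_op_inv l k = (if k = col_plus l then 1 else 0) +
     (if (l, k) \<in> {(3, 4), (4, 8), (6, 9)} then 1 else 0)"

lemma col_op_inverse_list:
  "list_all (\<lambda>k. list_all (\<lambda>j. sum_list (map (\<lambda>l. col_op k l * col_op_inv l j) [0..<12]) = (if k = j then 1 else 0)) [0..<12]) [0..<12]"
  by code_simp

lemma col_op_inverse:
  assumes "k < 12" "j < 12"
  shows "(\<Sum>l<12. col_op k l * col_op_inv l j) = (if k = j then 1 else 0)"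
  using col_op_inverse_list assms by (auto simp: list_all_iff sum_list_distinct_conv_sum_set atLeast0LessThan)

lemma col_plus_lt: "k < 12 \<Longrightarrow> col_plus k < 12"
proof -
  assume "k < 12"
  then have "col_plus k \<in> set [0,5,10,1,2,3,6,7,11,4,8,9]"
    unfolding col_plus_def by (intro nth_mem) simp
  then show ?thesis by auto
qed

lemma col_minus_lt: "9 \<le> k \<Longrightarrow> k < 12 \<Longrightarrow> col_minus k < 12"
proof -
  assume "9 \<le> k" "k < 12"
  then have "col_minus k \<in> set [1,2,6]"
    unfolding col_minus_def by (intro nth_mem) simp
  then show ?thesis by auto
qed

lemma sum_col_op:
  fixes f :: "nat \<Rightarrow> 'a :: comm_ring_1"
  assumes "l < 12"
  shows "(\<Sum>k<12. f k * of_int (col_op k l)) = f (col_plus l) - (if l \<ge> 9 then f (col_minus l) else 0)"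
proof -
  have "(\<Sum>k<12. f k * of_int (col_op k l)) = (\<Sum>k<12. (if k = col_plus l then f k else 0) -
      (if k = col_minus l then (if l \<ge> 9 then f k else 0) else 0))"
    by (rule sum.cong) (auto simp: col_op_def)
  then show ?thesis using col_plus_lt[OF assms] col_minus_lt[of l] assms
    by (simp add: sum_subtractf)
qed

lemma mat_mult_entry:
  assumes "A \<in> carrier_mat a b" "B \<in> carrier_mat b c" "i < a" "j < c"
  shows "(A * B) $$ (i, j) = (\<Sum>s<b. A $$ (i, s) * B $$ (s, j))"
  using assms by (simp add: scalar_prod_def atLeast0LessThan)

text \<open>All constructions are made over an arbitrary commutative ring and for an arbitrary assignment \<open>u\<close> of
values to the variables, so that specializations and substitutions can be followed by naturality.
The variables with index 5 supply a fifth form $F_5$, those with index at least 6 the entries of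
auxiliary rows.\<close>

locale bideg =
  fixes m n :: nat
  assumes m: "m > 0" and n: "n > 0"
begin

abbreviation "M \<equiv> m * n"

definition E :: "nat \<Rightarrow> expo list" where
  "E k = List.product [0..<k * m] [0..<k * n]"

text \<open>The exponents of the monomial basis of $S_{km-1,kn-1}$, listed by \<open>E k\<close>.\<close>

definition box :: "nat \<Rightarrow> expo set" where
  "box k = {0..<k * m} \<times> {0..<k * n}"

lemma M: "M > 0" using m n by simp

lemma length_E: "length (E k) = k * k * M"
  by (simp add: E_def)

lemma distinct_E: "distinct (E k)"
  by (simp add: E_def distinct_product)

lemma set_E: "set (E k) = box k"
  by (simp add: E_def box_def)

lemma E_box: "w < k * k * M \<Longrightarrow> E k ! w \<in> box k"
  by (metis length_E nth_mem set_E)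

lemma sum_E: "(\<Sum>w<k * k * M. f (E k ! w)) = (\<Sum>t\<in>box k. f t)" for f :: "_ \<Rightarrow> 'a :: comm_monoid_add"
proof -
  have "inj_on ((!) (E k)) {..<k * k * M}"
    using distinct_E length_E by (metis inj_on_nth lessThan_iff)
  moreover have "(!) (E k) ` {..<k * k * M} = box k"
    using nth_image[of "k * k * M" "E k"] length_E set_E by (simp add: atLeast0LessThan)
  ultimately show ?thesis by (metis (no_types, lifting) sum.reindex_cong)
qed

lemma lookup_mult_expand:
  fixes g h :: "'r :: comm_ring_1 bipoly"
  assumes "keys g \<subseteq> box k"
  shows "lookup (g * h) p =
    (\<Sum>w<k * k * M. lookup g (E k ! w) * lookup (xmonom (E k ! w) * h) p)"
proof -
  have "g = (\<Sum>t\<in>box k. single 0 (lookup g t) * xmonom t)"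
  proof (rule poly_mapping_eqI)
    fix t
    have "finite (box k)" by (simp add: box_def)
    moreover have "t \<notin> box k \<Longrightarrow> lookup g t = 0" using assms by (auto simp: in_keys_iff)
    ultimately show "lookup g t =
        lookup (\<Sum>s\<in>box k. single 0 (lookup g s) * xmonom s) t"
      by (simp add: lookup_sum lookup_const_mult lookup_xmonom if_distrib[of "\<lambda>x. _ * x"] cong: if_cong)
  qed
  then have "g * h = (\<Sum>t\<in>box k. single 0 (lookup g t) * (xmonom t * h))"
    by (metis (no_types, lifting) mult.assoc sum.cong sum_distrib_right)
  then have "lookup (g * h) p =
      (\<Sum>t\<in>box k. lookup g t * lookup (xmonom t * h) p)"
    by (simp add: lookup_sum lookup_const_mult)
  then show ?thesis
    using sum_E[of "\<lambda>t. lookup g t * lookup (xmonom t * h) p" k] by simp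
qed

text \<open>The matrix of $(A_j) \mapsto \sum_j A_j G_j$ from copies of $S_{m-1,n-1}$ to $S_{km-1,kn-1}$.\<close>

definition mult_matrix :: "nat \<Rightarrow> 'r::comm_ring_1 bipoly list \<Rightarrow> 'r mat" where
  "mult_matrix k Gs = mat (k * k * M) (length Gs * M)
     (\<lambda>(p, q). lookup (xmonom (E 1 ! (q mod M)) * Gs ! (q div M)) (E k ! p))"

definition frm :: "(cvar \<Rightarrow> 'r::comm_ring_1) \<Rightarrow> nat \<Rightarrow> 'r bipoly" where
  "frm u i = form m n (\<lambda>a. u (i, a))"

definition linear_forms :: "(cvar \<Rightarrow> 'r::comm_ring_1) \<Rightarrow> 'r bipoly list" where
  "linear_forms u = [frm u 1, frm u 2, frm u 3, frm u 4]"

definition quadric_forms :: "(cvar \<Rightarrow> 'r::comm_ring_1) \<Rightarrow> 'r bipoly list" where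
  "quadric_forms u =
    [frm u 1 ^ 2, frm u 2 ^ 2, frm u 3 ^ 2, frm u 1 * frm u 2, frm u 1 * frm u 3, frm u 1 * frm u 4,
     frm u 2 * frm u 3, frm u 2 * frm u 4, frm u 3 * frm u 4]"

definition F_det :: "(cvar \<Rightarrow> 'r::comm_ring_1) \<Rightarrow> 'r" where
  "F_det u = det (mult_matrix 2 (linear_forms u))"

definition Q_det :: "(cvar \<Rightarrow> 'r::comm_ring_1) \<Rightarrow> 'r" where
  "Q_det u = det (mult_matrix 3 (quadric_forms u))"

text \<open>The upper $9M$ rows are the map $S_{2m-1,2n-1}^3 \to S_{3m-1,3n-1}$ given by $F_1,F_2,F_3$; the lower $3M$
rows are filled with variables of index at least 6, which makes the matrix square.\<close>

definition stacked :: "(cvar \<Rightarrow> 'r::comm_ring_1) \<Rightarrow> 'r mat" where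
  "stacked u = mat (12 * M) (12 * M) (\<lambda>(r, s).
     if r < 9 * M then lookup (xmonom (E 2 ! (s mod (4 * M))) * frm u (s div (4 * M) + 1)) (E 3 ! r)
     else u (6 + (r - 9 * M), (s, 0)))"

text \<open>The product of the \<open>r\<close>-th auxiliary row with the vector $x^a F_j$ placed in the $i$-th copy of
$S_{2m-1,2n-1}$, where $k = 4(i-1) + (j-1)$ and $x^a$ is given by its number.\<close>

definition fresh_entry :: "(cvar \<Rightarrow> 'r::comm_ring_1) \<Rightarrow> nat \<Rightarrow> nat \<Rightarrow> nat \<Rightarrow> 'r" where
  "fresh_entry u r k a = (\<Sum>w<4 * M. u (6 + r, (k div 4 * (4 * M) + w, 0)) *
     lookup (xmonom (E 1 ! a) * frm u (k mod 4 + 1)) (E 2 ! w))"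

definition stacked_det :: "(cvar \<Rightarrow> 'r::comm_ring_1) \<Rightarrow> 'r" where
  "stacked_det u = det (stacked u)"

text \<open>The auxiliary rows applied to the Koszul syzygies; the block numbers are those of the last three column
operations.\<close>

definition koszul_det :: "(cvar \<Rightarrow> 'r::comm_ring_1) \<Rightarrow> 'r" where
  "koszul_det u = det (mat (3 * M) (3 * M) (\<lambda>(r, q).
     fresh_entry u r ([4, 8, 9] ! (q div M)) (q mod M) - fresh_entry u r ([1, 2, 6] ! (q div M)) (q mod M)))"

lemma mult_matrix_carrier: "mult_matrix k Gs \<in> carrier_mat (k * k * M) (length Gs * M)"
  by (simp add: mult_matrix_def)

lemma length_linear_forms: "length (linear_forms u) = 4"
  by (simp add: linear_forms_def)

lemma length_quadric_forms: "length (quadric_forms u) = 9"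
  by (simp add: quadric_forms_def)

lemma mult_matrix_carrier_F: "mult_matrix 2 (linear_forms u) \<in> carrier_mat (4 * M) (4 * M)"
  using mult_matrix_carrier[of 2 "linear_forms u"] by (simp add: length_linear_forms)

lemma mult_matrix_carrier_Q: "mult_matrix 3 (quadric_forms u) \<in> carrier_mat (9 * M) (9 * M)"
  using mult_matrix_carrier[of 3 "quadric_forms u"] by (simp add: length_quadric_forms)

lemma keys_xmonom_frm:
  assumes "a \<in> box 1"
  shows "keys (xmonom a * frm u i) \<subseteq> box 2"
proof
  fix t assume "t \<in> keys (xmonom a * frm u i)"
  with keys_mult obtain x y where xy: "t = x + y" "x \<in> keys (xmonom a :: 'a bipoly)" "y \<in> keys (frm u i)"
    by blast
  then have "x = a" "y \<in> exp_box m n"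
    by (auto simp: xmonom_def frm_def in_keys_iff lookup_form split: if_splits)
  with assms xy(1) show "t \<in> box 2" by (auto simp: box_def exp_box_def plus_prod_def)
qed

lemma div_4M: "a < M \<Longrightarrow> (k * M + a) div (4 * M) = k div 4" "a < M \<Longrightarrow> (k * M + a) mod (4 * M) = (k mod 4) * M + a"
proof -
  assume a: "a < M"
  have e: "k * M + a = k div 4 * (4 * M) + ((k mod 4) * M + a)"
  proof -
    have "k * M = (k div 4 * 4 + k mod 4) * M" by simp
    also have "\<dots> = k div 4 * (4 * M) + (k mod 4) * M" by (simp only: distrib_right mult.assoc)
    finally show ?thesis by simp
  qed
  have l: "(k mod 4) * M + a < 4 * M" by (rule index_less) (use a in auto)
  show "(k * M + a) div (4 * M) = k div 4" "(k * M + a) mod (4 * M) = (k mod 4) * M + a"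
    by (subst e, rule index_split[OF l])+
qed

definition F_thrice :: "(cvar \<Rightarrow> 'r::comm_ring_1) \<Rightarrow> 'r mat" where
  "F_thrice u = mat (3 * (4 * M)) (3 * (4 * M)) (\<lambda>(s, q).
     if s div (4 * M) = q div (4 * M) then mult_matrix 2 (linear_forms u) $$ (s mod (4 * M), q mod (4 * M)) else 0)"

definition col_op_matrix :: "int mat" where
  "col_op_matrix = mat (12 * M) (12 * M) (\<lambda>(q, p). if q mod M = p mod M then col_op (q div M) (p div M) else 0)"

definition col_op_matrix_inv :: "int mat" where
  "col_op_matrix_inv = mat (12 * M) (12 * M) (\<lambda>(q, p). if q mod M = p mod M then col_op_inv (q div M) (p div M) else 0)"

lemma col_op_matrix_inv_right: "col_op_matrix * col_op_matrix_inv = 1\<^sub>m (12 * M)"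
proof (rule eq_matI)
  fix i j assume "i < dim_row (1\<^sub>m (12 * M))" "j < dim_col (1\<^sub>m (12 * M))"
  then have ij: "i < 12 * M" "j < 12 * M" by auto
  then have d: "i div M < 12" "j div M < 12" "i mod M < M" "j mod M < M"
    using M by (auto simp: less_mult_imp_div_less)
  have "(col_op_matrix * col_op_matrix_inv) $$ (i, j) = (\<Sum>q<12 * M. col_op_matrix $$ (i, q) * col_op_matrix_inv $$ (q, j))"
    using ij by (simp add: col_op_matrix_def col_op_matrix_inv_def scalar_prod_def atLeast0LessThan)
  also have "\<dots> = (\<Sum>k<12. \<Sum>a<M. col_op_matrix $$ (i, k * M + a) * col_op_matrix_inv $$ (k * M + a, j))"
    by (rule sum_blocks)
  also have "\<dots> = (\<Sum>k<12. \<Sum>a<M. if a = i mod M then (if i mod M = j mod M then col_op (i div M) k * col_op_inv k (j div M) else 0) else 0)"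
  proof (intro sum.cong refl)
    fix k a :: nat assume "k \<in> {..<12}" "a \<in> {..<M}"
    then have k: "k < 12" and a: "a < M" by auto
    note l = index_less[OF k a]
    show "col_op_matrix $$ (i, k * M + a) * col_op_matrix_inv $$ (k * M + a, j) = (if a = i mod M then (if i mod M = j mod M then col_op (i div M) k * col_op_inv k (j div M) else 0) else 0)"
      unfolding col_op_matrix_def col_op_matrix_inv_def using ij l index_split[OF a, of k] by auto
  qed
  also have "\<dots> = (if i mod M = j mod M then (\<Sum>k<12. col_op (i div M) k * col_op_inv k (j div M)) else 0)"
    using d by simp
  also have "\<dots> = (if i mod M = j mod M \<and> i div M = j div M then 1 else 0)"
    unfolding col_op_inverse[OF d(1,2)] by simp
  also have "i mod M = j mod M \<and> i div M = j div M \<longleftrightarrow> i = j" by (metis div_mult_mod_eq)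
  also have "(if i = j then 1 else 0) = 1\<^sub>m (12 * M) $$ (i, j)" using ij by simp
  finally show "(col_op_matrix * col_op_matrix_inv) $$ (i, j) = 1\<^sub>m (12 * M) $$ (i, j)" .
qed (auto simp: col_op_matrix_def col_op_matrix_inv_def)

lemma stacked_F_thrice:
  assumes r: "r < 12 * M" and k: "k < 12" and a: "a < M"
  shows "(stacked u * F_thrice u) $$ (r, k * M + a) =
    (if r < 9 * M then lookup (xmonom (E 1 ! a) * (frm u (k mod 4 + 1) * frm u (k div 4 + 1))) (E 3 ! r)
     else fresh_entry u (r - 9 * M) k a)"
proof -
  have q: "k * M + a < 12 * M" by (rule index_less[OF k a])
  have k4: "k div 4 < 3" "k mod 4 < 4" using k by auto
  have tF: "F_thrice u $$ (i * (4 * M) + w, k * M + a) =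
      (if i = k div 4 then lookup (xmonom (E 1 ! a) * frm u (k mod 4 + 1)) (E 2 ! w) else 0)"
    if i: "i < 3" and w: "w < 4 * M" for i w
  proof -
    have l: "i * (4 * M) + w < 3 * (4 * M)" by (rule index_less[OF i w])
    have j: "(k mod 4) * M + a < 4 * M" by (rule index_less[OF k4(2) a])
    have "mult_matrix 2 (linear_forms u) $$ (w, (k mod 4) * M + a) =
        lookup (xmonom (E 1 ! a) * linear_forms u ! (k mod 4)) (E 2 ! w)"
      using w j index_split[OF a, of "k mod 4"] by (simp add: mult_matrix_def linear_forms_def)
    moreover have "linear_forms u ! (k mod 4) = frm u (k mod 4 + 1)"
    proof -
      consider "k mod 4 = 0" | "k mod 4 = 1" | "k mod 4 = 2" | "k mod 4 = 3" using k4(2) by linarith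
      then show ?thesis by cases (simp_all add: linear_forms_def flip: numeral_2_eq_2)
    qed
    ultimately show ?thesis unfolding F_thrice_def
      using l q index_split[OF w, of i] div_4M[OF a, of k] by simp
  qed
  have "(stacked u * F_thrice u) $$ (r, k * M + a) = (\<Sum>s<3 * (4 * M). stacked u $$ (r, s) * F_thrice u $$ (s, k * M + a))"
    using r q by (simp add: stacked_def F_thrice_def scalar_prod_def atLeast0LessThan)
  also have "\<dots> = (\<Sum>i<3. \<Sum>w<4 * M. stacked u $$ (r, i * (4 * M) + w) * F_thrice u $$ (i * (4 * M) + w, k * M + a))"
    by (rule sum_blocks)
  also have "\<dots> = (\<Sum>i<3. if i = k div 4 then (\<Sum>w<4 * M. stacked u $$ (r, i * (4 * M) + w) *
      lookup (xmonom (E 1 ! a) * frm u (k mod 4 + 1)) (E 2 ! w)) else 0)"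
    by (intro sum.cong refl) (simp add: tF)
  also have "\<dots> = (\<Sum>w<4 * M. stacked u $$ (r, k div 4 * (4 * M) + w) *
      lookup (xmonom (E 1 ! a) * frm u (k mod 4 + 1)) (E 2 ! w))"
    using k4 by simp
  also have "\<dots> = (if r < 9 * M then lookup (xmonom (E 1 ! a) * (frm u (k mod 4 + 1) * frm u (k div 4 + 1))) (E 3 ! r)
     else fresh_entry u (r - 9 * M) k a)"
  proof (cases "r < 9 * M")
    case True
    have "stacked u $$ (r, k div 4 * (4 * M) + w) = lookup (xmonom (E 2 ! w) * frm u (k div 4 + 1)) (E 3 ! r)"
      if w: "w < 4 * M" for w
      using index_less[OF k4(1) w] index_split[OF w, of "k div 4"] r True by (simp add: stacked_def)
    then have "(\<Sum>w<4 * M. stacked u $$ (r, k div 4 * (4 * M) + w) *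
        lookup (xmonom (E 1 ! a) * frm u (k mod 4 + 1)) (E 2 ! w))
      = (\<Sum>w<2 * 2 * M. lookup (xmonom (E 1 ! a) * frm u (k mod 4 + 1)) (E 2 ! w) *
          lookup (xmonom (E 2 ! w) * frm u (k div 4 + 1)) (E 3 ! r))"
      by (intro sum.cong) (auto simp: mult.commute)
    also have "\<dots> = lookup ((xmonom (E 1 ! a) * frm u (k mod 4 + 1)) * frm u (k div 4 + 1)) (E 3 ! r)"
      by (rule lookup_mult_expand[symmetric]) (rule keys_xmonom_frm, rule E_box, simp add: a)
    finally show ?thesis using True by (simp add: mult.assoc)
  next
    case False
    have "stacked u $$ (r, k div 4 * (4 * M) + w) = u (6 + (r - 9 * M), (k div 4 * (4 * M) + w, 0))"
      if w: "w < 4 * M" for w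
      using index_less[OF k4(1) w] r False by (simp add: stacked_def)
    then show ?thesis using False by (simp add: fresh_entry_def)
  qed
  finally show ?thesis .
qed

lemma quadric_from_blocks:
  assumes "l < 9"
  shows "frm u (col_plus l mod 4 + 1) * frm u (col_plus l div 4 + 1) = quadric_forms u ! l"
proof -
  consider "l = 0" | "l = 1" | "l = 2" | "l = 3" | "l = 4" | "l = 5" | "l = 6" | "l = 7" | "l = 8"
    using assms by linarith
  then show ?thesis
    by cases (simp_all add: col_plus_def quadric_forms_def power2_eq_square mult.commute flip: numeral_2_eq_2)
qed

lemma col_pair:
  assumes "9 \<le> l" "l < 12"
  shows "col_plus l mod 4 = col_minus l div 4" "col_plus l div 4 = col_minus l mod 4"
    "col_plus l = [4, 8, 9] ! (l - 9)" "col_minus l = [1, 2, 6] ! (l - 9)"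
proof -
  consider "l = 9" | "l = 10" | "l = 11" using assms by linarith
  then show "col_plus l mod 4 = col_minus l div 4" "col_plus l div 4 = col_minus l mod 4"
    "col_plus l = [4, 8, 9] ! (l - 9)" "col_minus l = [1, 2, 6] ! (l - 9)"
    by (cases; simp add: col_plus_def col_minus_def)+
qed

text \<open>The matrix $F_{m,n}$ expresses each of the three copies of $S_{2m-1,2n-1}$ by $S_{m-1,n-1}^4$, and in these
coordinates the upper part of \<open>stacked\<close> has the twelve column blocks $F_iF_j$.  Nine of them form $Q_{m,n}$.
The other three repeat earlier ones, so integral unimodular column operations replace them by zero.  The
result is block triangular with diagonal blocks $Q_{m,n}$ and \<open>koszul_det\<close>.  The first
factor on the left and the last one on the right do not involve $F_4$.\<close>

theorem stacked_identity:
  fixes u :: "cvar \<Rightarrow> 'r :: idom"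
  shows "stacked_det u * F_det u ^ 3 = Q_det u * koszul_det u \<or> stacked_det u * F_det u ^ 3 = - (Q_det u * koszul_det u)"
proof -
  let ?T = "map_mat (of_int :: int \<Rightarrow> 'r) col_op_matrix"
  let ?BD = "stacked u * F_thrice u"
  let ?Z = "?BD * ?T"
  let ?Q = "mult_matrix 3 (quadric_forms u)"
  let ?B = "mat (3 * M) (3 * M) (\<lambda>(r, q).
     fresh_entry u r ([4, 8, 9] ! (q div M)) (q mod M) - fresh_entry u r ([1, 2, 6] ! (q div M)) (q mod M))"
  let ?C = "mat (3 * M) (9 * M) (\<lambda>(r, q). ?Z $$ (9 * M + r, q))"
  have car: "stacked u \<in> carrier_mat (12 * M) (12 * M)" "F_thrice u \<in> carrier_mat (12 * M) (12 * M)"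
    "?T \<in> carrier_mat (12 * M) (12 * M)" "col_op_matrix \<in> carrier_mat (12 * M) (12 * M)" "col_op_matrix_inv \<in> carrier_mat (12 * M) (12 * M)"
    by (auto simp: stacked_def F_thrice_def col_op_matrix_def col_op_matrix_inv_def)
  note dimQ = carrier_matD[OF mult_matrix_carrier_Q[of u]]
  have Z: "?Z $$ (r, l * M + a) = ?BD $$ (r, col_plus l * M + a) -
      (if l \<ge> 9 then ?BD $$ (r, col_minus l * M + a) else 0)"
    if r: "r < 12 * M" and l: "l < 12" and a: "a < M" for r l a
  proof -
    note q = index_less[OF l a]
    have "?Z $$ (r, l * M + a) = (\<Sum>s<12 * M. ?BD $$ (r, s) * ?T $$ (s, l * M + a))"
      by (rule mat_mult_entry[OF mult_carrier_mat[OF car(1,2)] car(3) r q])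
    also have "\<dots> = (\<Sum>k<12. \<Sum>b<M. ?BD $$ (r, k * M + b) * ?T $$ (k * M + b, l * M + a))"
      by (rule sum_blocks)
    also have "\<dots> = (\<Sum>k<12. \<Sum>b<M. if b = a then ?BD $$ (r, k * M + a) * of_int (col_op k l) else 0)"
    proof (intro sum.cong refl)
      fix k b assume "k \<in> {..<12::nat}" "b \<in> {..<M}"
      then have k: "k < 12" and b: "b < M" by auto
      show "?BD $$ (r, k * M + b) * ?T $$ (k * M + b, l * M + a) =
         (if b = a then ?BD $$ (r, k * M + a) * of_int (col_op k l) else 0)"
        using index_less[OF k b] q index_split[OF b, of k] index_split[OF a, of l]
          index_split[OF a, of k] by (auto simp: col_op_matrix_def)
    qed
    also have "\<dots> = (\<Sum>k<12. ?BD $$ (r, k * M + a) * of_int (col_op k l))" using a by simp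
    finally show ?thesis unfolding sum_col_op[OF l] .
  qed
  have blocks: "?Z = four_block_mat ?Q (0\<^sub>m (9 * M) (3 * M)) ?C ?B"
  proof (rule eq_matI)
    fix r q assume "r < dim_row (four_block_mat ?Q (0\<^sub>m (9 * M) (3 * M)) ?C ?B)"
      "q < dim_col (four_block_mat ?Q (0\<^sub>m (9 * M) (3 * M)) ?C ?B)"
    then have r: "r < 12 * M" and q: "q < 12 * M" by (auto simp: mult_matrix_def quadric_forms_def)
    define l a where "l = q div M" and "a = q mod M"
    have q': "q = l * M + a" and l: "l < 12" and a: "a < M"
      using q M unfolding l_def a_def by (simp_all only: div_mult_mod_eq less_mult_imp_div_less mod_less_divisor)
    have l9: "l < 9 \<longleftrightarrow> q < 9 * M" unfolding l_def using M by (simp add: div_less_iff_less_mult)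
    note BD = stacked_F_thrice[OF r col_plus_lt[OF l] a, of u]
    note Zr = Z[OF r l a]
    show "?Z $$ (r, q) = four_block_mat ?Q (0\<^sub>m (9 * M) (3 * M)) ?C ?B $$ (r, q)"
    proof (cases "r < 9 * M")
      case True
      note BD' = stacked_F_thrice[OF r col_minus_lt[OF _ l] a, of u]
      show ?thesis
      proof (cases "l < 9")
        case l: True
        have "?Z $$ (r, q) = lookup (xmonom (E 1 ! a) * quadric_forms u ! l) (E 3 ! r)"
          unfolding q' Zr BD quadric_from_blocks[OF l] using True l by simp
        moreover have "?Q $$ (r, q) = lookup (xmonom (E 1 ! a) * quadric_forms u ! l) (E 3 ! r)"
          using True l l9 unfolding l_def a_def by (simp add: mult_matrix_def quadric_forms_def)
        ultimately show ?thesis using True l l9 by (simp add: dimQ index_mat_four_block)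
      next
        case False
        then have "?Z $$ (r, q) = 0"
          unfolding q' Zr BD using BD' col_pair[of l] l True by (simp add: mult.commute)
        then show ?thesis using True False l9 q by (simp add: dimQ index_mat_four_block)
      qed
    next
      case False
      show ?thesis
      proof (cases "l < 9")
        case True
        then show ?thesis using False l9 q r by (simp add: dimQ index_mat_four_block)
      next
        case l': False
        then have l9': "9 \<le> l" by simp
        note BD' = stacked_F_thrice[OF r col_minus_lt[OF l9' l] a, of u]
        have "?Z $$ (r, q) = fresh_entry u (r - 9 * M) ([4, 8, 9] ! (l - 9)) a - fresh_entry u (r - 9 * M) ([1, 2, 6] ! (l - 9)) a"
          unfolding q' Zr BD BD' using False l9' col_pair(3,4)[OF l9' l] by simp
        moreover have "(q - 9 * M) div M = l - 9" "(q - 9 * M) mod M = a"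
        proof -
          have "q - 9 * M = (l - 9) * M + a" using l9' by (simp add: q' diff_mult_distrib)
          then show "(q - 9 * M) div M = l - 9" "(q - 9 * M) mod M = a"
            using index_split[OF a, of "l - 9"] by simp_all
        qed
        ultimately show ?thesis using False l' l9 q r
          by (simp add: dimQ index_mat_four_block)
      qed
    qed
  qed (use car in \<open>auto simp: mult_matrix_def quadric_forms_def\<close>)
  have "det (four_block_mat ?Q (0\<^sub>m (9 * M) (3 * M)) ?C ?B) = det ?Q * det ?B"
    by (rule det_four_block_mat_upper_right_zero; auto simp: mult_matrix_def quadric_forms_def)
  then have "det ?Z = det ?Q * det ?B" by (rule trans[OF arg_cong[OF blocks, of det]])
  then have qb: "Q_det u * koszul_det u = det ?Z" by (simp only: Q_det_def koszul_det_def)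
  have zt: "det ?Z = stacked_det u * F_det u ^ 3 * det ?T"
  proof -
    have "det (F_thrice u) = F_det u ^ 3"
      unfolding F_thrice_def F_det_def by (rule det_block_diagonal) (rule mult_matrix_carrier_F)
    then show ?thesis using car by (simp add: det_mult[of _ "12 * M"] stacked_det_def)
  qed
  have "det ?T = 1 \<or> det ?T = -1"
    by (rule det_integer_unit[OF car(4,5) col_op_matrix_inv_right])
  then show ?thesis unfolding qb zt by (elim disjE) simp_all
qed

section \<open>Naturality and homogeneity of the determinants\<close>

lemma coeff_map_frm: "comm_ring_hom h \<Longrightarrow> coeff_map h (frm u i) = frm (\<lambda>v. h (u v)) i"
  by (simp add: frm_def coeff_map_form)

lemma entry_hom:
  assumes "comm_ring_hom h"
  shows "h (lookup (xmonom a * G) t) = lookup (xmonom a * coeff_map h G) t"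
proof -
  interpret c: comm_ring_hom "coeff_map h" by (rule coeff_map_hom[OF assms])
  show ?thesis
    by (simp add: c.hom_mult coeff_map_xmonom[OF assms] flip: lookup_coeff_map[OF assms])
qed

lemma mult_matrix_hom:
  assumes "comm_ring_hom h"
  shows "map_mat h (mult_matrix k Gs) = mult_matrix k (map (coeff_map h) Gs)"
proof (rule eq_matI)
  fix i j assume "i < dim_row (mult_matrix k (map (coeff_map h) Gs))" "j < dim_col (mult_matrix k (map (coeff_map h) Gs))"
  then have ij: "i < k * k * M" "j < length Gs * M" by (auto simp: mult_matrix_def)
  then have "j div M < length Gs" by (simp add: less_mult_imp_div_less)
  then show "map_mat h (mult_matrix k Gs) $$ (i, j) = mult_matrix k (map (coeff_map h) Gs) $$ (i, j)"
    using ij by (simp add: mult_matrix_def entry_hom[OF assms])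
qed (auto simp: mult_matrix_def)

lemma F_det_hom:
  assumes h: "comm_ring_hom h"
  shows "h (F_det u) = F_det (\<lambda>v. h (u v))"
proof -
  have "h (F_det u) = det (map_mat h (mult_matrix 2 (linear_forms u)))"
    by (simp add: F_det_def comm_ring_hom.hom_det[OF h])
  also have "\<dots> = F_det (\<lambda>v. h (u v))"
    by (simp add: mult_matrix_hom[OF h] F_det_def linear_forms_def coeff_map_frm[OF h])
  finally show ?thesis .
qed

lemma Q_det_hom:
  assumes h: "comm_ring_hom h"
  shows "h (Q_det u) = Q_det (\<lambda>v. h (u v))"
proof -
  interpret c: comm_ring_hom "coeff_map h" by (rule coeff_map_hom[OF h])
  have "h (Q_det u) = det (map_mat h (mult_matrix 3 (quadric_forms u)))"
    by (simp add: Q_det_def comm_ring_hom.hom_det[OF h])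
  also have "\<dots> = Q_det (\<lambda>v. h (u v))"
    by (simp add: mult_matrix_hom[OF h] Q_det_def quadric_forms_def coeff_map_frm[OF h] c.hom_mult c.hom_power)
  finally show ?thesis .
qed

lemma stacked_det_hom:
  assumes h: "comm_ring_hom h"
  shows "h (stacked_det u) = stacked_det (\<lambda>v. h (u v))"
proof -
  have "map_mat h (stacked u) = stacked (\<lambda>v. h (u v))"
    by (rule eq_matI) (auto simp: stacked_def entry_hom[OF h] coeff_map_frm[OF h])
  then show ?thesis by (simp add: stacked_det_def flip: comm_ring_hom.hom_det[OF h])
qed

lemma koszul_det_hom:
  assumes h: "comm_ring_hom h"
  shows "h (koszul_det u) = koszul_det (\<lambda>v. h (u v))"
proof -
  interpret h: comm_ring_hom h by fact
  have "h (fresh_entry u r k a) = fresh_entry (\<lambda>v. h (u v)) r k a" for r k a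
    by (simp add: fresh_entry_def h.hom_sum h.hom_mult entry_hom[OF h] coeff_map_frm[OF h])
  then show ?thesis unfolding koszul_det_def comm_ring_hom.hom_det[OF h, symmetric]
    by (intro arg_cong[of _ _ det] eq_matI) (auto simp: h.hom_minus)
qed

lemma F_det_cong:
  assumes "\<And>i a. i \<in> {1, 2, 3, 4} \<Longrightarrow> u (i, a) = v (i, a)"
  shows "F_det u = F_det v"
  using assms by (simp add: F_det_def linear_forms_def frm_def)

lemma Q_det_cong:
  assumes "\<And>i a. i \<in> {1, 2, 3, 4} \<Longrightarrow> u (i, a) = v (i, a)"
  shows "Q_det u = Q_det v"
  using assms by (simp add: Q_det_def quadric_forms_def frm_def)

lemma stacked_det_cong:
  assumes "\<And>i a. i \<in> {1, 2, 3} \<or> 6 \<le> i \<Longrightarrow> u (i, a) = v (i, a)"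
  shows "stacked_det u = stacked_det v"
proof -
  have "frm u (s div (4 * M) + 1) = frm v (s div (4 * M) + 1)" if "s < 12 * M" for s
  proof -
    have "s div (4 * M) < 3" using that by (simp add: less_mult_imp_div_less)
    then have "u (s div (4 * M) + 1, a) = v (s div (4 * M) + 1, a)" for a by (intro assms) auto
    then show ?thesis by (simp only: frm_def)
  qed
  moreover have "u (6 + (r - 9 * M), (s, 0)) = v (6 + (r - 9 * M), (s, 0))" for r s
    by (intro assms) simp
  ultimately have "stacked u = stacked v" unfolding stacked_def
    by (intro cong_mat refl) (simp only: split)
  then show ?thesis by (simp add: stacked_det_def)
qed

lemma koszul_det_cong:
  assumes "\<And>i a. i \<in> {1, 2, 3} \<or> 6 \<le> i \<Longrightarrow> u (i, a) = v (i, a)"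
  shows "koszul_det u = koszul_det v"
proof -
  have e: "fresh_entry u r k a = fresh_entry v r k a" if "k mod 4 < 3" for r k a
  proof -
    have "u (k mod 4 + 1, a) = v (k mod 4 + 1, a)" for a using that by (intro assms) auto
    then have "frm u (k mod 4 + 1) = frm v (k mod 4 + 1)" by (simp only: frm_def)
    then show ?thesis by (simp add: fresh_entry_def assms)
  qed
  have "[4, 8, 9] ! k mod 4 < (3 :: nat) \<and> [1, 2, 6] ! k mod 4 < (3 :: nat)" if k: "k < 3" for k
  proof -
    consider "k = 0" | "k = 1" | "k = 2" using k by linarith
    then show ?thesis by cases auto
  qed
  then show ?thesis unfolding koszul_det_def
    by (intro arg_cong[of _ _ det] eq_matI) (auto simp: e less_mult_imp_div_less)
qed

lemma det_mult_matrix_scale: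
  fixes Gs :: "'r :: comm_ring_1 bipoly list"
  assumes len: "length ws = length Gs" "length Gs = k * k"
  shows "det (mult_matrix k (map2 (\<lambda>s G. single 0 s * G) ws Gs)) = prod_list ws ^ M * det (mult_matrix k Gs)"
proof -
  let ?N = "k * k * M"
  have car: "mult_matrix k Gs \<in> carrier_mat ?N ?N" using mult_matrix_carrier[of k Gs] len by simp
  have "mult_matrix k (map2 (\<lambda>s G. single 0 s * G) ws Gs) = mat ?N ?N (\<lambda>(p, q). ws ! (q div M) * mult_matrix k Gs $$ (p, q))"
  proof (rule eq_matI)
    fix i j assume "i < dim_row (mat ?N ?N (\<lambda>(p, q). ws ! (q div M) * mult_matrix k Gs $$ (p, q)))"
      "j < dim_col (mat ?N ?N (\<lambda>(p, q). ws ! (q div M) * mult_matrix k Gs $$ (p, q)))"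
    then have ij: "i < ?N" "j < ?N" by auto
    then have "j div M < k * k" by (simp add: less_mult_imp_div_less)
    moreover have "lookup (xmonom a * (single 0 s * G)) t = s * lookup (xmonom a * G) t"
      for a s t and G :: "'r bipoly"
      by (subst mult.left_commute) (rule lookup_const_mult)
    ultimately show "mult_matrix k (map2 (\<lambda>s G. single 0 s * G) ws Gs) $$ (i, j) =
        mat ?N ?N (\<lambda>(p, q). ws ! (q div M) * mult_matrix k Gs $$ (p, q)) $$ (i, j)"
      using ij len by (simp add: mult_matrix_def)
  qed (use len in \<open>auto simp: mult_matrix_def\<close>)
  then have "det (mult_matrix k (map2 (\<lambda>s G. single 0 s * G) ws Gs)) = (\<Prod>q<k * k * M. ws ! (q div M)) * det (mult_matrix k Gs)"
    by (simp only: det_scale_cols[OF car])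
  also have "(\<Prod>q<k * k * M. ws ! (q div M)) = prod_list ws ^ M"
    unfolding prod_blocks[of "\<lambda>j. ws ! j" M "k * k"] using len
    by (simp add: prod.list_conv_set_nth prod_power_distrib atLeast0LessThan)
  finally show ?thesis .
qed

lemma frm_scale: "frm (\<lambda>(i, a). \<tau> i * u (i, a)) i = single 0 (\<tau> i) * frm u i"
  by (rule poly_mapping_eqI) (simp add: frm_def lookup_form lookup_const_mult)

lemma F_det_scale: "F_det (\<lambda>(i, a). \<tau> i * u (i, a)) = (\<tau> 1 * \<tau> 2 * \<tau> 3 * \<tau> 4) ^ M * F_det u"
  using det_mult_matrix_scale[of "[\<tau> 1, \<tau> 2, \<tau> 3, \<tau> 4]" "linear_forms u" 2]
  by (simp add: F_det_def linear_forms_def frm_scale mult_ac)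

lemma Q_det_scale: "Q_det (\<lambda>(i, a). \<tau> i * u (i, a)) = ((\<tau> 1 * \<tau> 2 * \<tau> 3) ^ 5 * \<tau> 4 ^ 3) ^ M * Q_det u"
proof -
  let ?c = "\<lambda>i. single (0 :: expo) (\<tau> i)"
  let ?ws = "[\<tau> 1 ^ 2, \<tau> 2 ^ 2, \<tau> 3 ^ 2, \<tau> 1 * \<tau> 2, \<tau> 1 * \<tau> 3, \<tau> 1 * \<tau> 4, \<tau> 2 * \<tau> 3, \<tau> 2 * \<tau> 4, \<tau> 3 * \<tau> 4]"
  have c: "single (0 :: expo) (s * t) = single 0 s * single 0 t" for s t :: 'a
    by (simp add: mult_single)
  have "quadric_forms (\<lambda>(i, a). \<tau> i * u (i, a)) = map2 (\<lambda>s G. single 0 s * G) ?ws (quadric_forms u)"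
    by (simp add: quadric_forms_def frm_scale c power2_eq_square mult_ac)
  then have "Q_det (\<lambda>(i, a). \<tau> i * u (i, a)) = prod_list ?ws ^ M * Q_det u"
    unfolding Q_det_def by (simp only:) (rule det_mult_matrix_scale, simp_all add: length_quadric_forms)
  also have "prod_list ?ws = (\<tau> 1 * \<tau> 2 * \<tau> 3) ^ 5 * \<tau> 4 ^ 3"
    by (simp add: power2_eq_square power3_eq_cube numeral_eq_Suc mult_ac)
  finally show ?thesis .
qed

section \<open>Invertible and singular specializations\<close>

text \<open>Surjectivity of the map yields a right inverse matrix.\<close>

lemma mult_matrix_unit:
  fixes Gs :: "'r :: comm_ring_1 bipoly list"
  assumes len: "length Gs = k * k"
    and surj: "\<And>t. t \<in> box k \<Longrightarrow> \<exists>As. (\<forall>j<k * k. keys (As j) \<subseteq> box 1) \<and>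
      xmonom t = (\<Sum>j<k * k. As j * Gs ! j)"
  shows "\<exists>y. det (mult_matrix k Gs) * y = 1"
proof -
  let ?N = "k * k * M"
  from bchoice[OF ballI[OF surj]] obtain As where "\<forall>t\<in>box k. (\<forall>j<k * k. keys (As t j) \<subseteq> box 1) \<and>
      xmonom t = (\<Sum>j<k * k. As t j * Gs ! j)" ..
  then have As: "\<And>t j. t \<in> box k \<Longrightarrow> j < k * k \<Longrightarrow> keys (As t j) \<subseteq> box 1"
    "\<And>t. t \<in> box k \<Longrightarrow> xmonom t = (\<Sum>j<k * k. As t j * Gs ! j)" by blast+
  define B where "B = mat ?N ?N (\<lambda>(q, p). lookup (As (E k ! p) (q div M)) (E 1 ! (q mod M)))"
  have car: "mult_matrix k Gs \<in> carrier_mat ?N ?N" "B \<in> carrier_mat ?N ?N"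
    using mult_matrix_carrier[of k Gs] len by (auto simp: B_def)
  have "mult_matrix k Gs * B = 1\<^sub>m ?N"
  proof (rule eq_matI)
    fix r p assume "r < dim_row (1\<^sub>m ?N)" "p < dim_col (1\<^sub>m ?N)"
    then have r: "r < ?N" and p: "p < ?N" by auto
    note pb = E_box[OF p]
    have "(mult_matrix k Gs * B) $$ (r, p) = (\<Sum>q<k * k * M. mult_matrix k Gs $$ (r, q) * B $$ (q, p))"
      by (rule mat_mult_entry[OF car r p])
    also have "\<dots> = (\<Sum>j<k * k. \<Sum>a<M. mult_matrix k Gs $$ (r, j * M + a) * B $$ (j * M + a, p))"
      by (rule sum_blocks)
    also have "\<dots> = (\<Sum>j<k * k. \<Sum>a<1 * 1 * M. lookup (As (E k ! p) j) (E 1 ! a) *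
        lookup (xmonom (E 1 ! a) * Gs ! j) (E k ! r))"
    proof (rule sum.cong[OF refl], rule sum.cong)
      fix j a assume "j \<in> {..<k * k}" "a \<in> {..<1 * 1 * M}"
      then have j: "j < k * k" and a: "a < M" by auto
      show "mult_matrix k Gs $$ (r, j * M + a) * B $$ (j * M + a, p) = lookup (As (E k ! p) j) (E 1 ! a) *
        lookup (xmonom (E 1 ! a) * Gs ! j) (E k ! r)"
        using index_less[OF j a] index_split[OF a, of j] r p len by (simp add: mult_matrix_def B_def mult.commute)
    qed simp
    also have "\<dots> = (\<Sum>j<k * k. lookup (As (E k ! p) j * Gs ! j) (E k ! r))"
      by (intro sum.cong refl lookup_mult_expand[symmetric] As(1) pb) auto
    also have "\<dots> = lookup (xmonom (E k ! p)) (E k ! r)"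
      by (simp only: As(2)[OF pb] lookup_sum)
    also have "\<dots> = 1\<^sub>m ?N $$ (r, p)"
      using r p distinct_E[of k] length_E[of k] by (auto simp: lookup_xmonom nth_eq_iff_index_eq)
    finally show "(mult_matrix k Gs * B) $$ (r, p) = 1\<^sub>m ?N $$ (r, p)" .
  qed (use car in auto)
  then have "det (mult_matrix k Gs) * det B = 1" using car by (metis det_mult det_one)
  then show ?thesis by blast
qed

text \<open>Every monomial of $S_{km-1,kn-1}$ is a monomial of $S_{m-1,n-1}$ times some $x_1^{im} x_2^{jn}$ with $i,j<k$.\<close>

lemma mult_matrix_unit_corners:
  fixes Gs :: "'r :: comm_ring_1 bipoly list"
  assumes len: "length Gs = k * k"
    and corner: "\<And>i j. i < k \<Longrightarrow> j < k \<Longrightarrow>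
      \<exists>s. xmonom (i * m, j * n) = (\<Sum>l<k * k. single 0 (s l) * Gs ! l)"
  shows "\<exists>y. det (mult_matrix k Gs) * y = 1"
proof (rule mult_matrix_unit[OF len])
  fix t assume t: "t \<in> box k"
  obtain x y where xy: "t = (x, y)" by (cases t)
  have i: "x div m < k" "y div n < k" using t m n by (auto simp: xy box_def less_mult_imp_div_less)
  from corner[OF i] obtain s where s: "xmonom (x div m * m, y div n * n) =
      (\<Sum>l<k * k. single 0 (s l) * Gs ! l)" by blast
  have "t = (x mod m, y mod n) + (x div m * m, y div n * n)"
    by (simp add: xy plus_prod_def)
  then have "xmonom t = xmonom (x mod m, y mod n) * xmonom (x div m * m, y div n * n)"
    by (metis xmonom_add)
  also have "\<dots> = (\<Sum>l<k * k. (xmonom (x mod m, y mod n) * single 0 (s l)) * Gs ! l)"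
    unfolding s by (simp add: sum_distrib_left mult.assoc)
  finally have *: "xmonom t = (\<Sum>l<k * k. (xmonom (x mod m, y mod n) * single 0 (s l)) * Gs ! l)" .
  have "keys (xmonom (x mod m, y mod n) * single 0 (s l)) \<subseteq> box 1" for l
    using m n by (auto simp: xmonom_def mult_single box_def split: if_splits)
  with * show "\<exists>As. (\<forall>j<k * k. keys (As j) \<subseteq> box 1) \<and> xmonom t = (\<Sum>j<k * k. As j * Gs ! j)"
    by (intro exI[of _ "\<lambda>l. xmonom (x mod m, y mod n) * single 0 (s l)"] conjI) auto
qed

definition affine_val :: "complex \<Rightarrow> complex \<Rightarrow> complex bipoly \<Rightarrow> complex" where
  "affine_val x z = pm_eval (\<lambda>a. a) (\<lambda>t. x ^ fst t * z ^ snd t)"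

lemma affine_val_hom: "comm_ring_hom (affine_val x z)"
  unfolding affine_val_def
proof (rule pm_eval_hom)
  show "comm_ring_hom (\<lambda>a :: complex. a)" by unfold_locales auto
qed (auto simp: power_add)

lemma affine_val_alt:
  assumes "keys g \<subseteq> S" "finite S"
  shows "affine_val x z g = (\<Sum>t\<in>S. lookup g t * (x ^ fst t * z ^ snd t))"
  unfolding affine_val_def pm_eval_def
  by (rule sum.mono_neutral_left) (use assms in \<open>auto simp: in_keys_iff\<close>)

text \<open>The row vector of all monomials evaluated at a common zero annihilates the matrix.\<close>

lemma mult_matrix_singular:
  fixes Gs :: "complex bipoly list"
  assumes len: "length Gs = k * k" and k: "k > 0"
    and keys: "\<And>j a. j < k * k \<Longrightarrow> a \<in> box 1 \<Longrightarrow> keys (xmonom a * Gs ! j) \<subseteq> box k"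
    and zero: "\<And>j. j < k * k \<Longrightarrow> affine_val x z (Gs ! j) = 0"
  shows "det (mult_matrix k Gs) = 0"
proof -
  let ?N = "k * k * M"
  interpret b: comm_ring_hom "affine_val x z" by (rule affine_val_hom)
  have car: "mult_matrix k Gs \<in> carrier_mat ?N ?N" using mult_matrix_carrier[of k Gs] len by simp
  define v where "v = vec ?N (\<lambda>p. x ^ fst (E k ! p) * z ^ snd (E k ! p))"
  have "det (transpose_mat (mult_matrix k Gs)) = 0"
  proof (subst det_0_iff_vec_prod_zero_field[of _ ?N])
    show "\<exists>v. v \<in> carrier_vec ?N \<and> v \<noteq> 0\<^sub>v ?N \<and> transpose_mat (mult_matrix k Gs) *\<^sub>v v = 0\<^sub>v ?N"
    proof (intro exI conjI)
      show "v \<in> carrier_vec ?N" by (simp add: v_def)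
      have "(0, 0) \<in> set (E k)" using m n k by (simp add: set_E box_def)
      then obtain p where p: "p < ?N" "E k ! p = (0, 0)" by (metis in_set_conv_nth length_E)
      then have "v $ p = 1" by (simp add: v_def)
      then show "v \<noteq> 0\<^sub>v ?N" using p(1) by auto
      show "transpose_mat (mult_matrix k Gs) *\<^sub>v v = 0\<^sub>v ?N"
      proof (rule eq_vecI)
        fix q assume "q < dim_vec (0\<^sub>v ?N :: complex vec)"
        then have q: "q < ?N" by simp
        then have j: "q div M < k * k" by (simp add: less_mult_imp_div_less)
        let ?g = "xmonom (E 1 ! (q mod M)) * Gs ! (q div M)"
        have a: "E 1 ! (q mod M) \<in> box 1" by (rule E_box) (use M in simp)
        have "(transpose_mat (mult_matrix k Gs) *\<^sub>v v) $ q = (\<Sum>p<?N. mult_matrix k Gs $$ (p, q) * v $ p)"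
          using q car by (simp add: scalar_prod_def v_def atLeast0LessThan)
        also have "\<dots> = (\<Sum>p<?N. (\<lambda>t. lookup ?g t * (x ^ fst t * z ^ snd t)) (E k ! p))"
          using q len by (intro sum.cong) (auto simp: mult_matrix_def v_def)
        also have "\<dots> = (\<Sum>t\<in>box k. lookup ?g t * (x ^ fst t * z ^ snd t))"
          by (rule sum_E)
        also have "\<dots> = affine_val x z ?g"
          by (rule affine_val_alt[symmetric]) (use keys[OF j a] in \<open>auto simp: box_def\<close>)
        also have "\<dots> = 0" using zero[OF j] by (simp add: b.hom_mult)
        finally show "(transpose_mat (mult_matrix k Gs) *\<^sub>v v) $ q = 0\<^sub>v ?N $ q" using q by simp
      qed (use car in simp)
    qed
  qed (use car in simp)
  then show ?thesis using det_transpose[OF car] by simp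
qed

lemma Q_det_zero:
  fixes u :: "cvar \<Rightarrow> complex"
  assumes z: "\<And>i. i \<in> {1, 2, 3} \<Longrightarrow> affine_val x z (frm u i) = 0"
  shows "Q_det u = 0"
  unfolding Q_det_def
proof (rule mult_matrix_singular[where x = x and z = z])
  interpret b: comm_ring_hom "affine_val x z" by (rule affine_val_hom)
  show "length (quadric_forms u) = 3 * 3" by (simp add: length_quadric_forms)
  show "affine_val x z (quadric_forms u ! j) = 0" if "j < 3 * 3" for j
  proof -
    have "quadric_forms u ! j \<in> set (quadric_forms u)" using that by (intro nth_mem) (simp add: length_quadric_forms)
    then show ?thesis using z by (auto simp: quadric_forms_def b.hom_mult b.hom_power)
  qed
  show "keys (xmonom a * quadric_forms u ! j) \<subseteq> box 3" if "j < 3 * 3" "a \<in> box 1" for j a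
  proof -
    have "quadric_forms u ! j \<in> set (quadric_forms u)" using that by (intro nth_mem) (simp add: length_quadric_forms)
    then obtain i i' where "quadric_forms u ! j = frm u i * frm u i'"
      by (auto simp: quadric_forms_def power2_eq_square)
    then have e: "xmonom a * quadric_forms u ! j = (xmonom a * frm u i) * frm u i'" by (simp add: mult.assoc)
    show ?thesis
    proof
      fix t assume "t \<in> keys (xmonom a * quadric_forms u ! j)"
      then obtain p q where pq: "t = p + q" "p \<in> keys (xmonom a * frm u i)" "q \<in> keys (frm u i')"
        unfolding e using keys_mult by blast
      have "p \<in> box 2" using keys_xmonom_frm[OF that(2)] pq(2) by blast
      moreover have "q \<in> exp_box m n" using pq(3) by (auto simp: frm_def in_keys_iff lookup_form split: if_splits)
      ultimately show "t \<in> box 3" using pq(1) by (auto simp: box_def exp_box_def plus_prod_def)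
    qed
  qed
qed simp

end

text \<open>Rows are added one at a time while a right inverse is maintained: the new column of the right inverse is a
kernel vector of the present rows, and the new row is a coordinate functional normalized on it.\<close>

lemma complete_to_invertible:
  fixes f :: "nat \<Rightarrow> nat \<Rightarrow> 'a :: field"
  assumes "k \<le> N" and "\<And>r r'. r < k \<Longrightarrow> r' < k \<Longrightarrow> (\<Sum>l<N. f r l * S l r') = (if r = r' then 1 else 0)"
  shows "\<exists>g. (\<forall>r<k. g r = f r) \<and> det (mat N N (\<lambda>(r, l). g r l)) \<noteq> 0"
  using assms
proof (induction "N - k" arbitrary: k f S)
  case 0
  then have k: "k = N" by simp
  have "mat N N (\<lambda>(r, l). f r l) * mat N N (\<lambda>(r, l). S r l) = 1\<^sub>m N"
  proof (rule eq_matI)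
    fix i j assume "i < dim_row (1\<^sub>m N :: 'a mat)" "j < dim_col (1\<^sub>m N :: 'a mat)"
    then have ij: "i < N" "j < N" by auto
    have "(mat N N (\<lambda>(r, l). f r l) * mat N N (\<lambda>(r, l). S r l)) $$ (i, j) = (\<Sum>l<N. f i l * S l j)"
      using ij by (simp add: scalar_prod_def atLeast0LessThan)
    then show "(mat N N (\<lambda>(r, l). f r l) * mat N N (\<lambda>(r, l). S r l)) $$ (i, j) = 1\<^sub>m N $$ (i, j)"
      using 0(3)[of i j] ij k by simp
  qed auto
  then have "det (mat N N (\<lambda>(r, l). f r l)) * det (mat N N (\<lambda>(r, l). S r l)) = 1"
    by (metis det_mult det_one mat_carrier)
  then have "det (mat N N (\<lambda>(r, l). f r l)) \<noteq> 0" by auto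
  then show ?case by blast
next
  case (Suc d)
  then have "k < N" by simp
  from nontrivial_kernel[OF this, of f] obtain a j where
    a: "j < N" "a j \<noteq> 0" "\<And>r. r < k \<Longrightarrow> (\<Sum>l<N. f r l * a l) = 0" by blast
  \<comment> \<open>the new row \<open>g k\<close> takes the value 1 on the kernel vector \<open>a\<close>; \<open>T\<close> corrects the old columns of the right inverse\<close>
  define g where "g r = (if r = k then (\<lambda>l. if l = j then 1 / a j else 0) else f r)" for r
  define T where "T l r = (if r = k then a l else S l r - a l * (S j r / a j))" for l r
  have gk: "(\<Sum>l<N. g k l * h l) = h j / a j" for h
    using a(1) by (simp add: g_def if_distrib[of "\<lambda>x. x * _"] cong: if_cong)
  have "\<exists>h. (\<forall>r<Suc k. h r = g r) \<and> det (mat N N (\<lambda>(r, l). h r l)) \<noteq> 0"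
  proof (rule Suc.hyps(1))
    show "d = N - Suc k" "Suc k \<le> N" using Suc.hyps(2) \<open>k < N\<close> by auto
    fix r r' assume r: "r < Suc k" "r' < Suc k"
    show "(\<Sum>l<N. g r l * T l r') = (if r = r' then 1 else 0)"
    proof (cases "r = k")
      case True
      then show ?thesis using gk[of "\<lambda>l. T l r'"] a(2) by (simp add: T_def)
    next
      case False
      with r have rk: "r < k" by simp
      show ?thesis
      proof (cases "r' = k")
        case True
        then show ?thesis using False a(3)[OF rk] by (simp add: T_def g_def)
      next
        case r': False
        have "(\<Sum>l<N. g r l * T l r') = (\<Sum>l<N. f r l * S l r') - (\<Sum>l<N. f r l * a l) * (S j r' / a j)"
          using False r' by (simp add: T_def g_def right_diff_distrib sum_subtractf sum_distrib_right sum_divide_distrib mult.assoc)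
        then show ?thesis using Suc.prems(2)[OF rk, of r'] r r' a(3)[OF rk] by simp
      qed
    qed
  qed
  then obtain h where h: "\<And>r. r < Suc k \<Longrightarrow> h r = g r" "det (mat N N (\<lambda>(r, l). h r l)) \<noteq> 0" by blast
  have "\<forall>r<k. h r = f r" using h(1) by (simp add: g_def)
  with h(2) show ?case by blast
qed

context bideg
begin

text \<open>If $F_1,F_2,F_3$ generate $S_{3m-1,3n-1}$ then the upper rows have a right inverse, and the auxiliary rows
can be chosen to make the whole matrix invertible.\<close>

lemma stacked_det_nonzero:
  fixes c :: "cvar \<Rightarrow> complex"
  assumes surj: "\<And>t. t \<in> box 3 \<Longrightarrow> \<exists>As. (\<forall>i<3. keys (As i) \<subseteq> box 2) \<and>
      xmonom t = (\<Sum>i<3. As i * frm c (i + 1))"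
  shows "\<exists>u. (\<forall>i a. i < 6 \<longrightarrow> u (i, a) = c (i, a)) \<and> stacked_det u \<noteq> 0"
proof -
  let ?N = "3 * (4 * M)"
  define f where "f r s = lookup (xmonom (E 2 ! (s mod (4 * M))) * frm c (s div (4 * M) + 1)) (E 3 ! r)" for r s
  from bchoice[OF ballI[OF surj]] obtain As where "\<forall>t\<in>box 3. (\<forall>i<3. keys (As t i) \<subseteq> box 2) \<and>
      xmonom t = (\<Sum>i<3. As t i * frm c (i + 1))" ..
  then have As: "\<And>t i. t \<in> box 3 \<Longrightarrow> i < 3 \<Longrightarrow> keys (As t i) \<subseteq> box 2"
    "\<And>t. t \<in> box 3 \<Longrightarrow> xmonom t = (\<Sum>i<3. As t i * frm c (i + 1))" by blast+
  define S where "S s p = lookup (As (E 3 ! p) (s div (4 * M))) (E 2 ! (s mod (4 * M)))" for s p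
  have inv: "(\<Sum>s<?N. f r s * S s p) = (if r = p then 1 else 0)" if r: "r < 9 * M" and p: "p < 9 * M" for r p
  proof -
    have pb: "E 3 ! p \<in> box 3" by (rule E_box) (use p in simp)
    have "(\<Sum>s<?N. f r s * S s p) = (\<Sum>i<3. \<Sum>w<4 * M. f r (i * (4 * M) + w) * S (i * (4 * M) + w) p)"
      by (rule sum_blocks)
    also have "\<dots> = (\<Sum>i<3. \<Sum>w<2 * 2 * M. lookup (As (E 3 ! p) i) (E 2 ! w) *
        lookup (xmonom (E 2 ! w) * frm c (i + 1)) (E 3 ! r))"
    proof (rule sum.cong[OF refl], rule sum.cong)
      fix i w assume "w \<in> {..<2 * 2 * M}"
      then have w: "w < 4 * M" by simp
      show "f r (i * (4 * M) + w) * S (i * (4 * M) + w) p = lookup (As (E 3 ! p) i) (E 2 ! w) *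
        lookup (xmonom (E 2 ! w) * frm c (i + 1)) (E 3 ! r)"
        unfolding f_def S_def index_split[OF w, of i] by (rule mult.commute)
    qed simp
    also have "\<dots> = (\<Sum>i<3. lookup (As (E 3 ! p) i * frm c (i + 1)) (E 3 ! r))"
      by (intro sum.cong refl lookup_mult_expand[symmetric] As(1) pb) auto
    also have "\<dots> = lookup (xmonom (E 3 ! p)) (E 3 ! r)"
      by (simp only: As(2)[OF pb] lookup_sum)
    also have "\<dots> = (if r = p then 1 else 0)"
      using r p distinct_E[of 3] length_E[of 3] by (auto simp: lookup_xmonom nth_eq_iff_index_eq)
    finally show ?thesis .
  qed
  have "9 * M \<le> ?N" by simp
  from complete_to_invertible[OF this inv] obtain g where
    g: "\<And>r. r < 9 * M \<Longrightarrow> g r = f r" "det (mat ?N ?N (\<lambda>(r, l). g r l)) \<noteq> 0" by blast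
  define u where "u = (\<lambda>(i, a). if i < 6 then c (i, a) else g (9 * M + (i - 6)) (fst a))"
  have fr: "frm u (s div (4 * M) + 1) = frm c (s div (4 * M) + 1)" if "s < 12 * M" for s
  proof -
    have "s div (4 * M) < 3" using that by (simp add: less_mult_imp_div_less)
    then show ?thesis by (simp add: frm_def u_def)
  qed
  have "stacked u = mat ?N ?N (\<lambda>(r, l). g r l)"
  proof (rule eq_matI)
    fix r s assume "r < dim_row (mat ?N ?N (\<lambda>(r, l). g r l))" "s < dim_col (mat ?N ?N (\<lambda>(r, l). g r l))"
    then have rs: "r < 12 * M" "s < 12 * M" by auto
    show "stacked u $$ (r, s) = mat ?N ?N (\<lambda>(r, l). g r l) $$ (r, s)"
    proof (cases "r < 9 * M")
      case True
      then show ?thesis using rs fr[OF rs(2)] g(1)[of r] by (simp add: stacked_def f_def)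
    next
      case False
      then obtain e where "r = 9 * M + e" by (metis le_Suc_ex not_less)
      then show ?thesis using rs by (simp add: stacked_def u_def)
    qed
  qed (auto simp: stacked_def)
  then have "stacked_det u \<noteq> 0" using g(2) by (simp add: stacked_det_def)
  moreover have "\<forall>i a. i < 6 \<longrightarrow> u (i, a) = c (i, a)" by (simp add: u_def)
  ultimately show ?thesis by blast
qed

end

section \<open>Orderings of the bases\<close>

lemma ordering_permutation:
  assumes "distinct xs" "distinct ys" "set xs = set ys"
  shows "\<exists>p. p permutes {0..<length ys} \<and> (\<forall>i<length ys. xs ! i = ys ! p i)"
proof -
  have "mset xs = mset ys" using assms by (simp add: set_eq_iff_mset_eq_distinct)
  then obtain p where "p permutes {..<length ys}" "permute_list p ys = xs"
    by (metis mset_eq_permutation)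
  then show ?thesis
    by (intro exI[of _ p]) (auto simp: atLeast0LessThan permute_list_nth)
qed

lemma det_permuted:
  fixes A :: "'a :: comm_ring_1 mat"
  assumes A: "A \<in> carrier_mat N N" and p: "p permutes {0..<N}" and q: "q permutes {0..<N}"
  shows "det (mat N N (\<lambda>(i, j). A $$ (p i, q j))) = det A \<or> det (mat N N (\<lambda>(i, j). A $$ (p i, q j))) = - det A"
proof -
  have sg: "signof r = (1 :: 'a) \<or> signof r = (-1 :: 'a)" for r :: "nat \<Rightarrow> nat"
    by (auto simp: sign_def)
  let ?B = "mat N N (\<lambda>(i, j). A $$ (i, q j))"
  have pi: "p i < N" if "i < N" for i using permutes_in_image[OF p] that by simp
  have qi: "q i < N" if "i < N" for i using permutes_in_image[OF q] that by simp
  have B: "?B \<in> carrier_mat N N" by simp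
  have "mat N N (\<lambda>(i, j). A $$ (p i, q j)) = mat N N (\<lambda>(i, j). ?B $$ (p i, j))"
    by (rule eq_matI) (auto simp: pi)
  then have 1: "det (mat N N (\<lambda>(i, j). A $$ (p i, q j))) = signof p * det ?B"
    by (simp only: det_permute_rows[OF B p])
  have "transpose_mat ?B = mat N N (\<lambda>(i, j). transpose_mat A $$ (q i, j))"
    by (rule eq_matI) (use A qi in auto)
  then have "det (transpose_mat ?B) = signof q * det (transpose_mat A)"
    by (simp only: det_permute_rows[OF transpose_carrier_mat[THEN iffD2, OF A] q])
  then have 2: "det ?B = signof q * det A" using det_transpose[OF A] det_transpose[OF B] by simp
  show ?thesis unfolding 1 2 using sg[of p] sg[of q] by auto
qed

context bideg
begin

text \<open>Changing the orderings of the bases permutes rows and columns.\<close>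

lemma det_matrix_of:
  fixes Gs :: "'r :: comm_ring_1 bipoly list"
  assumes len: "length Gs = k * k" and k: "k > 0"
    and bs: "is_ordering bs (power_basis (k * k) (m - 1) (n - 1))"
    and es: "is_ordering es (exp_box (k * m - 1) (k * n - 1))"
  shows "det (matrix_of bs es (comb_map Gs)) = det (mult_matrix k Gs) \<or>
         det (matrix_of bs es (comb_map Gs)) = - det (mult_matrix k Gs)"
proof -
  let ?N = "k * k * M"
  let ?b = "\<lambda>q. (replicate (k * k) 0)[q div M := xmonom (E 1 ! (q mod M))] :: 'r bipoly list"
  define cs where "cs = map ?b [0..<?N]"
  have lb: "?b q ! l = (if l = q div M then xmonom (E 1 ! (q mod M)) else 0)" if "l < k * k" for q l
    using that by (simp add: nth_list_update)
  have x0: "xmonom a \<noteq> (0 :: 'r bipoly)" for a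
    by (metis lookup_xmonom lookup_zero zero_neq_one)
  have xinj: "xmonom a = (xmonom b :: 'r bipoly) \<Longrightarrow> a = b" for a b
    by (metis lookup_xmonom zero_neq_one)
  have dc: "distinct cs"
    unfolding cs_def distinct_map
  proof (intro conjI inj_onI)
    fix q q' assume q: "q \<in> set [0..<?N]" "q' \<in> set [0..<?N]" "?b q = ?b q'"
    then have d: "q div M < k * k" "q' div M < k * k" by (auto simp: less_mult_imp_div_less)
    have "?b q ! (q div M) = ?b q' ! (q div M)" using q(3) by simp
    then have e: "xmonom (E 1 ! (q mod M)) = (if q div M = q' div M then xmonom (E 1 ! (q' mod M)) else (0 :: 'r bipoly))"
      unfolding lb[OF d(1)] by simp
    then have 1: "q div M = q' div M" using x0 by (metis (full_types))
    with e xinj have "E 1 ! (q mod M) = E 1 ! (q' mod M)" by auto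
    then have "q mod M = q' mod M"
      using distinct_E[of 1] length_E[of 1] M by (simp add: nth_eq_iff_index_eq)
    with 1 show "q = q'" by (metis div_mult_mod_eq)
  qed simp
  have box1: "box 1 = exp_box (m - 1) (n - 1)" using m n by (auto simp: box_def exp_box_def)
  have sc: "set cs = power_basis (k * k) (m - 1) (n - 1)"
  proof
    show "set cs \<subseteq> power_basis (k * k) (m - 1) (n - 1)"
    proof
      fix x assume "x \<in> set cs"
      then obtain q where q: "q < ?N" "x = ?b q" by (auto simp: cs_def)
      then have "q div M < k * k" by (simp add: less_mult_imp_div_less)
      moreover have "E 1 ! (q mod M) \<in> exp_box (m - 1) (n - 1)"
        unfolding box1[symmetric] by (rule E_box) (use M in simp)
      ultimately show "x \<in> power_basis (k * k) (m - 1) (n - 1)" unfolding power_basis_def q(2) by blast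
    qed
    show "power_basis (k * k) (m - 1) (n - 1) \<subseteq> set cs"
    proof
      fix x :: "'r bipoly list" assume "x \<in> power_basis (k * k) (m - 1) (n - 1)"
      then obtain l a where la: "l < k * k" "a \<in> box 1" "x = (replicate (k * k) 0)[l := xmonom a]"
        unfolding power_basis_def box1 by blast
      then obtain w where w: "w < M" "E 1 ! w = a" using set_E[of 1] length_E[of 1] by (metis in_set_conv_nth mult_1)
      have x: "x = ?b (l * M + w)" using la w index_split[OF w(1), of l] by simp
      have "l * M + w < ?N" by (rule index_less[OF la(1) w(1)])
      then have "x \<in> ?b ` set [0..<?N]" unfolding x by (intro imageI) simp
      then show "x \<in> set cs" unfolding cs_def by simp
    qed
  qed
  have ek: "exp_box (k * m - 1) (k * n - 1) = set (E k)"
  proof -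
    have "0 < k * m" "0 < k * n" using m n k by simp_all
    then have "{0..k * m - 1} = {0..<k * m}" "{0..k * n - 1} = {0..<k * n}"
      by (metis Suc_pred' atLeastLessThanSuc_atLeastAtMost)+
    then show ?thesis by (simp only: set_E box_def exp_box_def)
  qed
  have lcs: "length cs = ?N" by (simp add: cs_def)
  obtain p where p: "p permutes {0..<?N}" "\<And>i. i < ?N \<Longrightarrow> es ! i = E k ! p i"
    using ordering_permutation[of es "E k"] es distinct_E[of k] ek length_E[of k]
    unfolding is_ordering_def by metis
  obtain q where q: "q permutes {0..<?N}" "\<And>i. i < ?N \<Longrightarrow> bs ! i = cs ! q i"
    using ordering_permutation[of bs cs] bs dc sc lcs unfolding is_ordering_def by metis
  have lb': "length bs = ?N" using bs dc sc lcs unfolding is_ordering_def by (metis distinct_card)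
  have le: "length es = ?N" using es distinct_E[of k] ek length_E[of k] unfolding is_ordering_def by (metis distinct_card)
  have comb: "comb_map Gs (cs ! j) = xmonom (E 1 ! (j mod M)) * Gs ! (j div M)" if j: "j < ?N" for j
  proof -
    have d: "j div M < k * k" using j by (simp add: less_mult_imp_div_less)
    have "comb_map Gs (cs ! j) = (\<Sum>l<k * k. ?b j ! l * Gs ! l)"
      using j len by (simp add: comb_map_def cs_def)
    also have "\<dots> = (\<Sum>l<k * k. if l = j div M then xmonom (E 1 ! (j mod M)) * Gs ! l else 0)"
      by (intro sum.cong refl) (simp add: lb)
    finally show ?thesis using d by simp
  qed
  have "matrix_of bs es (comb_map Gs) = mat ?N ?N (\<lambda>(i, j). mult_matrix k Gs $$ (p i, q j))"
  proof (rule eq_matI)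
    fix i j assume "i < dim_row (mat ?N ?N (\<lambda>(i, j). mult_matrix k Gs $$ (p i, q j)))"
      "j < dim_col (mat ?N ?N (\<lambda>(i, j). mult_matrix k Gs $$ (p i, q j)))"
    then have ij: "i < ?N" "j < ?N" by auto
    then have pq: "p i < ?N" "q j < ?N" using permutes_in_image[OF p(1)] permutes_in_image[OF q(1)] by auto
    show "matrix_of bs es (comb_map Gs) $$ (i, j) = mat ?N ?N (\<lambda>(i, j). mult_matrix k Gs $$ (p i, q j)) $$ (i, j)"
      using ij pq lb' le len by (simp add: matrix_of_def p(2) q(2) comb mult_matrix_def)
  qed (auto simp: matrix_of_def lb' le)
  moreover have "mult_matrix k Gs \<in> carrier_mat ?N ?N" using mult_matrix_carrier[of k Gs] len by simp
  ultimately show ?thesis using det_permuted[OF _ p(1) q(1), of "mult_matrix k Gs"] by simp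
qed

end

section \<open>Forms without common zeros\<close>

text \<open>Polynomials in $x_1$ over $\mathbb{C}[x_2]$.\<close>

definition bi_poly :: "complex bipoly \<Rightarrow> complex poly poly" where
  "bi_poly = pm_eval (\<lambda>a. [:[:a:]:]) (\<lambda>t. monom (monom 1 (snd t)) (fst t))"

lemma const_const_hom: "comm_ring_hom (\<lambda>a :: complex. [:[:a:]:])"
  by unfold_locales (simp_all add: pCons_one)

lemma bi_poly_hom: "comm_ring_hom bi_poly"
  unfolding bi_poly_def
  by (rule pm_eval_hom[OF const_const_hom]) (auto simp: mult_monom monom_0 pCons_one)

lemma coeff_bi_poly: "coeff (coeff (bi_poly g) i) j = lookup g (i, j)"
proof -
  have "coeff (coeff (bi_poly g) i) j = (\<Sum>t\<in>keys g. if t = (i, j) then lookup g t else 0)"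
    unfolding bi_poly_def pm_eval_def coeff_sum
    by (intro sum.cong refl) (auto simp: coeff_sum)
  then show ?thesis by (simp add: in_keys_iff)
qed

lemma bi_poly_inj: "bi_poly g = bi_poly h \<Longrightarrow> g = h"
  by (rule poly_mapping_eqI) (metis coeff_bi_poly surj_pair)

lemma bihom_form:
  "bihom m n (form m n u) (x1, y1) (x2, y2) =
     (\<Sum>a\<in>exp_box m n. u a * x1 ^ fst a * y1 ^ (m - fst a) * x2 ^ snd a * y2 ^ (n - snd a))"
proof -
  have "bihom m n (form m n u) (x1, y1) (x2, y2) =
     (\<Sum>a\<in>keys (form m n u). lookup (form m n u) a * x1 ^ fst a * y1 ^ (m - fst a) * x2 ^ snd a * y2 ^ (n - snd a))"
    by (simp add: bihom_def case_prod_unfold)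
  also have "\<dots> = (\<Sum>a\<in>exp_box m n. lookup (form m n u) a * x1 ^ fst a * y1 ^ (m - fst a) * x2 ^ snd a * y2 ^ (n - snd a))"
    by (rule sum.mono_neutral_left) (auto simp: in_keys_iff lookup_form exp_box_def split: if_splits)
  finally show ?thesis by (simp add: lookup_form)
qed

lemma bi_poly_form:
  "bi_poly (form m n u) = (\<Sum>a\<in>exp_box m n. monom (monom (u a) (snd a)) (fst a))"
proof (intro poly_eqI)
  fix i j
  have "coeff (coeff (\<Sum>a\<in>exp_box m n. monom (monom (u a) (snd a)) (fst a)) i) j
      = (\<Sum>a\<in>exp_box m n. if a = (i, j) then u a else 0)"
    unfolding coeff_sum by (intro sum.cong refl) auto
  also have "\<dots> = coeff (coeff (bi_poly (form m n u)) i) j"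
    by (simp add: coeff_bi_poly lookup_form exp_box_def)
  finally show "coeff (coeff (bi_poly (form m n u)) i) j =
      coeff (coeff (\<Sum>a\<in>exp_box m n. monom (monom (u a) (snd a)) (fst a)) i) j" by simp
qed

lemma zdeg_bi_poly:
  assumes "\<And>t. t \<in> keys g \<Longrightarrow> snd t < k"
  shows "zdeg_lt k (bi_poly g)"
  using assms by (force simp: zdeg_lt_def deg_lt_def coeff_bi_poly in_keys_iff)

lemma degree_bi_poly:
  assumes "\<And>t. t \<in> keys g \<Longrightarrow> fst t < k" "k > 0"
  shows "degree (bi_poly g) < k"
proof -
  have "degree (bi_poly g) \<le> k - 1"
  proof (rule degree_le, intro allI impI)
    fix i assume "k - 1 < i"
    then have "\<And>j. lookup g (i, j) = 0"
      using assms by (metis Suc_pred' fst_conv in_keys_iff less_Suc_eq not_less_eq)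
    then show "coeff (bi_poly g) i = 0" by (intro poly_eqI) (simp add: coeff_bi_poly)
  qed
  with assms(2) show ?thesis by linarith
qed

context bideg
begin

text \<open>A point of $\mathbb{P}^1 \times \mathbb{P}^1$ has coordinates $(t,1)$ or $(1,0)$ in each factor.  Values at
infinity in the second factor are coefficients at $x_2^n$.\<close>

lemma no_common_zero_locale:
  fixes c :: "cvar \<Rightarrow> complex"
  assumes ncz: "\<not> common_zero m n (map (\<lambda>i. form m n (\<lambda>a. c (i, a))) [1, 2, 3])"
  shows "no_common_zero m n (bi_poly (frm c 1)) (bi_poly (frm c 2)) (bi_poly (frm c 3))"
proof -
  have nz: "\<exists>i\<in>{1, 2, 3}. bihom m n (frm c i) P Q \<noteq> 0" if "P \<noteq> (0, 0)" "Q \<noteq> (0, 0)" for P Q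
  proof (rule ccontr)
    assume "\<not> ?thesis"
    with that have "common_zero m n (map (\<lambda>i. form m n (\<lambda>a. c (i, a))) [1, 2, 3])"
      unfolding common_zero_def frm_def by (intro exI[of _ P] exI[of _ Q]) auto
    with ncz show False ..
  qed
  have dz: "zdeg_lt (Suc n) (bi_poly (frm c i))" for i
    by (rule zdeg_bi_poly) (auto simp: frm_def in_keys_iff lookup_form exp_box_def split: if_splits)
  have dx: "degree (bi_poly (frm c i)) \<le> m" for i
  proof -
    have "degree (bi_poly (frm c i)) < Suc m"
      by (rule degree_bi_poly) (auto simp: frm_def in_keys_iff lookup_form exp_box_def split: if_splits)
    then show ?thesis by simp
  qed
  have pw: "(0 :: complex) ^ (k - j) = (if j = k then 1 else 0)" if "j \<le> k" for j k :: nat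
    using that by (auto simp: power_0_left)
  have ev: "poly (bi_poly (frm c i)) [:t:] = (\<Sum>a\<in>exp_box m n. smult (t ^ fst a) (monom (c (i, a)) (snd a)))" for i t
    by (simp add: frm_def bi_poly_form poly_sum poly_monom poly_const_pow mult.commute)
  have e1: "poly (poly (bi_poly (frm c i)) [:t:]) z = bihom m n (frm c i) (t, 1) (z, 1)" for i t z
    unfolding ev by (simp add: frm_def bihom_form poly_sum poly_monom mult_ac)
  have e2: "coeff (poly (bi_poly (frm c i)) [:t:]) n = bihom m n (frm c i) (t, 1) (1, 0)" for i t
    unfolding ev coeff_sum unfolding frm_def bihom_form
    by (rule sum.cong) (auto simp: exp_box_def pw mult_ac)
  have ci: "coeff (bi_poly (frm c i)) m = (\<Sum>a\<in>exp_box m n. if fst a = m then monom (c (i, a)) (snd a) else 0)" for i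
    by (simp add: frm_def bi_poly_form coeff_sum)
  have e3: "poly (coeff (bi_poly (frm c i)) m) z = bihom m n (frm c i) (1, 0) (z, 1)" for i z
    unfolding ci poly_sum unfolding frm_def bihom_form
    by (rule sum.cong) (auto simp: exp_box_def pw poly_monom)
  have e4: "coeff (coeff (bi_poly (frm c i)) m) n = bihom m n (frm c i) (1, 0) (1, 0)" for i
    unfolding ci coeff_sum unfolding frm_def bihom_form
    by (rule sum.cong) (auto simp: exp_box_def pw)
  have dl: "deg_lt (Suc n) (poly (bi_poly (frm c i)) [:t:])" "deg_lt (Suc n) (coeff (bi_poly (frm c i)) m)" for i t
    using dz[of i] zdeg_lt_eval[OF dz[of i]] by (auto simp: zdeg_lt_def)
  show ?thesis
  proof
    show "no_zero n (poly (bi_poly (frm c 1)) [:t:]) (poly (bi_poly (frm c 2)) [:t:]) (poly (bi_poly (frm c 3)) [:t:])" for t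
      unfolding no_zero_def e1 e2 using dl nz[of "(t, 1)" "(_, 1)"] nz[of "(t, 1)" "(1, 0)"] by auto
    show "no_zero n (coeff (bi_poly (frm c 1)) m) (coeff (bi_poly (frm c 2)) m) (coeff (bi_poly (frm c 3)) m)"
      unfolding no_zero_def e3 e4 using dl nz[of "(1, 0)" "(_, 1)"] nz[of "(1, 0)" "(1, 0)"] by auto
  qed (auto simp: m n dx dz)
qed

lemma bi_poly_surj:
  assumes "zdeg_lt (2 * n) A" "degree A < 2 * m"
  shows "\<exists>g. bi_poly g = A \<and> keys g \<subseteq> box 2"
proof -
  define g where "g = (\<Sum>t\<in>box 2. single t (coeff (coeff A (fst t)) (snd t)))"
  have fin: "finite (box 2)" by (simp add: box_def)
  have l: "lookup g t = (if t \<in> box 2 then coeff (coeff A (fst t)) (snd t) else 0)" for t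
    using fin by (simp add: g_def lookup_sum lookup_single when_def)
  have "bi_poly g = A"
  proof (intro poly_eqI)
    fix i j
    show "coeff (coeff (bi_poly g) i) j = coeff (coeff A i) j"
    proof (cases "i < 2 * m \<and> j < 2 * n")
      case True
      then show ?thesis by (simp add: coeff_bi_poly l box_def)
    next
      case False
      then have "coeff (coeff A i) j = 0"
        using assms by (metis coeff_0 coeff_eq_0 deg_lt_def less_le_trans not_less zdeg_lt_def)
      then show ?thesis using False by (simp add: coeff_bi_poly l)
    qed
  qed
  moreover have "keys g \<subseteq> box 2" by (auto simp: in_keys_iff l split: if_splits)
  ultimately show ?thesis by blast
qed

lemma stacked_det_nonzero_if_no_common_zero:
  fixes c :: "cvar \<Rightarrow> complex"
  assumes "\<not> common_zero m n (map (\<lambda>i. form m n (\<lambda>a. c (i, a))) [1, 2, 3])"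
  shows "\<exists>u. (\<forall>i a. i < 6 \<longrightarrow> u (i, a) = c (i, a)) \<and> stacked_det u \<noteq> 0"
proof (rule stacked_det_nonzero)
  interpret no_common_zero m n "bi_poly (frm c 1)" "bi_poly (frm c 2)" "bi_poly (frm c 3)"
    by (rule no_common_zero_locale[OF assms])
  interpret b: comm_ring_hom bi_poly by (rule bi_poly_hom)
  fix t assume t: "t \<in> box 3"
  have "zdeg_lt (3 * n) (bi_poly (xmonom t))"
    by (rule zdeg_bi_poly) (use t in \<open>auto simp: box_def in_keys_iff lookup_xmonom split: if_splits\<close>)
  moreover have "degree (bi_poly (xmonom t)) < 3 * m"
    by (rule degree_bi_poly) (use t m in \<open>auto simp: box_def in_keys_iff lookup_xmonom split: if_splits\<close>)
  ultimately obtain A1 A2 A3 where A: "zdeg_lt (2 * n) A1" "zdeg_lt (2 * n) A2" "zdeg_lt (2 * n) A3"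
     "degree A1 < 2 * m" "degree A2 < 2 * m" "degree A3 < 2 * m"
     "bi_poly (xmonom t) = A1 * bi_poly (frm c 1) + A2 * bi_poly (frm c 2) + A3 * bi_poly (frm c 3)"
    using bidegree_surjective by blast
  obtain g1 g2 g3 where g: "bi_poly g1 = A1" "keys g1 \<subseteq> box 2" "bi_poly g2 = A2" "keys g2 \<subseteq> box 2"
    "bi_poly g3 = A3" "keys g3 \<subseteq> box 2"
    using bi_poly_surj A by metis
  have "bi_poly (xmonom t) = bi_poly (g1 * frm c 1 + g2 * frm c 2 + g3 * frm c 3)"
    unfolding A(7) by (simp add: b.hom_add b.hom_mult g)
  then have "xmonom t = g1 * frm c 1 + g2 * frm c 2 + g3 * frm c 3" by (rule bi_poly_inj)
  moreover have "(\<Sum>i<3. [g1, g2, g3] ! i * frm c (i + 1)) = g1 * frm c 1 + g2 * frm c 2 + g3 * frm c 3"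
    by (simp add: numeral_3_eq_3 numeral_2_eq_2)
  moreover have "keys ([g1, g2, g3] ! i) \<subseteq> box 2" if "i < 3" for i
  proof -
    have "[g1, g2, g3] ! i \<in> set [g1, g2, g3]" by (rule nth_mem) (use that in simp)
    then show ?thesis using g by auto
  qed
  ultimately show "\<exists>As. (\<forall>i<3. keys (As i) \<subseteq> box 2) \<and> xmonom t = (\<Sum>i<3. As i * frm c (i + 1))"
    by (intro exI[of _ "\<lambda>i. [g1, g2, g3] ! i"]) auto
qed

section \<open>Forms in powers of the variables\<close>

abbreviation C :: "'r :: comm_ring_1 \<Rightarrow> 'r bipoly" where "C \<equiv> single 0"
abbreviation X :: "'r :: comm_ring_1 bipoly" where "X \<equiv> xmonom (m, 0)"
abbreviation Z :: "'r :: comm_ring_1 bipoly" where "Z \<equiv> xmonom (0, n)"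

text \<open>The coefficient function of $\alpha + \beta X + \gamma Z + \delta XZ$ where $X = x_1^m$ and $Z = x_2^n$.  All
special values of the determinants are taken at such forms.\<close>

fun corner :: "'r :: comm_ring_1 \<times> 'r \<times> 'r \<times> 'r \<Rightarrow> expo \<Rightarrow> 'r" where
  "corner (\<alpha>, \<beta>, \<gamma>, \<delta>) a = (if a = (0, 0) then \<alpha> else 0) + (if a = (m, 0) then \<beta> else 0) +
     (if a = (0, n) then \<gamma> else 0) + (if a = (m, n) then \<delta> else 0)"

lemma sum_corner:
  "(\<Sum>a\<in>exp_box m n. corner (\<alpha>, \<beta>, \<gamma>, \<delta>) a * g a) = \<alpha> * g (0, 0) + \<beta> * g (m, 0) + \<gamma> * g (0, n) + \<delta> * g (m, n)"
proof -
  have "finite (exp_box m n)" "(0, 0) \<in> exp_box m n" "(m, 0) \<in> exp_box m n" "(0, n) \<in> exp_box m n" "(m, n) \<in> exp_box m n"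
    by (auto simp: exp_box_def)
  then show ?thesis
    by (simp add: distrib_right sum.distrib if_distrib[of "\<lambda>x. x * _"] cong: if_cong)
qed

lemma corner_monomial: "xmonom (i * m, j * n) = X ^ i * (Z ^ j :: 'r :: comm_ring_1 bipoly)"
proof -
  have x: "X ^ i = (xmonom (i * m, 0) :: 'r bipoly)" for i
  proof (induction i)
    case 0
    then show ?case by (simp add: zero_prod_def flip: xmonom_0)
  next
    case (Suc i)
    then show ?case by (simp add: plus_prod_def flip: xmonom_add)
  qed
  have z: "Z ^ j = (xmonom (0, j * n) :: 'r bipoly)" for j
  proof (induction j)
    case 0
    then show ?case by (simp add: zero_prod_def flip: xmonom_0)
  next
    case (Suc j)
    then show ?case by (simp add: plus_prod_def flip: xmonom_add)
  qed
  show ?thesis unfolding x z by (simp add: plus_prod_def flip: xmonom_add)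
qed

lemma form_corner: "form m n (corner (\<alpha>, \<beta>, \<gamma>, \<delta>)) = C \<alpha> + C \<beta> * X + C \<gamma> * Z + C \<delta> * (X * Z)"
proof -
  have xz: "X * Z = (xmonom (m, n) :: 'a bipoly)" by (simp add: plus_prod_def flip: xmonom_add)
  have c: "C \<alpha> = C \<alpha> * xmonom (0, 0)" for \<alpha> :: 'a
    by (simp add: xmonom_def mult_single zero_prod_def)
  show ?thesis unfolding xz
    by (subst c[of \<alpha>], rule poly_mapping_eqI)
      (auto simp: lookup_form lookup_add lookup_const_mult lookup_xmonom exp_box_def)
qed

definition in_span :: "'r :: comm_ring_1 bipoly list \<Rightarrow> 'r bipoly \<Rightarrow> bool" where
  "in_span Gs P \<longleftrightarrow> (\<exists>s. P = (\<Sum>l<length Gs. C (s l) * Gs ! l))"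

lemma in_span_add: "in_span Gs P \<Longrightarrow> in_span Gs Q \<Longrightarrow> in_span Gs (P + Q)"
  unfolding in_span_def
proof (elim exE)
  fix s t assume "P = (\<Sum>l<length Gs. C (s l) * Gs ! l)" "Q = (\<Sum>l<length Gs. C (t l) * Gs ! l)"
  then have "P + Q = (\<Sum>l<length Gs. C (s l + t l) * Gs ! l)"
    by (simp add: single_add distrib_right sum.distrib)
  then show "\<exists>s. P + Q = (\<Sum>l<length Gs. C (s l) * Gs ! l)" by (rule exI[of _ "\<lambda>l. s l + t l"])
qed

lemma in_span_scale: "in_span Gs P \<Longrightarrow> in_span Gs (C c * P)"
  unfolding in_span_def
proof (elim exE)
  fix s assume "P = (\<Sum>l<length Gs. C (s l) * Gs ! l)"
  then have "C c * P = (\<Sum>l<length Gs. C (c * s l) * Gs ! l)"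
    by (simp add: sum_distrib_left mult_single flip: mult.assoc)
  then show "\<exists>s. C c * P = (\<Sum>l<length Gs. C (s l) * Gs ! l)" by (rule exI[of _ "\<lambda>l. c * s l"])
qed

lemma in_span_diff: "in_span Gs P \<Longrightarrow> in_span Gs Q \<Longrightarrow> in_span Gs (P - Q)"
  using in_span_add[OF _ in_span_scale[of Gs Q "-1"]] by (simp add: single_uminus)

lemma in_span_member: "P \<in> set Gs \<Longrightarrow> in_span Gs P"
  unfolding in_span_def in_set_conv_nth
proof (elim exE conjE)
  fix i assume i: "i < length Gs" "Gs ! i = P"
  have "P = (\<Sum>l<length Gs. C (if l = i then 1 else 0) * Gs ! l)"
    using i by (simp add: if_distrib[of C] if_distrib[of "\<lambda>x. x * _"] cong: if_cong)
  then show "\<exists>s. P = (\<Sum>l<length Gs. C (s l) * Gs ! l)"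
    by (rule exI[of _ "\<lambda>l. if l = i then 1 else 0"])
qed

lemma mult_matrix_unit_span:
  assumes "length Gs = k * k" and "\<And>i j. i < k \<Longrightarrow> j < k \<Longrightarrow> in_span Gs (X ^ i * Z ^ j)"
  shows "\<exists>y. det (mult_matrix k Gs) * y = 1"
  by (rule mult_matrix_unit_corners[OF assms(1)])
    (use assms in \<open>auto simp: in_span_def corner_monomial\<close>)

text \<open>On forms in $X$ and $Z$ the map $F_{m,n}$ is invertible as soon as the four forms span $1, X, Z, XZ$.\<close>

lemma F_det_unit:
  assumes "\<And>P. P \<in> {1, X, Z, X * Z} \<Longrightarrow> in_span (linear_forms u) P"
  shows "\<exists>y. F_det u * y = 1"
  unfolding F_det_def
proof (rule mult_matrix_unit_span)
  show "length (linear_forms u) = 2 * 2" by (simp add: length_linear_forms)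
  fix i j :: nat assume "i < 2" "j < 2"
  then have "i = 0 \<or> i = 1" "j = 0 \<or> j = 1" by auto
  then show "in_span (linear_forms u) (X ^ i * Z ^ j)" using assms by auto
qed

definition corner_point :: "(nat \<Rightarrow> 'r :: comm_ring_1 \<times> 'r \<times> 'r \<times> 'r) \<Rightarrow> cvar \<Rightarrow> 'r" where
  "corner_point K = (\<lambda>(i, a). corner (K i) a)"

lemma frm_corner_point:
  "K i = (\<alpha>, \<beta>, \<gamma>, \<delta>) \<Longrightarrow> frm (corner_point K) i = C \<alpha> + C \<beta> * X + C \<gamma> * Z + C \<delta> * (X * Z)"
  by (simp only: frm_def corner_point_def split form_corner)

text \<open>The forms are $1$, $X+Z$, $XZ$, $X$.\<close>

lemma F_det_unit_base:
  assumes "K 1 = (1, 0, 0, 0)" "K 2 = (0, 1, 1, 0)" "K 3 = (0, 0, 0, 1)" "K 4 = (0, 1, 0, 0)"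
  shows "\<exists>y. F_det (corner_point K) * y = 1"
proof (rule F_det_unit)
  let ?u = "corner_point K"
  let ?L = "linear_forms ?u"
  have f: "frm ?u 1 = 1" "frm ?u 2 = X + Z" "frm ?u 3 = X * Z" "frm ?u 4 = X"
    by (simp_all add: assms frm_corner_point del: One_nat_def)
  have s: "in_span ?L 1" "in_span ?L (X + Z)" "in_span ?L (X * Z)" "in_span ?L X"
    by (rule in_span_member, simp only: linear_forms_def f, simp)+
  have "in_span ?L Z" using in_span_diff[OF s(2,4)] by simp
  with s show "\<And>P. P \<in> {1, X, Z, X * Z} \<Longrightarrow> in_span ?L P" by blast
qed

text \<open>For $1$, $X+Z$, $XZ$, $X$ the nine products occurring in $Q_{m,n}$ span the nine monomials $X^iZ^j$ with
$i,j \le 2$.  (For $1, X, Z, XZ$ they do not, because $1 \cdot XZ = X \cdot Z$.)\<close>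

lemma Q_det_unit_base:
  assumes "K 1 = (1, 0, 0, 0)" "K 2 = (0, 1, 1, 0)" "K 3 = (0, 0, 0, 1)" "K 4 = (0, 1, 0, 0)"
  shows "\<exists>y. Q_det (corner_point K) * y = 1"
  unfolding Q_det_def
proof (rule mult_matrix_unit_span)
  let ?u = "corner_point K"
  let ?L = "quadric_forms ?u"
  show "length ?L = 3 * 3" by (simp add: length_quadric_forms)
  have f: "frm ?u 1 = 1" "frm ?u 2 = X + Z" "frm ?u 3 = X * Z" "frm ?u 4 = X"
    by (simp_all add: assms frm_corner_point del: One_nat_def)
  have L: "?L = [1, (X + Z) ^ 2, (X * Z) ^ 2, X + Z, X * Z, X, (X + Z) * (X * Z), (X + Z) * X, (X * Z) * X]"
    by (simp only: quadric_forms_def f) simp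
  have s: "in_span ?L 1" "in_span ?L ((X + Z) ^ 2)" "in_span ?L ((X * Z) ^ 2)" "in_span ?L (X + Z)"
    "in_span ?L (X * Z)" "in_span ?L X" "in_span ?L ((X + Z) * (X * Z))" "in_span ?L ((X + Z) * X)" "in_span ?L ((X * Z) * X)"
    by (rule in_span_member, simp add: L)+
  have z: "in_span ?L Z" using in_span_diff[OF s(4,6)] by simp
  have x2: "in_span ?L (X ^ 2)" using in_span_diff[OF s(8,5)] by (simp add: algebra_simps power2_eq_square)
  have "(X + Z) ^ 2 - X * Z - X * Z - X ^ 2 = (Z ^ 2 :: 'a bipoly)"
    by (simp add: power2_eq_square algebra_simps)
  then have z2: "in_span ?L (Z ^ 2)"
    using in_span_diff[OF in_span_diff[OF in_span_diff[OF s(2,5)] s(5)] x2] by simp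
  have x2z: "in_span ?L (X ^ 2 * Z)" using s(9) by (simp add: power2_eq_square mult_ac)
  have xz2: "in_span ?L (X * Z ^ 2)" using in_span_diff[OF s(7,9)] by (simp add: algebra_simps power2_eq_square)
  have x2z2: "in_span ?L (X ^ 2 * Z ^ 2)" using s(3) by (simp add: power_mult_distrib)
  fix i j :: nat assume "i < 3" "j < 3"
  then have "i = 0 \<or> i = 1 \<or> i = 2" "j = 0 \<or> j = 1 \<or> j = 2" by auto
  then show "in_span ?L (X ^ i * Z ^ j)"
    using s z x2 z2 x2z xz2 x2z2 by (elim disjE) (simp_all only: power_0 power_one_right mult_1_left mult_1_right)
qed

text \<open>The first three forms are $t f_j + f_{j+1}$ for $f = (1, X+Z, XZ, X)$, the fourth one is $f_1$.  Knowing
$f_1$, one recovers $f_2$, $f_3$ and $f_4$ in turn, for every value of $t$.\<close>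

lemma F_det_unit_cyclic:
  assumes "K 1 = (t, 1, 1, 0)" "K 2 = (0, t, t, 1)" "K 3 = (0, 1, 0, t)" "K 4 = (1, 0, 0, 0)"
  shows "\<exists>y. F_det (corner_point K) * y = 1"
proof (rule F_det_unit)
  let ?u = "corner_point K"
  let ?L = "linear_forms ?u"
  have f: "frm ?u 1 = C t + X + Z" "frm ?u 2 = C t * X + C t * Z + X * Z" "frm ?u 3 = X + C t * (X * Z)" "frm ?u 4 = 1"
    by (simp_all add: assms frm_corner_point del: One_nat_def)
  have s: "in_span ?L (frm ?u i)" if "i \<in> {1, 2, 3, 4}" for i
    using that by (intro in_span_member) (auto simp: linear_forms_def)
  have s1: "in_span ?L 1" using s[of 4] by (simp add: f)
  have "in_span ?L (frm ?u 1 - C t * 1)" using s[of 1] s1 by (intro in_span_diff in_span_scale) auto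
  then have sS: "in_span ?L (X + Z)" unfolding f by (simp add: algebra_simps)
  have "in_span ?L (frm ?u 2 - C t * (X + Z))" using s[of 2] sS by (intro in_span_diff in_span_scale) auto
  then have sP: "in_span ?L (X * Z)" unfolding f by (simp add: algebra_simps)
  have "in_span ?L (frm ?u 3 - C t * (X * Z))" using s[of 3] sP by (intro in_span_diff in_span_scale) auto
  then have sX: "in_span ?L X" unfolding f by (simp add: algebra_simps)
  have "in_span ?L Z" using in_span_diff[OF sS sX] by simp
  with s1 sX sP show "\<And>P. P \<in> {1, X, Z, X * Z} \<Longrightarrow> in_span ?L P" by blast
qed

text \<open>Here $a$ and $b$ are the values of $X$ and $Z$ at a point at which the first three forms vanish.\<close>

lemma F_det_unit_through_point:
  assumes "K 1 = (-a, 1, 0, 0)" "K 2 = (-b, 0, 1, 0)" "K 3 = (-(a * b), 0, 0, 1)" "K 4 = (1, 0, 0, 0)"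
  shows "\<exists>y. F_det (corner_point K) * y = 1"
proof (rule F_det_unit)
  let ?u = "corner_point K"
  let ?L = "linear_forms ?u"
  have f: "frm ?u 1 = C (-a) + X" "frm ?u 2 = C (-b) + Z" "frm ?u 3 = C (-(a * b)) + X * Z" "frm ?u 4 = 1"
    by (simp_all add: assms frm_corner_point del: One_nat_def)
  have s: "in_span ?L (frm ?u i)" if "i \<in> {1, 2, 3, 4}" for i
    using that by (intro in_span_member) (auto simp: linear_forms_def)
  have s1: "in_span ?L 1" using s[of 4] by (simp add: f)
  have c: "in_span ?L (C e)" for e using in_span_scale[OF s1, of e] by simp
  have "in_span ?L X" using in_span_diff[OF s[of 1] c[of "-a"]] by (simp add: f del: One_nat_def)
  moreover have "in_span ?L Z" using in_span_diff[OF s[of 2] c[of "-b"]] by (simp add: f)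
  moreover have "in_span ?L (X * Z)" using in_span_diff[OF s[of 3] c[of "-(a * b)"]] by (simp add: f)
  ultimately show "\<And>P. P \<in> {1, X, Z, X * Z} \<Longrightarrow> in_span ?L P" using s1 by blast
qed

lemma bihom_corner:
  "bihom m n (form m n (corner (\<alpha>, \<beta>, \<gamma>, \<delta>))) (x1, y1) (x2, y2) =
     \<alpha> * (y1 ^ m * y2 ^ n) + \<beta> * (x1 ^ m * y2 ^ n) + \<gamma> * (y1 ^ m * x2 ^ n) + \<delta> * (x1 ^ m * x2 ^ n)"
  using sum_corner[of \<alpha> \<beta> \<gamma> \<delta> "\<lambda>a. x1 ^ fst a * y1 ^ (m - fst a) * x2 ^ snd a * y2 ^ (n - snd a)"]
  by (simp only: bihom_form mult.assoc) simp

lemma affine_val_form: "affine_val x z (form m n u) = (\<Sum>a\<in>exp_box m n. u a * (x ^ fst a * z ^ snd a))"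
proof -
  have "affine_val x z (form m n u) = (\<Sum>a\<in>exp_box m n. lookup (form m n u) a * (x ^ fst a * z ^ snd a))"
    by (rule affine_val_alt) (auto simp: in_keys_iff lookup_form exp_box_def split: if_splits)
  then show ?thesis by (simp add: lookup_form)
qed

lemma affine_val_corner:
  "affine_val x z (form m n (corner (\<alpha>, \<beta>, \<gamma>, \<delta>))) = \<alpha> + \<beta> * x ^ m + \<gamma> * z ^ n + \<delta> * (x ^ m * z ^ n)"
  using sum_corner[of \<alpha> \<beta> \<gamma> \<delta> "\<lambda>a. x ^ fst a * z ^ snd a"] by (simp only: affine_val_form) simp

text \<open>Both triples span the forms $1$, $X+Z$, $XZ$ for every $t$, and these have no common zero on
$\mathbb{P}^1 \times \mathbb{P}^1$.\<close>

lemma corner_no_common_zero: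
  assumes "form m n (\<lambda>a. c (1, a)) = form m n (corner p1)" "form m n (\<lambda>a. c (2, a)) = form m n (corner p2)"
    "form m n (\<lambda>a. c (3, a)) = form m n (corner p3)"
    and "(p1, p2, p3) = ((1, 0, 0, 0), (0, 1, 1, 0), (0, 0, 0, 1)) \<or>
      (p1, p2, p3) = ((0, 1, 1, 0), (0, t, t, 1), (1, 0, 0, t))"
  shows "\<not> common_zero m n (map (\<lambda>i. form m n (\<lambda>a. c (i, a))) [1, 2, 3])"
proof
  assume "common_zero m n (map (\<lambda>i. form m n (\<lambda>a. c (i, a))) [1, 2, 3])"
  then obtain x1 y1 x2 y2 where P: "(x1, y1) \<noteq> (0, 0)" "(x2, y2) \<noteq> (0, 0)"
    "bihom m n (form m n (corner p1)) (x1, y1) (x2, y2) = 0"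
    "bihom m n (form m n (corner p2)) (x1, y1) (x2, y2) = 0"
    "bihom m n (form m n (corner p3)) (x1, y1) (x2, y2) = 0"
    unfolding common_zero_def using assms(1-3) by auto
  let ?a = "y1 ^ m * y2 ^ n" and ?b = "x1 ^ m * y2 ^ n" and ?c = "y1 ^ m * x2 ^ n" and ?d = "x1 ^ m * x2 ^ n"
  have "?a = 0 \<and> ?b + ?c = 0 \<and> ?d = 0"
    using assms(4)
  proof
    assume "(p1, p2, p3) = ((1, 0, 0, 0), (0, 1, 1, 0), (0, 0, 0, 1))"
    then show ?thesis using P(3-5) by (auto simp: bihom_corner)
  next
    assume p: "(p1, p2, p3) = ((0, 1, 1, 0), (0, t, t, 1), (1, 0, 0, t))"
    then have s: "?b + ?c = 0" using P(3) by (auto simp: bihom_corner)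
    have "t * (?b + ?c) + ?d = 0" using P(4) p by (simp add: bihom_corner algebra_simps)
    then have d: "?d = 0" unfolding s by simp
    have "?a + t * ?d = 0" using P(5) p by (simp add: bihom_corner algebra_simps)
    then show ?thesis using s d unfolding d by simp
  qed
  then show False using P(1,2) m n by (auto simp: zero_power)
qed

end

section \<open>A pencil with simple zeros\<close>

definition root_poly :: "nat \<Rightarrow> nat \<Rightarrow> complex poly" where
  "root_poly d N = (\<Prod>i<N. [:- of_nat (d + i), 1:])"

lemma degree_root_poly: "degree (root_poly d N) = N"
  by (simp add: root_poly_def degree_prod_eq_sum_degree)

lemma lead_root_poly: "coeff (root_poly d N) N = 1"
proof -
  have "lead_coeff (root_poly d N) = 1"
    unfolding root_poly_def lead_coeff_prod by simp
  then show ?thesis by (simp add: degree_root_poly)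
qed

lemma root_poly_zero: "poly (root_poly d N) x = 0 \<longleftrightarrow> (\<exists>i<N. x = of_nat (d + i))"
proof -
  have "poly [:- of_nat (d + i), 1:] x = 0 \<longleftrightarrow> x = of_nat (d + i)" for i
    by (simp only: poly_pCons poly_0) (simp add: algebra_simps flip: of_nat_add)
  then show ?thesis by (auto simp only: root_poly_def poly_prod prod_zero_iff finite_lessThan lessThan_iff)
qed

text \<open>The value of the binary form of degree \<open>N\<close> that dehomogenizes to \<open>p\<close>.\<close>

definition hom_eval :: "complex poly \<Rightarrow> nat \<Rightarrow> complex \<Rightarrow> complex \<Rightarrow> complex" where
  "hom_eval p N x y = (\<Sum>i\<in>{0..N}. coeff p i * x ^ i * y ^ (N - i))"

lemma hom_eval_affine:
  assumes "degree p \<le> N" "y \<noteq> 0"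
  shows "hom_eval p N x y = y ^ N * poly p (x / y)"
proof -
  have "poly p (x / y) = (\<Sum>i\<in>{0..N}. coeff p i * (x / y) ^ i)"
    unfolding poly_altdef using assms(1)
    by (intro sum.mono_neutral_left) (auto simp: coeff_eq_0)
  moreover have "y ^ N * (coeff p i * (x / y) ^ i) = coeff p i * x ^ i * y ^ (N - i)" if "i \<in> {0..N}" for i
    using that assms(2) by (simp add: power_diff power_divide)
  ultimately show ?thesis unfolding hom_eval_def by (simp only: sum_distrib_left cong: sum.cong)
qed

lemma hom_eval_infinity: "hom_eval p N x 0 = coeff p N * x ^ N"
proof -
  have "hom_eval p N x 0 = (\<Sum>i\<in>{0..N}. if i = N then coeff p i * x ^ i else 0)"
    unfolding hom_eval_def by (rule sum.cong) (auto simp: power_0_left)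
  then show ?thesis by simp
qed

lemma hom_eval_root_poly:
  assumes "hom_eval (root_poly d N) N x y = 0" "(x, y) \<noteq> (0, 0)"
  shows "y \<noteq> 0 \<and> (\<exists>i<N. x / y = of_nat (d + i))"
proof -
  have "y \<noteq> 0"
  proof
    assume "y = 0"
    with assms show False by (auto simp: hom_eval_infinity lead_root_poly)
  qed
  with assms(1) show ?thesis
    by (simp add: hom_eval_affine degree_root_poly root_poly_zero)
qed

context bideg
begin

lemma bihom_product:
  "bihom m n (form m n (\<lambda>a. coeff p (fst a) * coeff q (snd a))) (x1, y1) (x2, y2) =
     hom_eval p m x1 y1 * hom_eval q n x2 y2"
  unfolding bihom_form hom_eval_def sum_product exp_box_def sum.cartesian_product
  by (rule sum.cong) (auto simp: mult_ac)

lemma bihom_affine: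
  assumes "y1 \<noteq> 0" "y2 \<noteq> 0"
  shows "bihom m n (form m n u) (x1, y1) (x2, y2) = y1 ^ m * y2 ^ n * affine_val (x1 / y1) (x2 / y2) (form m n u)"
proof -
  have "u a * x1 ^ fst a * y1 ^ (m - fst a) * x2 ^ snd a * y2 ^ (n - snd a) =
      y1 ^ m * y2 ^ n * (u a * ((x1 / y1) ^ fst a * (x2 / y2) ^ snd a))" if "a \<in> exp_box m n" for a
  proof -
    have "fst a \<le> m" "snd a \<le> n" using that by (auto simp: exp_box_def)
    then show ?thesis using assms by (simp add: power_diff power_divide)
  qed
  then show ?thesis unfolding bihom_form affine_val_form by (simp only: sum_distrib_left cong: sum.cong)
qed

lemma affine_val_product:
  assumes "degree p \<le> m" "degree q \<le> n"
  shows "affine_val x z (form m n (\<lambda>a. coeff p (fst a) * coeff q (snd a))) = poly p x * poly q z"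
proof -
  have "bihom m n (form m n (\<lambda>a. coeff p (fst a) * coeff q (snd a))) (x, 1) (z, 1) = poly p x * poly q z"
    unfolding bihom_product using assms by (simp add: hom_eval_affine)
  then show ?thesis by (simp add: bihom_affine)
qed

definition line_form :: "complex \<Rightarrow> expo \<Rightarrow> complex" where
  "line_form s a = (if a = (0, 0) then s else 0) - (if a = (1, 0) then 1 else 0) -
     (if a = (0, 1) then 2 * of_nat m else 0)"

lemma affine_val_line: "affine_val x z (form m n (line_form s)) = s - x - 2 * of_nat m * z"
proof -
  have *: "finite (exp_box m n)" "(0, 0) \<in> exp_box m n" "(1, 0) \<in> exp_box m n" "(0, 1) \<in> exp_box m n"
    using m n by (auto simp: exp_box_def)
  have "affine_val x z (form m n (line_form s)) = (\<Sum>a\<in>exp_box m n. (if a = (0, 0) then s * (x ^ fst a * z ^ snd a) else 0) -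
      (if a = (1, 0) then x ^ fst a * z ^ snd a else 0) - (if a = (0, 1) then 2 * of_nat m * (x ^ fst a * z ^ snd a) else 0))"
    unfolding affine_val_form line_form_def by (rule sum.cong) auto
  also have "\<dots> = s - x - 2 * of_nat m * z" using * by (simp add: sum_subtractf)
  finally show ?thesis .
qed

text \<open>The forms $F_1 = s - x_1 - 2m x_2$, $F_2 = f(x_1) g(x_2)$ and $F_3 = h(x_1) k(x_2)$, where the roots of
$f, h$ are $0,\dots,m-1$ and $m,\dots,2m-1$, and those of $k, g$ are $0,\dots,n-1$ and $n,\dots,2n-1$.  The
common zeros of $F_2$ and $F_3$ are the $2mn$ points of \<open>grid\<close>, and the linear form $x_1 + 2m x_2$ takes
different values at them.\<close>

definition grid_point :: "complex \<Rightarrow> cvar \<Rightarrow> complex" where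
  "grid_point s = (\<lambda>(i, a). if i = 1 then line_form s a
     else if i = 2 then coeff (root_poly 0 m) (fst a) * coeff (root_poly n n) (snd a)
     else if i = 3 then coeff (root_poly m m) (fst a) * coeff (root_poly 0 n) (snd a) else 0)"

definition grid :: "(nat \<times> nat) set" where
  "grid = {0..<m} \<times> {0..<n} \<union> {m..<2 * m} \<times> {n..<2 * n}"

definition grid_roots :: "complex set" where
  "grid_roots = (\<lambda>(x, z). of_nat (x + 2 * m * z)) ` grid"

lemma frm_grid_point:
  "frm (grid_point s) 1 = form m n (line_form s)"
  "frm (grid_point s) 2 = form m n (\<lambda>a. coeff (root_poly 0 m) (fst a) * coeff (root_poly n n) (snd a))"
  "frm (grid_point s) 3 = form m n (\<lambda>a. coeff (root_poly m m) (fst a) * coeff (root_poly 0 n) (snd a))"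
  by (simp_all add: frm_def grid_point_def)

lemma card_grid_roots: "card grid_roots = 2 * M"
proof -
  have "inj_on (\<lambda>(x, z). of_nat (x + 2 * m * z) :: complex) grid"
  proof (rule inj_onI, clarify)
    fix x z x' z' assume "(x, z) \<in> grid" "(x', z') \<in> grid"
      and e: "(of_nat (x + 2 * m * z) :: complex) = of_nat (x' + 2 * m * z')"
    then have x: "x < 2 * m" "x' < 2 * m" by (auto simp: grid_def)
    from e have e': "x + 2 * m * z = x' + 2 * m * z'" by (simp only: of_nat_eq_iff)
    have "(x + 2 * m * z) mod (2 * m) = x" "(x' + 2 * m * z') mod (2 * m) = x'" using x by simp_all
    with e' have "x = x'" by metis
    with e' m show "x = x' \<and> z = z'" by simp
  qed
  then have "card grid_roots = card grid" unfolding grid_roots_def by (rule card_image)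
  also have "\<dots> = 2 * M" unfolding grid_def
    by (subst card_Un_disjoint) (auto simp: card_cartesian_product)
  finally show ?thesis .
qed

lemma grid_common_zero:
  assumes "s \<in> grid_roots"
  shows "\<exists>x z. \<forall>i\<in>{1, 2, 3}. affine_val x z (frm (grid_point s) i) = 0"
proof -
  obtain x z where xz: "(x, z) \<in> grid" "s = of_nat (x + 2 * m * z)" using assms by (auto simp: grid_roots_def)
  have "affine_val (of_nat x) (of_nat z) (frm (grid_point s) 1) = 0"
    by (simp only: frm_grid_point affine_val_line xz(2)) simp
  moreover have "poly (root_poly 0 m) (of_nat x) * poly (root_poly n n) (of_nat z) = 0"
    using xz(1) by (auto simp: grid_def root_poly_zero simp flip: of_nat_add intro: exI[of _ "z - n"])
  moreover have "poly (root_poly m m) (of_nat x) * poly (root_poly 0 n) (of_nat z) = 0"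
    using xz(1) by (auto simp: grid_def root_poly_zero simp flip: of_nat_add intro: exI[of _ "x - m"])
  ultimately show ?thesis
    by (intro exI[of _ "of_nat x"] exI[of _ "of_nat z"])
      (auto simp: frm_grid_point affine_val_product degree_root_poly simp del: One_nat_def)
qed

lemma grid_no_common_zero:
  assumes s: "s \<notin> grid_roots"
  shows "\<not> common_zero m n (map (\<lambda>i. form m n (\<lambda>a. grid_point s (i, a))) [1, 2, 3])"
proof
  assume "common_zero m n (map (\<lambda>i. form m n (\<lambda>a. grid_point s (i, a))) [1, 2, 3])"
  then have "common_zero m n [frm (grid_point s) 1, frm (grid_point s) 2, frm (grid_point s) 3]"
    by (simp add: frm_def)
  then obtain x1 y1 x2 y2 where P: "(x1, y1) \<noteq> (0, 0)" "(x2, y2) \<noteq> (0, 0)"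
    "bihom m n (form m n (line_form s)) (x1, y1) (x2, y2) = 0"
    "hom_eval (root_poly 0 m) m x1 y1 * hom_eval (root_poly n n) n x2 y2 = 0"
    "hom_eval (root_poly m m) m x1 y1 * hom_eval (root_poly 0 n) n x2 y2 = 0"
    unfolding common_zero_def frm_grid_point bihom_product[symmetric] by auto
  note h1 = hom_eval_root_poly[OF _ P(1)] and h2 = hom_eval_root_poly[OF _ P(2)]
  have disj: False if "w = of_nat (0 + i)" "w = of_nat (N + j)" "i < N" for w :: complex and i j N :: nat
  proof -
    have "of_nat (0 + i) = (of_nat (N + j) :: complex)" using that(1,2) by (rule subst)
    then have "0 + i = N + j" by (simp only: of_nat_eq_iff)
    with that(3) show False by simp
  qed
  have fin: "s \<in> grid_roots" if "y1 \<noteq> 0" "y2 \<noteq> 0" "x1 / y1 = of_nat x" "x2 / y2 = of_nat z" "(x, z) \<in> grid" for x z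
  proof -
    have "affine_val (x1 / y1) (x2 / y2) (form m n (line_form s)) = 0" using P(3) that(1,2) by (simp add: bihom_affine)
    then have "s = of_nat (x + 2 * m * z)" unfolding affine_val_line that(3,4) by (simp add: algebra_simps)
    with that(5) show ?thesis unfolding grid_roots_def by force
  qed
  from P(4,5) consider
    "hom_eval (root_poly 0 m) m x1 y1 = 0" "hom_eval (root_poly m m) m x1 y1 = 0"
    | "hom_eval (root_poly 0 m) m x1 y1 = 0" "hom_eval (root_poly 0 n) n x2 y2 = 0"
    | "hom_eval (root_poly n n) n x2 y2 = 0" "hom_eval (root_poly m m) m x1 y1 = 0"
    | "hom_eval (root_poly n n) n x2 y2 = 0" "hom_eval (root_poly 0 n) n x2 y2 = 0"
    by auto
  then show False
  proof cases
    case 1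
    with h1[OF 1(1)] h1[OF 1(2)] disj show False by blast
  next
    case 2
    with h1[OF 2(1)] h2[OF 2(2)] obtain i j where "y1 \<noteq> 0" "y2 \<noteq> 0" "i < m" "j < n"
      "x1 / y1 = of_nat i" "x2 / y2 = of_nat j" by auto
    with fin[of i j] s show False by (auto simp: grid_def)
  next
    case 3
    with h2[OF 3(1)] h1[OF 3(2)] obtain i j where "y1 \<noteq> 0" "y2 \<noteq> 0" "i < m" "j < n"
      "x1 / y1 = of_nat (m + i)" "x2 / y2 = of_nat (n + j)" by blast
    with fin[of "m + i" "n + j"] s show False by (auto simp: grid_def)
  next
    case 4
    with h2[OF 4(1)] h2[OF 4(2)] disj show False by blast
  qed
qed

lemma minus_one_not_grid_root: "-1 \<notin> grid_roots"
proof
  assume "-1 \<in> grid_roots"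
  then obtain k :: nat where "(-1 :: complex) = of_nat k"
    unfolding grid_roots_def by (auto simp del: of_nat_add of_nat_mult)
  then have "of_nat (k + 1) = (0 :: complex)" by (metis add.commute add_eq_0_iff2 of_nat_1 of_nat_add)
  then show False by (simp only: of_nat_eq_0_iff)
qed

end

section \<open>The quotient of the determinants\<close>

lemma const_poly_hom: "comm_ring_hom (\<lambda>a :: 'a :: comm_ring_1. [:a:])"
  by unfold_locales (simp_all add: pCons_one)

lemma int_unit_cases: "\<exists>y. x * y = 1 \<Longrightarrow> x = 1 \<or> x = (-1 :: int)"
  using zmult_eq_1_iff by auto

context bideg
begin

abbreviation detF :: cpoly where "detF \<equiv> F_det indet"
abbreviation detQ :: cpoly where "detQ \<equiv> Q_det indet"

lemma ev_F_det: "ev c detF = F_det c"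
  using F_det_hom[OF ev_hom, of c indet] by simp

lemma ev_Q_det: "ev c detQ = Q_det c"
  using Q_det_hom[OF ev_hom, of c indet] by simp

lemma ev_stacked_det: "ev c (stacked_det indet) = stacked_det c"
  using stacked_det_hom[OF ev_hom, of c indet] by simp

lemma ev_koszul_det: "ev c (koszul_det indet) = koszul_det c"
  using koszul_det_hom[OF ev_hom, of c indet] by simp

text \<open>The forms $1$, $X+Z$, $XZ$, $X$, at which both generic determinants are $\pm 1$.\<close>

definition base_corners :: "nat \<Rightarrow> 'r :: comm_ring_1 \<times> 'r \<times> 'r \<times> 'r" where
  "base_corners i = (if i = 1 then (1, 0, 0, 0) else if i = 2 then (0, 1, 1, 0)
     else if i = 3 then (0, 0, 0, 1) else if i = 4 then (0, 1, 0, 0) else (0, 0, 0, 0))"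

abbreviation base_point :: "cvar \<Rightarrow> 'r :: comm_ring_1" where
  "base_point \<equiv> corner_point base_corners"

lemma of_int_base_point: "of_int (base_point v) = base_point v"
  by (auto simp: corner_point_def base_corners_def split: prod.split)

lemma F_det_base_point: "F_det base_point = (1 :: 'r :: comm_ring_1) \<or> F_det base_point = (-1 :: 'r)"
proof -
  have "F_det base_point = (1 :: int) \<or> F_det base_point = (-1 :: int)"
    by (rule int_unit_cases, rule F_det_unit_base) (simp_all add: base_corners_def)
  moreover have "of_int (F_det base_point) = (F_det base_point :: 'r)"
    using F_det_hom[OF of_int_hom, of base_point] by (simp add: of_int_base_point)
  ultimately show ?thesis by (metis of_int_1 of_int_minus)
qed

lemma Q_det_base_point: "Q_det base_point = (1 :: 'r :: comm_ring_1) \<or> Q_det base_point = (-1 :: 'r)"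
proof -
  have "Q_det base_point = (1 :: int) \<or> Q_det base_point = (-1 :: int)"
    by (rule int_unit_cases, rule Q_det_unit_base) (simp_all add: base_corners_def)
  moreover have "of_int (Q_det base_point) = (Q_det base_point :: 'r)"
    using Q_det_hom[OF of_int_hom, of base_point] by (simp add: of_int_base_point)
  ultimately show ?thesis by (metis of_int_1 of_int_minus)
qed

lemma base_point_no_common_zero:
  "\<not> common_zero m n (map (\<lambda>i. form m n (\<lambda>a. base_point (i, a))) [1, 2, 3])"
  by (rule corner_no_common_zero[of _ "(1, 0, 0, 0)" "(0, 1, 1, 0)" "(0, 0, 0, 1)"])
    (simp_all add: corner_point_def base_corners_def del: corner.simps)

lemma detF_nonzero: "detF \<noteq> 0"
  using F_det_base_point[where 'r = int] ev_F_det[of "base_point :: cvar \<Rightarrow> int"] by auto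

lemma stacked_koszul_det_nonzero: "(stacked_det indet :: cpoly) \<noteq> 0" "(koszul_det indet :: cpoly) \<noteq> 0"
proof -
  obtain u :: "cvar \<Rightarrow> complex" where u: "\<And>i a. i < 6 \<Longrightarrow> u (i, a) = base_point (i, a)" "stacked_det u \<noteq> 0"
    using stacked_det_nonzero_if_no_common_zero[OF base_point_no_common_zero] by blast
  have "F_det u = F_det (base_point :: cvar \<Rightarrow> complex)" by (rule F_det_cong) (auto simp: u(1))
  then have "F_det u \<noteq> 0" using F_det_base_point[where 'r = complex] by auto
  then have "koszul_det u \<noteq> 0" using stacked_identity[of u] u(2) by auto
  then show "(stacked_det indet :: cpoly) \<noteq> 0" "(koszul_det indet :: cpoly) \<noteq> 0"
    using u(2) ev_stacked_det[of u] ev_koszul_det[of u] by auto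
qed

definition F5_for_F4 :: "cvar \<Rightarrow> cpoly" where
  "F5_for_F4 = (\<lambda>(i, a). indet (if i = 4 then 5 else i, a))"

text \<open>Since the outer factors of \<open>stacked_identity\<close> do not involve $F_4$, they can be eliminated between
the identity and its image under $F_4 \mapsto F_5$.\<close>

lemma exchange_identity: "detQ * ev F5_for_F4 detF ^ 3 = ev F5_for_F4 detQ * detF ^ 3"
proof -
  let ?a = "stacked_det indet :: cpoly" and ?b = "koszul_det indet :: cpoly"
  have a: "ev F5_for_F4 ?a = ?a" unfolding ev_stacked_det by (rule stacked_det_cong) (auto simp: F5_for_F4_def)
  have b: "ev F5_for_F4 ?b = ?b" unfolding ev_koszul_det by (rule koszul_det_cong) (auto simp: F5_for_F4_def)
  obtain e :: cpoly where e1: "e = 1 \<or> e = -1" and e: "?a * detF ^ 3 = e * (detQ * ?b)"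
  proof -
    from stacked_identity[of "indet :: cvar \<Rightarrow> cpoly"] show ?thesis
    proof
      assume "?a * detF ^ 3 = detQ * ?b"
      then show ?thesis by (intro that[of 1]) simp_all
    next
      assume "?a * detF ^ 3 = - (detQ * ?b)"
      then show ?thesis by (intro that[of "-1"]) simp_all
    qed
  qed
  then have "ev F5_for_F4 e = e" by (auto simp: ev.hom_uminus)
  then have s: "?a * ev F5_for_F4 detF ^ 3 = e * (ev F5_for_F4 detQ * ?b)"
    using arg_cong[OF e, of "ev F5_for_F4"] by (simp add: ev_mult ev.hom_power a b)
  have "?a * ?b * (detQ * ev F5_for_F4 detF ^ 3) = detQ * ?b * (?a * ev F5_for_F4 detF ^ 3)" by (simp only: mult_ac)
  also have "\<dots> = (e * (detQ * ?b)) * (ev F5_for_F4 detQ * ?b)" unfolding s by (simp only: mult_ac)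
  also have "\<dots> = ?a * ?b * (ev F5_for_F4 detQ * detF ^ 3)" unfolding e[symmetric] by (simp only: mult_ac)
  finally show ?thesis using stacked_koszul_det_nonzero by simp
qed

definition first4 :: "cvar set" where "first4 = {1, 2, 3, 4} \<times> UNIV"

definition base_dir :: "cvar \<Rightarrow> cpoly" where
  "base_dir v = (if v \<in> first4 then base_point v else 0)"

lemma scaled_assignment:
  "(\<lambda>v. if v \<in> I \<times> UNIV then [:0, indet v:] else [:indet v:]) =
   (\<lambda>(i, a). (if i \<in> I then [:0, 1:] else 1) * [:indet (i, a) :: cpoly:])"
  by (auto simp: fun_eq_iff)

lemma x_power: "[:0, 1:] ^ k * [:a:] = monom (a :: cpoly) k"
  by (simp add: monom_altdef mult.commute)

lemma F_det_scaled: "F_det (\<lambda>(i, a). \<tau> i * [:indet (i, a) :: cpoly:]) = (\<tau> 1 * \<tau> 2 * \<tau> 3 * \<tau> 4) ^ M * [:detF:]"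
  using F_det_scale[of \<tau> "\<lambda>v. [:indet v:]"] F_det_hom[OF const_poly_hom, of "indet :: cvar \<Rightarrow> cpoly"] by simp

lemma Q_det_scaled: "Q_det (\<lambda>(i, a). \<tau> i * [:indet (i, a) :: cpoly:]) = ((\<tau> 1 * \<tau> 2 * \<tau> 3) ^ 5 * \<tau> 4 ^ 3) ^ M * [:detQ:]"
  using Q_det_scale[of \<tau> "\<lambda>v. [:indet v:]"] Q_det_hom[OF const_poly_hom, of "indet :: cvar \<Rightarrow> cpoly"] by simp

lemma detF_cubed_homog: "homog first4 (12 * M) (detF ^ 3)"
proof (rule homogI)
  have "ev (\<lambda>v. if v \<in> first4 then [:0, indet v:] else [:indet v:]) (detF ^ 3) = (([:0, 1:] ^ 4) ^ M * [:detF:]) ^ 3"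
    unfolding first4_def scaled_assignment ev.hom_power ev_F_det F_det_scaled
    by (simp add: power4_eq_xxxx mult_ac)
  also have "\<dots> = [:0, 1:] ^ (12 * M) * [:detF ^ 3:]"
    by (simp only: power_mult_distrib poly_const_pow power_mult[symmetric]) (simp add: mult_ac)
  finally show "ev (\<lambda>v. if v \<in> first4 then [:0, indet v:] else [:indet v:]) (detF ^ 3) = monom (detF ^ 3) (12 * M)"
    by (simp only: x_power)
qed

lemma along_base: "ev (\<lambda>v. if v \<in> first4 then base_dir v else indet v) p =
    ev (\<lambda>v. if v \<in> first4 then base_point v else indet v) p"
  by (rule arg_cong[of _ _ "\<lambda>c. ev c p"]) (auto simp: base_dir_def)

lemma F_det_along_base: "F_det (\<lambda>v. if v \<in> first4 then base_point v else indet v :: cpoly) = F_det base_point"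
  by (rule F_det_cong) (auto simp: first4_def)

lemma Q_det_along_base: "Q_det (\<lambda>v. if v \<in> first4 then base_point v else indet v :: cpoly) = Q_det base_point"
  by (rule Q_det_cong) (auto simp: first4_def)

lemma corner_add_scale:
  "corner (a1, a2, a3, a4) x + t * corner (b1, b2, b3, b4) x = corner (a1 + t * b1, a2 + t * b2, a3 + t * b3, a4 + t * b4) x"
  by (simp add: algebra_simps)

text \<open>Cancels the factor \<open>ev F5_for_F4 detF ^ 3\<close> in \<open>exchange_identity\<close>.  On the special line this factor is
the determinant at the forms of \<open>F_det_unit_cyclic\<close>, hence never zero.\<close>

lemma detF_cubed_dvd_detQ: "detF ^ 3 dvd detQ"
proof -
  \<comment> \<open>Along the direction \<open>base_dir\<close> these become the forms of \<open>F_det_unit_cyclic\<close>, with $F_5 = 1$ as the last one.\<close>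
  define K :: "nat \<Rightarrow> complex \<times> complex \<times> complex \<times> complex" where
    "K i = (if i = 1 then (0, 1, 1, 0) else if i = 2 then (0, 0, 0, 1) else if i = 3 then (0, 1, 0, 0)
       else if i = 5 then (1, 0, 0, 0) else (0, 0, 0, 0))" for i
  show ?thesis
  proof (rule cancel_coprime_factor)
    show "detF ^ 3 * ev F5_for_F4 detQ = ev F5_for_F4 detF ^ 3 * detQ" using exchange_identity by (simp only: mult_ac)
    show "homog first4 (12 * M) (detF ^ 3)" by (rule detF_cubed_homog)
    show "12 * M > 0" using m n by simp
    show "base_dir v = 0" if "v \<notin> first4" for v using that by (simp add: base_dir_def)
    have "along first4 base_dir (detF ^ 3) = F_det base_point ^ 3"
      unfolding along_def along_base ev.hom_power ev_F_det F_det_along_base ..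
    then show "along first4 base_dir (detF ^ 3) = 1 \<or> along first4 base_dir (detF ^ 3) = -1"
      using F_det_base_point[where 'r = cpoly] by (auto simp: power3_eq_cube)
    show "ev (\<lambda>v. corner_point K v + t * ev (corner_point K) (base_dir v)) (ev F5_for_F4 detF ^ 3) \<noteq> 0" for t :: complex
    proof -
      let ?y = "\<lambda>v. corner_point K v + t * ev (corner_point K) (base_dir v)"
      define L :: "nat \<Rightarrow> complex \<times> complex \<times> complex \<times> complex" where
        "L i = (if i = 1 then (t, 1, 1, 0) else if i = 2 then (0, t, t, 1) else if i = 3 then (0, 1, 0, t)
          else (1, 0, 0, 0))" for i
      have bp: "ev (corner_point K) (base_point v :: cpoly) = base_point v" for v
        using ev.hom_of_int[of "corner_point K" "base_point v"] by (simp only: of_int_base_point)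
      have "F_det (\<lambda>v. ev ?y (F5_for_F4 v)) = F_det (corner_point L)"
      proof (rule F_det_cong)
        fix i :: nat and a :: expo assume i: "i \<in> {1, 2, 3, 4}"
        show "ev ?y (F5_for_F4 (i, a)) = corner_point L (i, a)"
        proof (cases "i = 4")
          case True
          then show ?thesis
            by (simp add: F5_for_F4_def base_dir_def first4_def corner_point_def K_def L_def)
        next
          case False
          then have "i \<in> {1, 2, 3}" using i by auto
          then have "ev ?y (F5_for_F4 (i, a)) = corner (K i) a + t * corner (base_corners i) a"
            by (simp add: F5_for_F4_def base_dir_def first4_def bp False)
              (simp add: corner_point_def)
          also have "\<dots> = corner (L i) a"
            using \<open>i \<in> {1, 2, 3}\<close> by (auto simp: K_def L_def base_corners_def corner_add_scale simp del: corner.simps)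
          finally show ?thesis by (simp add: corner_point_def)
        qed
      qed
      moreover have "\<exists>y. F_det (corner_point L) * y = 1"
        by (rule F_det_unit_cyclic[of L t]) (simp_all add: L_def)
      ultimately have "F_det (\<lambda>v. ev ?y (F5_for_F4 v)) \<noteq> 0" by auto
      then show ?thesis by (simp add: ev.hom_power ev_F_det F_det_hom[OF ev_hom])
    qed
  qed
qed

text \<open>This quotient turns out to be the resultant of $F_1,F_2,F_3$ up to sign.\<close>

definition res :: cpoly where
  "res = (SOME U. detQ = detF ^ 3 * U)"

lemma detQ_factorization: "detQ = detF ^ 3 * res"
  unfolding res_def by (rule someI_ex) (use detF_cubed_dvd_detQ in \<open>auto simp: dvd_def\<close>)

lemma ev_res: "Q_det c = F_det c ^ 3 * ev c res"
proof -
  have "ev c detQ = ev c detF ^ 3 * ev c res"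
    using arg_cong[OF detQ_factorization, of "ev c"] by (simp only: ev_mult ev.hom_power)
  then show ?thesis by (simp only: ev_Q_det ev_F_det)
qed

text \<open>Substitutions that preserve the ratio of \<open>detQ\<close> and \<open>detF ^ 3\<close> preserve the quotient.\<close>

lemma res_fixed:
  assumes "ev \<rho> detQ * detF ^ 3 = detQ * ev \<rho> detF ^ 3" "ev \<rho> detF \<noteq> 0"
  shows "ev \<rho> res = res"
proof -
  have "ev \<rho> detQ = ev \<rho> detF ^ 3 * ev \<rho> res"
    using arg_cong[OF detQ_factorization, of "ev \<rho>"] by (simp only: ev_mult ev.hom_power)
  then have "ev \<rho> detF ^ 3 * ev \<rho> res * detF ^ 3 = detF ^ 3 * res * ev \<rho> detF ^ 3"
    using assms(1) by (metis detQ_factorization)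
  then have "(ev \<rho> detF ^ 3 * detF ^ 3) * ev \<rho> res = (ev \<rho> detF ^ 3 * detF ^ 3) * res" by (simp only: mult_ac)
  then show ?thesis using assms(2) detF_nonzero by simp
qed

lemma ev_F5_detF_nonzero: "ev F5_for_F4 detF \<noteq> 0"
proof -
  define c :: "cvar \<Rightarrow> int" where "c = (\<lambda>(i, a). base_point (if i = 5 then 4 else i, a))"
  have "ev c (ev F5_for_F4 detF) = F_det (\<lambda>v. ev c (F5_for_F4 v))" by (simp add: ev_F_det F_det_hom[OF ev_hom])
  also have "\<dots> = F_det base_point" by (rule F_det_cong) (auto simp: F5_for_F4_def c_def)
  finally show ?thesis using F_det_base_point[where 'r = int] by auto
qed

lemma res_F5_for_F4: "ev F5_for_F4 res = res"
  by (rule res_fixed[OF exchange_identity[symmetric] ev_F5_detF_nonzero])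

text \<open>The quotient depends on $F_1,F_2,F_3$ only.  Given two assignments that agree there, a third one takes $F_4$
from the first and $F_5$ from the second, and exchanging $F_4$ for $F_5$ leads from one to the other.\<close>

lemma res_cong:
  fixes x y :: "cvar \<Rightarrow> 'a :: comm_ring_1"
  assumes "\<And>i a. i \<in> {1, 2, 3} \<Longrightarrow> x (i, a) = y (i, a)"
  shows "ev x res = ev y res"
proof -
  define \<kappa> :: "cvar \<Rightarrow> cpoly" where "\<kappa> v = (if v \<in> first4 then indet v else 0)" for v
  have "ev \<kappa> detF = detF" unfolding ev_F_det by (rule F_det_cong) (auto simp: \<kappa>_def first4_def)
  moreover have "ev \<kappa> detQ = detQ" unfolding ev_Q_det by (rule Q_det_cong) (auto simp: \<kappa>_def first4_def)
  ultimately have k: "ev \<kappa> res = res" using detF_nonzero by (intro res_fixed) simp_all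
  have four: "ev u res = ev v res" if "\<And>i a. i \<in> {1, 2, 3, 4} \<Longrightarrow> u (i, a) = v (i, a)" for u v :: "cvar \<Rightarrow> 'a"
  proof -
    have "ev u res = ev u (ev \<kappa> res)" by (simp only: k)
    also have "\<dots> = ev (\<lambda>w. ev u (\<kappa> w)) res" by (rule ev_compose)
    also have "(\<lambda>w. ev u (\<kappa> w)) = (\<lambda>w. ev v (\<kappa> w))"
      using that by (auto simp: fun_eq_iff \<kappa>_def first4_def)
    also have "ev (\<lambda>w. ev v (\<kappa> w)) res = ev v (ev \<kappa> res)" by (rule ev_compose[symmetric])
    finally show ?thesis by (simp only: k)
  qed
  \<comment> \<open>$F_4$ from \<open>x\<close>, $F_5$ from \<open>y\<close>\<close>
  define z where "z = (\<lambda>(i, a). if i = 5 then y (4 :: nat, a :: expo) else x (i, a))"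
  have "ev x res = ev z res" by (rule four) (auto simp: z_def)
  also have "\<dots> = ev z (ev F5_for_F4 res)" by (simp only: res_F5_for_F4)
  also have "\<dots> = ev (\<lambda>w. ev z (F5_for_F4 w)) res" by (rule ev_compose)
  also have "\<dots> = ev y res" by (rule four) (use assms in \<open>auto simp: F5_for_F4_def z_def\<close>)
  finally show ?thesis .
qed

text \<open>\<open>detF\<close> has degree $M$ in each form, and \<open>detQ\<close> has degree $5M$ in $F_1,F_2,F_3$ and $3M$ in $F_4$; the
quotient has degree $2M$ in each of $F_1,F_2,F_3$ and degree $0$ in $F_4$.\<close>

lemma res_scaled:
  assumes nz: "\<tau> 1 \<noteq> 0" "\<tau> 2 \<noteq> 0" "\<tau> 3 \<noteq> 0" "\<tau> 4 \<noteq> 0"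
  shows "ev (\<lambda>(i, a). \<tau> i * [:indet (i, a) :: cpoly:]) res = (\<tau> 1 * \<tau> 2 * \<tau> 3) ^ (2 * M) * [:res:]"
proof -
  let ?c = "\<lambda>(i, a). \<tau> i * [:indet (i, a) :: cpoly:]"
  define T where "T = (\<tau> 1 * \<tau> 2 * \<tau> 3) ^ M"
  define S where "S = \<tau> 4 ^ M"
  have TS: "T \<noteq> 0" "S \<noteq> 0" using nz by (simp_all add: T_def S_def)
  have fc: "F_det ?c = T * S * [:detF:]" unfolding F_det_scaled T_def S_def by (simp add: power_mult_distrib)
  have qc: "Q_det ?c = T ^ 5 * S ^ 3 * [:detQ:]"
    unfolding Q_det_scaled T_def S_def by (simp add: power_mult_distrib flip: power_mult) (simp add: mult.commute)
  have "T ^ 5 * S ^ 3 * [:detF ^ 3 * res:] = (T * S * [:detF:]) ^ 3 * ev ?c res"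
    using ev_res[of ?c] unfolding fc qc by (simp only: detQ_factorization[symmetric])
  moreover have "[:detF ^ 3 * res:] = [:detF:] ^ 3 * [:res:]" by (simp add: poly_const_pow)
  moreover have "T ^ 5 * S ^ 3 * ([:detF:] ^ 3 * [:res:]) = (T * S * [:detF:]) ^ 3 * (T ^ 2 * [:res:])"
  proof -
    have "T ^ 5 = T ^ 3 * T ^ 2" by (simp flip: power_add)
    then show ?thesis by (simp only: power_mult_distrib mult_ac)
  qed
  ultimately have "(T * S * [:detF:]) ^ 3 * (T ^ 2 * [:res:]) = (T * S * [:detF:]) ^ 3 * ev ?c res"
    by simp
  moreover have "(T * S * [:detF:]) ^ 3 \<noteq> 0" using TS detF_nonzero by simp
  ultimately have "ev ?c res = T ^ 2 * [:res:]" by (simp only: mult_cancel_left) simp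
  then show ?thesis unfolding T_def by (simp only: power_mult[symmetric] mult.commute)
qed

lemma res_homog: "homog first4 (6 * M) res"
proof (rule homogI)
  have "ev (\<lambda>v. if v \<in> first4 then [:0, indet v:] else [:indet v:]) res = ([:0, 1:] ^ 3) ^ (2 * M) * [:res:]"
    unfolding first4_def scaled_assignment by (subst res_scaled) (simp_all add: power3_eq_cube mult_ac)
  then show "ev (\<lambda>v. if v \<in> first4 then [:0, indet v:] else [:indet v:]) res = monom res (6 * M)"
    by (simp only: power_mult[symmetric] x_power) (simp add: mult_ac)
qed

lemma res_homog_1: "homog ({1} \<times> UNIV) (2 * M) res"
proof (rule homogI)
  have "ev (\<lambda>v. if v \<in> {1} \<times> UNIV then [:0, indet v:] else [:indet v:]) res = [:0, 1:] ^ (2 * M) * [:res:]"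
    unfolding scaled_assignment by (subst res_scaled) simp_all
  then show "ev (\<lambda>v. if v \<in> {1} \<times> UNIV then [:0, indet v:] else [:indet v:]) res = monom res (2 * M)"
    by (simp only: x_power)
qed

lemma res_along_base: "along first4 base_dir res = 1 \<or> along first4 base_dir res = -1"
proof -
  have "Q_det base_point = F_det base_point ^ 3 * along first4 base_dir res"
    unfolding along_def along_base using ev_res[of "\<lambda>v. if v \<in> first4 then base_point v else indet v :: cpoly"]
    by (simp only: F_det_along_base Q_det_along_base)
  then show ?thesis
    using F_det_base_point[where 'r = cpoly] Q_det_base_point[where 'r = cpoly]
    by (auto simp: power3_eq_cube minus_equation_iff)
qed

text \<open>After cancelling \<open>detF ^ 3\<close>, \<open>stacked_identity\<close> reads \<open>stacked_det = \<plusminus> res * koszul_det\<close>, and without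
common zeros the left side is nonzero for a suitable choice of the auxiliary rows.\<close>

lemma res_nonzero:
  fixes c :: "cvar \<Rightarrow> complex"
  assumes "\<not> common_zero m n (map (\<lambda>i. form m n (\<lambda>a. c (i, a))) [1, 2, 3])"
  shows "ev c res \<noteq> 0"
proof -
  obtain u where u: "\<And>i a. i < 6 \<Longrightarrow> u (i, a) = c (i, a)" "stacked_det u \<noteq> 0"
    using stacked_det_nonzero_if_no_common_zero[OF assms] by blast
  have "stacked_det indet * detF ^ 3 = detF ^ 3 * res * koszul_det indet \<or> stacked_det indet * detF ^ 3 = - (detF ^ 3 * res * koszul_det indet)"
    using stacked_identity[of "indet :: cvar \<Rightarrow> cpoly"] by (simp only: detQ_factorization[symmetric])
  then have "detF ^ 3 * (stacked_det indet) = detF ^ 3 * (res * koszul_det indet) \<or> detF ^ 3 * (stacked_det indet) = detF ^ 3 * (- (res * koszul_det indet))"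
    by (simp only: mult_ac mult_minus_right)
  then have "stacked_det indet = res * koszul_det indet \<or> stacked_det indet = - (res * koszul_det indet)"
    using detF_nonzero by (simp only: mult_cancel_left power_eq_0_iff) blast
  then have "ev u (stacked_det indet) = ev u res * ev u (koszul_det indet) \<or> ev u (stacked_det indet) = - (ev u res * ev u (koszul_det indet))"
    by (metis ev_mult ev.hom_uminus)
  then have "ev u res \<noteq> 0" using u(2) by (auto simp: ev_stacked_det)
  moreover have "ev u res = ev c res" by (rule res_cong) (auto simp: u(1))
  ultimately show ?thesis by simp
qed

text \<open>A common zero makes \<open>Q_det\<close> vanish, but possibly \<open>F_det\<close> as well.  On the line joining \<open>c\<close> to a point \<open>G\<close> whose first
three forms vanish at the same zero, \<open>F_det\<close> is not identically zero, so the quotient vanishes on the line.\<close>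

lemma res_zero:
  fixes c :: "cvar \<Rightarrow> complex"
  assumes z: "\<And>i. i \<in> {1, 2, 3} \<Longrightarrow> affine_val x z (frm c i) = 0"
  shows "ev c res = 0"
proof -
  define K :: "nat \<Rightarrow> complex \<times> complex \<times> complex \<times> complex" where
    "K i = (if i = 1 then (- (x ^ m), 1, 0, 0) else if i = 2 then (- (z ^ n), 0, 1, 0)
    else if i = 3 then (- (x ^ m * z ^ n), 0, 0, 1) else (1, 0, 0, 0))" for i
  define G where "G = corner_point K"
  \<comment> \<open>\<open>G\<close> at parameter 0, \<open>c\<close> at parameter 1\<close>
  define l where "l v = [:G v, c v - G v:]" for v
  have Gz: "affine_val x z (frm G i) = 0" if "i \<in> {1, 2, 3}" for i
    using that unfolding frm_def G_def corner_point_def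
    by (auto simp: K_def affine_val_corner simp del: corner.simps)
  have lz: "affine_val x z (frm (\<lambda>v. poly (l v) t) i) = 0" if i: "i \<in> {1, 2, 3}" for t i
  proof -
    have "affine_val x z (frm (\<lambda>v. poly (l v) t) i) = (1 - t) * affine_val x z (frm G i) + t * affine_val x z (frm c i)"
      by (simp add: frm_def affine_val_form l_def sum_distrib_left sum.distrib[symmetric] algebra_simps)
    then show ?thesis using z[OF i] Gz[OF i] by simp
  qed
  have "poly (Q_det l) t = 0" for t
    unfolding Q_det_hom[OF poly_hom_ring] by (rule Q_det_zero) (rule lz)
  then have "Q_det l = 0" using poly_all_0_iff_0 by blast
  then have "F_det l ^ 3 * ev l res = 0" by (metis ev_res)
  moreover have "F_det l \<noteq> 0"
  proof
    assume "F_det l = 0"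
    then have "F_det (\<lambda>v. poly (l v) 0) = 0" by (metis F_det_hom[OF poly_hom_ring] poly_0)
    then have "F_det G = 0" by (simp add: l_def)
    moreover have "\<exists>y. F_det G * y = 1"
      unfolding G_def by (rule F_det_unit_through_point[of K "x ^ m" "z ^ n"]) (simp_all add: K_def)
    ultimately show False by auto
  qed
  ultimately have "ev l res = 0" by simp
  then have "ev (\<lambda>v. poly (l v) 1) res = 0" by (metis hom_ev[OF poly_hom_ring] poly_0)
  then show ?thesis by (simp add: l_def)
qed

text \<open>The direction in which $F_1$ moves along $F_5$.\<close>

definition dir_F5 :: "cvar \<Rightarrow> cpoly" where
  "dir_F5 = (\<lambda>(i, a). if i = 1 then indet (5, a) else 0)"

text \<open>On the pencil \<open>grid_point s\<close> the polynomial \<open>res\<close> has $2mn$ distinct roots, which is its degree in $F_1$, so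
\<open>radical_divides\<close> applies.  The power of the leading coefficient, \<open>res\<close> at $(F_5,F_2,F_3)$, is
removed by \<open>cancel_coprime_factor\<close>: along the line with $F_5 = X+Z$, $F_2 = XZ + t(X+Z)$, $F_3 = 1 + tXZ$
it has no zero.\<close>

lemma res_dvd:
  assumes R: "\<And>c :: cvar \<Rightarrow> complex. ev c res = 0 \<Longrightarrow> ev c R = 0"
  shows "res dvd R"
proof -
  have d: "2 * M > 0" "6 * M > 0" using m n by simp_all
  define g :: "cvar \<Rightarrow> complex" where
    "g = (\<lambda>(i, a). if i = 5 then (if a = (0, 0) then 1 else 0) else grid_point 0 (i, a))"
  have gs: "ev (\<lambda>v. g v + s * ev g (dir_F5 v)) res = ev (grid_point s) res" for s
  proof (rule res_cong)
    fix i :: nat and a :: expo assume "i \<in> {1, 2, 3}"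
    then show "g (i, a) + s * ev g (dir_F5 (i, a)) = grid_point s (i, a)"
      by (auto simp: g_def dir_F5_def grid_point_def line_form_def)
  qed
  have "\<exists>k H. along ({1} \<times> UNIV) dir_F5 res ^ k * R = res * H"
  proof (rule radical_divides[OF res_homog_1 d(1) _ card_grid_roots _ _ R])
    show "dir_F5 v = 0" if "v \<notin> {1} \<times> UNIV" for v using that by (auto simp: dir_F5_def split: prod.splits)
    show "ev (\<lambda>v. g v + s * ev g (dir_F5 v)) res = 0" if "s \<in> grid_roots" for s
      unfolding gs using grid_common_zero[OF that] res_zero by blast
    show "ev (\<lambda>v. g v + (-1) * ev g (dir_F5 v)) res \<noteq> 0"
      unfolding gs by (rule res_nonzero[OF grid_no_common_zero[OF minus_one_not_grid_root]])
  qed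
  then obtain k H where kH: "res * H = along ({1} \<times> UNIV) dir_F5 res ^ k * R" by metis
  \<comment> \<open>Along \<open>base_dir\<close>, and with $F_5$ in place of $F_1$, these become $X+Z$, $XZ + t(X+Z)$, $1 + tXZ$.\<close>
  define K :: "nat \<Rightarrow> complex \<times> complex \<times> complex \<times> complex" where
    "K i = (if i = 2 then (0, 0, 0, 1) else if i = 3 then (1, 0, 0, 0) else if i = 5 then (0, 1, 1, 0) else (0, 0, 0, 0))" for i
  show ?thesis
  proof (rule cancel_coprime_factor[OF kH res_homog d(2) _ res_along_base])
    show "base_dir v = 0" if "v \<notin> first4" for v using that by (simp add: base_dir_def)
    show "ev (\<lambda>v. corner_point K v + t * ev (corner_point K) (base_dir v)) (along ({1} \<times> UNIV) dir_F5 res ^ k) \<noteq> 0" for t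
    proof -
      let ?y = "\<lambda>v. corner_point K v + t * ev (corner_point K) (base_dir v)"
      let ?w = "\<lambda>v. ev ?y (if v \<in> {1} \<times> UNIV then dir_F5 v else indet v)"
      have bp: "ev (corner_point K) (base_point v :: cpoly) = base_point v" for v
        using ev.hom_of_int[of "corner_point K" "base_point v"] by (simp only: of_int_base_point)
      have w: "?w (1, a) = corner (0, 1, 1, 0) a" "?w (2, a) = corner (0, t, t, 1) a" "?w (3, a) = corner (1, 0, 0, t) a" for a
        by (simp_all add: dir_F5_def base_dir_def first4_def bp del: corner.simps)
          (simp_all add: corner_point_def K_def base_corners_def corner_add_scale del: corner.simps)
      have "ev ?w res \<noteq> 0"
        by (rule res_nonzero, rule corner_no_common_zero[of _ "(0, 1, 1, 0)" "(0, t, t, 1)" "(1, 0, 0, t)" t])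
          (simp_all only: w, simp)
      then show ?thesis by (simp add: along_def ev.hom_power ev_compose)
    qed
  qed
qed

text \<open>The zeros of \<open>R\<close> are the triples with a common zero and contain the zeros of \<open>res\<close>.  So \<open>res\<close>
divides \<open>R\<close>; it is not a unit, \<open>R\<close> is irreducible, and the only units are $\pm 1$.\<close>

theorem resultant_eq:
  assumes "is_resultant m n R"
  shows "R = res \<or> R = - res"
proof -
  have irr: "irreducible R" and zero: "\<And>c. specialize c R = 0 \<longleftrightarrow>
        common_zero m n (map (\<lambda>i. form m n (\<lambda>a. c (i, a))) [1, 2, 3])"
    using assms by (auto simp: is_resultant_def)
  have "res dvd R"
  proof (rule res_dvd)
    fix c :: "cvar \<Rightarrow> complex" assume "ev c res = 0"
    then have "common_zero m n (map (\<lambda>i. form m n (\<lambda>a. c (i, a))) [1, 2, 3])" using res_nonzero by blast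
    then show "ev c R = 0" using zero by (simp add: specialize_ev)
  qed
  then obtain h where h: "R = res * h" by (elim dvdE)
  have "\<not> res dvd 1"
  proof
    assume "res dvd 1"
    then obtain y where "1 = res * y" by (elim dvdE)
    then have "ev (\<lambda>_. 0 :: complex) res * ev (\<lambda>_. 0) y = 1" by (metis ev_1 ev_mult)
    moreover have "ev (\<lambda>_. 0 :: complex) res = 0"
      by (rule res_zero[of 0 0]) (simp add: frm_def affine_val_form)
    ultimately show False by simp
  qed
  then have "h dvd 1" using irreducibleD[OF irr h] by blast
  then obtain h' where "h * h' = 1" by (metis dvdE)
  from cpoly_unit[OF this] show ?thesis using h by auto
qed

end

theorem corollary2p1:
  fixes m n :: nat
    and R :: cpoly
    and bF bQ :: "cpoly bipoly list list"
    and eF eQ :: "expo list"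
  assumes "m > 0" and "n > 0"
    and "is_ordering bF (power_basis 4 (m - 1) (n - 1))"
    and "is_ordering eF (exp_box (2 * m - 1) (2 * n - 1))"
    and "is_ordering bQ (power_basis 9 (m - 1) (n - 1))"
    and "is_ordering eQ (exp_box (3 * m - 1) (3 * n - 1))"
    and "is_resultant m n R"
  shows "det (matrix_of bQ eQ (Q_map m n)) = det (matrix_of bF eF (F_map m n)) ^ 3 * R \<or>
         det (matrix_of bQ eQ (Q_map m n)) = - (det (matrix_of bF eF (F_map m n)) ^ 3 * R)"
proof -
  interpret bideg m n by unfold_locales fact+
  have g: "genF m n i = frm indet i" for i by (simp add: genF_def frm_def)
  have "F_map m n = comb_map (linear_forms indet)"
    by (simp only: F_map_def linear_forms_def g)
  then have dF: "det (matrix_of bF eF (F_map m n)) = detF \<or> det (matrix_of bF eF (F_map m n)) = - detF"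
    using det_matrix_of[of "linear_forms indet" 2 bF eF] assms(3,4) by (simp add: length_linear_forms F_det_def)
  have "Q_map m n = comb_map (quadric_forms indet)"
    by (simp only: Q_map_def quadric_forms_def g Let_def)
  then have dQ: "det (matrix_of bQ eQ (Q_map m n)) = detQ \<or> det (matrix_of bQ eQ (Q_map m n)) = - detQ"
    using det_matrix_of[of "quadric_forms indet" 3 bQ eQ] assms(5,6) by (simp add: length_quadric_forms Q_det_def)
  have main: "detQ = detF ^ 3 * R \<or> detQ = - (detF ^ 3 * R)"
    using resultant_eq[OF assms(7)] detQ_factorization by (metis mult_minus_right minus_minus)
  have "(- detF) ^ 3 = - (detF ^ 3)" by (simp add: power3_eq_cube)
  then show ?thesis using dF dQ main by (elim disjE) (simp_all only: mult_minus_left minus_minus simp_thms)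
qed

end
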